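(* For every symmetrizable Kac-Moody algebra $\mathfrak{g}$ (with index set $I$ and dominant weights $P^+$) there exist a simply-laced Kac-Moody algebra $\widehat{\mathfrak{g}}$ (with index set $\widehat{I}$) and a diagram folding $\phi\colon\widehat{I}\to I$ with scaling factors $(\gamma_a\in\mathbf{Z}_{>0}: a\in I)$ such that for every $\lambda\in P^+\cup\{\infty\}$, the crystal $\operatorname{RC}(\lambda)$ of type $\mathfrak{g}$ virtualizes in the crystal $\operatorname{RC}(\lambda^v)$ of type $\widehat{\mathfrak{g}}$ under the virtualization map $v\colon(\nu,J)\mapsto(\widehat{\nu},\widehat{J})$ defined by $$\widehat{m}^{(b)}_{\gamma_a i}=m^{(a)}_i,\qquad \widehat{J}^{(b)}_{\gamma_a i}=\gamma_a J^{(a)}_i\qquad\text{for all } a\in I,\ b\in\phi^{-1}(a),\ i\in\mathbf{Z}_{>0},$$ where $\widehat{\nu}^{(b)}$ has no parts of length not divisible by $\gamma_a$ for $b \in \phi^{-1}(a)$.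
   Context: A symmetrizable Kac-Moody algebra $\mathfrak{g}$ has index set $I$, generalized Cartan matrix $A=(A_{ab})_{a,b\in I}$, weight lattice $P$, dominant integral weights $P^+$, fundamental weights $\Lambda_a$, simple roots $\alpha_a$, simple coroots $h_a$, with $\langle h_a,\alpha_b\rangle=A_{ab}$. Objects for $\widehat{\mathfrak{g}}$ carry hats. Simply-laced means that all off-diagonal entries of the Cartan matrix are $0$ or $-1$ (and the matrix is symmetric). **Rigged configurations.** Let $\mathcal{H}=I\times\mathbf{Z}_{>0}$. A rigged partition is a finite multiset of pairs of integers $(i,x)$ with $i>0$, called strings; $i$ is the length and $x$ the rigging (or label). A rigged configuration $(\nu,J)$ is a family of rigged partitions $(\nu,J)^{(a)}$, $a\in I$; $\nu^{(a)}$ is the partition formed by the lengths, $J_i^{(a)}$ is the weakly decreasing sequence of riggings of the strings of length $i$ in $(\nu,J)^{(a)}$, and $m_i^{(a)}$ is the number of parts of $\nu^{(a)}$ equal to $i$. For $\lambda\in P^+\cup\{\infty\}$ the vacancy numbers are $$p_i^{(a)}(\nu;\lambda)=c^{(a)}-\sum_{(b,j)\in\mathcal{H}}A_{ab}\min(i,j)\,m_j^{(b)},$$ where $c^{(a)}=\langle h_a,\lambda\rangle$ (the coefficient of $\Lambda_a$ in $\lambda$) if $\lambda\in P^+$, and $c^{(a)}=0$ if $\lambda=\infty$. The colabel of a string $(i,x)$ of $(\nu,J)^{(a)}$ is $p_i^{(a)}-x$. $(\nu,J)$ is $\lambda$-valid if $x\le p_i^{(a)}(\nu;\lambda)$ for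 every $(a,i)\in\mathcal{H}$ and every label $x\in J_i^{(a)}$. **$\operatorname{RC}(\infty)$.** Let $(\nu_\emptyset,J_\emptyset)$ be the rigged configuration with no strings. $\operatorname{RC}(\infty)$ is the set of rigged configurations generated from it by the following operators $e_a,f_a$ ($a\in I$), with vacancy numbers for $\lambda=\infty$. Let $x$ be the smallest label of $(\nu,J)^{(a)}$. - $e_a$: if $x\ge 0$ (or $(\nu,J)^{(a)}$ has no strings), $e_a(\nu,J)=0$. Otherwise let $\ell$ be the minimal length of the strings in $(\nu,J)^{(a)}$ with label $x$; replace $(\ell,x)$ by $(\ell-1,x+1)$ (deleting it if $\ell-1=0$) and change all other labels so that all their colabels remain fixed. - $f_a$: if $x>0$ (or $(\nu,J)^{(a)}$ has no strings), add the string $(1,-1)$ to $(\nu,J)^{(a)}$. Otherwise let $\ell$ be the maximal length of the strings in $(\nu,J)^{(a)}$ with label $x$ and replace $(\ell,x)$ by $(\ell+1,x-1)$. In either case change all other labels so that all their colabels remain fixed. Further, $\varepsilon_a(\nu,J)=\max\{k\ge 0: e_a^k(\nu,J)\ne 0\}$, $\mathrm{wt}(\nu,J)=-\sum_{a\in I}|\nu^{(a)}|\alpha_a$, and $\varphi_a=\varepsilon_a+\langle h_a,\mathrm{wt}\rangle$. **$\operatorname{RC}(\lambda)$, $\lambda\in P^+$.** $\operatorname{RC}(\lambda)=\{(\nu,J)\in\operatorname{RC}(\infty):(\nu,J)\text{ is }\lambda\text{-valid}\}$, with weight $\lambda-\sum_{a}|\nu^{(a)}|\alpha_a$, with $e_a$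 and $\varepsilon_a$ as for $\operatorname{RC}(\infty)$, with $\varphi_a=\varepsilon_a+\langle h_a,\mathrm{wt}\rangle$ for this weight, and with $f_a(\nu,J)$ given by the following rule: let $x$ be the smallest label of $(\nu,J)^{(a)}$; if $x>0$ (or $(\nu,J)^{(a)}$ has no strings), add the string $(1,-1)$ to $(\nu,J)^{(a)}$; otherwise let $\ell$ be the maximal length of the strings in $(\nu,J)^{(a)}$ with label $x$ and replace $(\ell,x)$ by $(\ell+1,x-1)$; in either case change all other labels so that all their colabels remain fixed; except that $f_a(\nu,J)=0$ if the result is not $\lambda$-valid. **Foldings and virtualization.** A diagram folding is a surjection $\phi\colon\widehat{I}\to I$ together with scaling factors $\gamma_a\in\mathbf{Z}_{>0}$ ($a\in I$); it is required that any two distinct $b,b'\in\phi^{-1}(a)$ are not connected in the Dynkin diagram of $\widehat{\mathfrak{g}}$. It induces an injective map of weight lattices $\Psi\colon P\to\widehat{P}$ given by $\Lambda_a\mapsto\gamma_a\sum_{b\in\phi^{-1}(a)}\widehat{\Lambda}_b$, normalized so that $\alpha_a\mapsto\gamma_a\sum_{b\in\phi^{-1}(a)}\widehat{\alpha}_b$. Put $\lambda^v=\Psi(\lambda)$ for $\lambda\in P^+$ and $\infty^v=\infty$. For a crystal $\widehat{B}$ of type $\widehat{\mathfrak{g}}$ define virtual operators $$e_a^v=\prod_{b\in\phi^{-1}(a)}\widehat{e}_b^{\,\gamma_a},\qquad f_a^v=\prod_{b\in\phi^{-1}(a)}\widehat{f}_b^{\,\gamma_a}\qquad(a\in I)$$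 (the factors commute). A virtual crystal is a subset $V\subseteq\widehat{B}$ which is an abstract $U_q(\mathfrak{g})$-crystal under $e_a^v,f_a^v$, $\varepsilon_a(x)=\widehat{\varepsilon}_b(x)/\gamma_a$ and $\varphi_a(x)=\widehat{\varphi}_b(x)/\gamma_a$ for all $b\in\phi^{-1}(a)$, $x\in V$ (in particular these do not depend on $b$), and $\mathrm{wt}=\Psi^{-1}\circ\widehat{\mathrm{wt}}$. A crystal $B$ of type $\mathfrak{g}$ virtualizes in $\widehat{B}$ under a map $v$ if $v$ is a $U_q(\mathfrak{g})$-crystal isomorphism from $B$ onto a virtual crystal $V\subseteq\widehat{B}$. *)

theory Defs
  imports Main "HOL-Library.Multiset"
begin

section \<open>Kac--Moody data\<close>

text \<open>
  A Kac--Moody algebra enters only through its Cartan datum. The weight lattice and its dual are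
  free abelian of the same finite rank, and both are taken in coordinates: integer vectors
  \<open>nat \<Rightarrow> int\<close> supported on \<open>{..<lrank C}\<close>, with the standard pairing.
\<close>

type_synonym lvec = "nat \<Rightarrow> int"

record 'i cartan_datum =
  idx    :: "'i set"
  cmat   :: "'i \<Rightarrow> 'i \<Rightarrow> int"
  lrank  :: nat
  root   :: "'i \<Rightarrow> lvec"
  coroot :: "'i \<Rightarrow> lvec"
  fund   :: "'i \<Rightarrow> lvec"

definition weight_lattice :: "'i cartan_datum \<Rightarrow> lvec set" where
  "weight_lattice C = {\<mu>. \<forall>k \<ge> lrank C. \<mu> k = 0}"

definition pairing :: "'i cartan_datum \<Rightarrow> lvec \<Rightarrow> lvec \<Rightarrow> int" where
  "pairing C h \<mu> = (\<Sum>k < lrank C. h k * \<mu> k)"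

definition lin_indep :: "'i set \<Rightarrow> 'k set \<Rightarrow> ('i \<Rightarrow> 'k \<Rightarrow> int) \<Rightarrow> bool" where
  "lin_indep J K v \<longleftrightarrow>
     (\<forall>c :: 'i \<Rightarrow> int. (\<forall>k\<in>K. (\<Sum>a\<in>J. c a * v a k) = 0) \<longrightarrow> (\<forall>a\<in>J. c a = 0))"

definition cmat_rank :: "'i cartan_datum \<Rightarrow> nat" where
  "cmat_rank C = Max {card J | J. J \<subseteq> idx C \<and> lin_indep J (idx C) (\<lambda>b a. cmat C a b)}"

definition generalized_cartan_matrix :: "'i set \<Rightarrow> ('i \<Rightarrow> 'i \<Rightarrow> int) \<Rightarrow> bool" where
  "generalized_cartan_matrix I A \<longleftrightarrow>
     (\<forall>a\<in>I. A a a = 2) \<and>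
     (\<forall>a\<in>I. \<forall>b\<in>I. a \<noteq> b \<longrightarrow> A a b \<le> 0 \<and> (A a b = 0 \<longleftrightarrow> A b a = 0))"

definition symmetrizable :: "'i set \<Rightarrow> ('i \<Rightarrow> 'i \<Rightarrow> int) \<Rightarrow> bool" where
  "symmetrizable I A \<longleftrightarrow>
     (\<exists>d :: 'i \<Rightarrow> int. (\<forall>a\<in>I. d a > 0) \<and> (\<forall>a\<in>I. \<forall>b\<in>I. d a * A a b = d b * A b a))"

text \<open>
  The last two conjuncts say that the datum is a (minimal) realization of the matrix. Linear
  independence of the coroots follows from the existence of the fundamental weights.
\<close>

definition symmetrizable_kac_moody :: "'i cartan_datum \<Rightarrow> bool" where
  "symmetrizable_kac_moody C \<longleftrightarrow>
     finite (idx C) \<and>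
     generalized_cartan_matrix (idx C) (cmat C) \<and>
     symmetrizable (idx C) (cmat C) \<and>
     (\<forall>a\<in>idx C. root C a \<in> weight_lattice C \<and> fund C a \<in> weight_lattice C
                \<and> coroot C a \<in> weight_lattice C) \<and>
     (\<forall>a\<in>idx C. \<forall>b\<in>idx C. pairing C (coroot C a) (root C b) = cmat C a b) \<and>
     (\<forall>a\<in>idx C. \<forall>b\<in>idx C. pairing C (coroot C a) (fund C b) = (if a = b then 1 else 0)) \<and>
     lin_indep (idx C) {..<lrank C} (root C) \<and>
     lrank C = 2 * card (idx C) - cmat_rank C"

definition simply_laced :: "'i cartan_datum \<Rightarrow> bool" where
  "simply_laced C \<longleftrightarrow>
     (\<forall>a\<in>idx C. \<forall>b\<in>idx C.
        cmat C a b = cmat C b a \<and> (a \<noteq> b \<longrightarrow> cmat C a b \<in> {0, -1}))"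

definition dominant :: "'i cartan_datum \<Rightarrow> lvec set" where
  "dominant C = {\<mu> \<in> weight_lattice C. \<forall>a\<in>idx C. pairing C (coroot C a) \<mu> \<ge> 0}"

datatype hweight = Weight lvec | Infty

definition dominant_infty :: "'i cartan_datum \<Rightarrow> hweight set" where
  "dominant_infty C = insert Infty (Weight ` dominant C)"


section \<open>Abstract crystals\<close>

text \<open>
  The element 0 is \<open>None\<close>. The functions \<open>eps\<close> and \<open>phi\<close> are integer-valued: the value
  \<open>-\<infinity>\<close>, allowed for general abstract crystals, does not occur for rigged configurations, so the
  axiom about it is vacuous.
\<close>

record ('i, 'b) crystal =
  elts :: "'b set"
  eop  :: "'i \<Rightarrow> 'b \<Rightarrow> 'b option"
  fop  :: "'i \<Rightarrow> 'b \<Rightarrow> 'b option"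
  eps  :: "'i \<Rightarrow> 'b \<Rightarrow> int"
  phi  :: "'i \<Rightarrow> 'b \<Rightarrow> int"
  wt   :: "'b \<Rightarrow> lvec"

definition abstract_crystal :: "'i cartan_datum \<Rightarrow> ('i, 'b) crystal \<Rightarrow> bool" where
  "abstract_crystal C B \<longleftrightarrow>
     (\<forall>x\<in>elts B. wt B x \<in> weight_lattice C) \<and>
     (\<forall>a\<in>idx C. \<forall>x\<in>elts B.
        phi B a x = eps B a x + pairing C (coroot C a) (wt B x) \<and>
        (\<forall>y. eop B a x = Some y \<longrightarrow>
           y \<in> elts B \<and> wt B y = (\<lambda>k. wt B x k + root C a k) \<and>
           eps B a y = eps B a x - 1 \<and> phi B a y = phi B a x + 1) \<and>
        (\<forall>y. fop B a x = Some y \<longrightarrow>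
           y \<in> elts B \<and> wt B y = (\<lambda>k. wt B x k - root C a k) \<and>
           eps B a y = eps B a x + 1 \<and> phi B a y = phi B a x - 1) \<and>
        (\<forall>y\<in>elts B. fop B a x = Some y \<longleftrightarrow> eop B a y = Some x))"

definition crystal_isomorphism ::
    "'i cartan_datum \<Rightarrow> ('i, 'b) crystal \<Rightarrow> ('i, 'c) crystal \<Rightarrow> ('b \<Rightarrow> 'c) \<Rightarrow> bool" where
  "crystal_isomorphism C B B' v \<longleftrightarrow>
     bij_betw v (elts B) (elts B') \<and>
     (\<forall>x\<in>elts B. wt B' (v x) = wt B x) \<and>
     (\<forall>a\<in>idx C. \<forall>x\<in>elts B.
        eps B' a (v x) = eps B a x \<and> phi B' a (v x) = phi B a x \<and>
        eop B' a (v x) = map_option v (eop B a x) \<and>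
        fop B' a (v x) = map_option v (fop B a x))"

definition iter_op :: "('b \<Rightarrow> 'b option) \<Rightarrow> nat \<Rightarrow> 'b \<Rightarrow> 'b option" where
  "iter_op g k x = ((\<lambda>y. Option.bind y g) ^^ k) (Some x)"


section \<open>Foldings and virtual crystals\<close>

definition diagram_folding ::
    "'i cartan_datum \<Rightarrow> 'j cartan_datum \<Rightarrow> ('j \<Rightarrow> 'i) \<Rightarrow> ('i \<Rightarrow> nat) \<Rightarrow> bool" where
  "diagram_folding C C' \<phi> \<gamma> \<longleftrightarrow>
     \<phi> ` idx C' = idx C \<and>
     (\<forall>a\<in>idx C. \<gamma> a > 0) \<and>
     (\<forall>b\<in>idx C'. \<forall>b'\<in>idx C'. b \<noteq> b' \<and> \<phi> b = \<phi> b' \<longrightarrow> cmat C' b b' = 0)"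

definition fibre :: "'j cartan_datum \<Rightarrow> ('j \<Rightarrow> 'i) \<Rightarrow> 'i \<Rightarrow> 'j set" where
  "fibre C' \<phi> a = {b \<in> idx C'. \<phi> b = a}"

text \<open>
  The two prescribed values determine \<open>\<Psi>\<close> on the weight lattice, because for a minimal
  realization the fundamental weights and the simple roots together span it rationally.
\<close>

definition weight_embedding ::
    "'i cartan_datum \<Rightarrow> 'j cartan_datum \<Rightarrow> ('j \<Rightarrow> 'i) \<Rightarrow> ('i \<Rightarrow> nat) \<Rightarrow> (lvec \<Rightarrow> lvec) \<Rightarrow> bool"
  where
  "weight_embedding C C' \<phi> \<gamma> \<Psi> \<longleftrightarrow>
     \<Psi> ` weight_lattice C \<subseteq> weight_lattice C' \<and>
     inj_on \<Psi> (weight_lattice C) \<and>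
     (\<forall>\<mu>\<in>weight_lattice C. \<forall>\<nu>\<in>weight_lattice C.
        \<Psi> (\<lambda>k. \<mu> k + \<nu> k) = (\<lambda>k. \<Psi> \<mu> k + \<Psi> \<nu> k)) \<and>
     (\<forall>a\<in>idx C. \<Psi> (fund C a) = (\<lambda>k. int (\<gamma> a) * (\<Sum>b\<in>fibre C' \<phi> a. fund C' b k))) \<and>
     (\<forall>a\<in>idx C. \<Psi> (root C a) = (\<lambda>k. int (\<gamma> a) * (\<Sum>b\<in>fibre C' \<phi> a. root C' b k)))"

primrec virtual_weight :: "(lvec \<Rightarrow> lvec) \<Rightarrow> hweight \<Rightarrow> hweight" where
  "virtual_weight \<Psi> (Weight \<mu>) = Weight (\<Psi> \<mu>)"
| "virtual_weight \<Psi> Infty = Infty"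

text \<open>
  The product over the fibre of the \<open>\<gamma> a\<close>-th powers. The nodes of a fibre are pairwise
  unconnected, so the factors commute; for definiteness they are composed along the order of
  the index type.
\<close>

definition virtual_op ::
    "('j::linorder) cartan_datum \<Rightarrow> ('j \<Rightarrow> 'i) \<Rightarrow> ('i \<Rightarrow> nat) \<Rightarrow> ('j \<Rightarrow> 'b \<Rightarrow> 'b option)
       \<Rightarrow> 'i \<Rightarrow> 'b \<Rightarrow> 'b option" where
  "virtual_op C' \<phi> \<gamma> g a x =
     foldr (\<lambda>b y. Option.bind y (iter_op (g b) (\<gamma> a)))
           (sorted_list_of_set (fibre C' \<phi> a)) (Some x)"

definition virtual_crystal ::
    "'i cartan_datum \<Rightarrow> ('j::linorder) cartan_datum \<Rightarrow> ('j \<Rightarrow> 'i) \<Rightarrow> ('i \<Rightarrow> nat) \<Rightarrow> (lvec \<Rightarrow> lvec)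
       \<Rightarrow> ('j, 'b) crystal \<Rightarrow> ('i, 'b) crystal \<Rightarrow> bool" where
  "virtual_crystal C C' \<phi> \<gamma> \<Psi> B' V \<longleftrightarrow>
     elts V \<subseteq> elts B' \<and>
     abstract_crystal C V \<and>
     (\<forall>x\<in>elts V. \<Psi> (wt V x) = wt B' x) \<and>
     (\<forall>a\<in>idx C. \<forall>x\<in>elts V.
        eop V a x = virtual_op C' \<phi> \<gamma> (eop B') a x \<and>
        fop V a x = virtual_op C' \<phi> \<gamma> (fop B') a x \<and>
        (\<forall>b\<in>fibre C' \<phi> a. int (\<gamma> a) * eps V a x = eps B' b x \<and>
                          int (\<gamma> a) * phi V a x = phi B' b x))"

definition virtualizes ::
    "'i cartan_datum \<Rightarrow> ('j::linorder) cartan_datum \<Rightarrow> ('j \<Rightarrow> 'i) \<Rightarrow> ('i \<Rightarrow> nat) \<Rightarrow> (lvec \<Rightarrow> lvec)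
       \<Rightarrow> ('i, 'b) crystal \<Rightarrow> ('j, 'c) crystal \<Rightarrow> ('b \<Rightarrow> 'c) \<Rightarrow> bool" where
  "virtualizes C C' \<phi> \<gamma> \<Psi> B B' v \<longleftrightarrow>
     abstract_crystal C B \<and> abstract_crystal C' B' \<and>
     (\<exists>V. virtual_crystal C C' \<phi> \<gamma> \<Psi> B' V \<and> crystal_isomorphism C B V v)"


section \<open>Rigged configurations\<close>

text \<open>
  A string is a pair (length, label). A configuration maps each node to its rigged partition;
  nodes outside the index set carry the empty one.
\<close>

type_synonym 'i rigged_config = "'i \<Rightarrow> (nat \<times> int) multiset"

definition mult :: "'i rigged_config \<Rightarrow> 'i \<Rightarrow> nat \<Rightarrow> nat" where
  "mult R a i = count (image_mset fst (R a)) i"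

definition labels :: "'i rigged_config \<Rightarrow> 'i \<Rightarrow> nat \<Rightarrow> int list" where
  "labels R a i = rev (sorted_list_of_multiset (image_mset snd (filter_mset (\<lambda>s. fst s = i) (R a))))"

primrec base_vacancy :: "'i cartan_datum \<Rightarrow> hweight \<Rightarrow> 'i \<Rightarrow> int" where
  "base_vacancy C (Weight \<mu>) a = pairing C (coroot C a) \<mu>"
| "base_vacancy C Infty a = 0"

definition vacancy :: "'i cartan_datum \<Rightarrow> hweight \<Rightarrow> 'i rigged_config \<Rightarrow> 'i \<Rightarrow> nat \<Rightarrow> int" where
  "vacancy C \<Lambda> R a i = base_vacancy C \<Lambda> a
     - (\<Sum>b\<in>idx C. \<Sum>j\<in>fst ` set_mset (R b). cmat C a b * int (min i j) * int (mult R b j))"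

definition valid :: "'i cartan_datum \<Rightarrow> hweight \<Rightarrow> 'i rigged_config \<Rightarrow> bool" where
  "valid C \<Lambda> R \<longleftrightarrow> (\<forall>a\<in>idx C. \<forall>i>0. \<forall>x\<in>set (labels R a i). x \<le> vacancy C \<Lambda> R a i)"

text \<open>
  Exchange the strings \<open>old\<close> at node \<open>a\<close> for the strings \<open>new\<close>, and shift the label of every
  other string by the change of its vacancy number, so that its colabel stays fixed. (Vacancy
  numbers depend only on the lengths.)
\<close>

definition exchange :: "'i cartan_datum \<Rightarrow> hweight \<Rightarrow> 'i \<Rightarrow> (nat \<times> int) multiset
    \<Rightarrow> (nat \<times> int) multiset \<Rightarrow> 'i rigged_config \<Rightarrow> 'i rigged_config" where
  "exchange C \<Lambda> a old new R =
     (let R0 = R(a := R a - old + new);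
          shift = (\<lambda>b (i, y). (i, y + vacancy C \<Lambda> R0 b i - vacancy C \<Lambda> R b i))
      in (\<lambda>b. if b = a then image_mset (shift b) (R b - old) + new
              else image_mset (shift b) (R b)))"

definition min_label :: "'i rigged_config \<Rightarrow> 'i \<Rightarrow> int" where
  "min_label R a = Min (snd ` set_mset (R a))"

definition rc_e :: "'i cartan_datum \<Rightarrow> 'i \<Rightarrow> 'i rigged_config \<Rightarrow> 'i rigged_config option" where
  "rc_e C a R =
     (if R a = {#} \<or> min_label R a \<ge> 0 then None
      else let x = min_label R a; l = Min {i. (i, x) \<in># R a}
           in Some (exchange C Infty a {#(l, x)#}
                      (if l = 1 then {#} else {#(l - 1, x + 1)#}) R))"

definition rc_f_raw ::
    "'i cartan_datum \<Rightarrow> hweight \<Rightarrow> 'i \<Rightarrow> 'i rigged_config \<Rightarrow> 'i rigged_config" where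
  "rc_f_raw C \<Lambda> a R =
     (if R a = {#} \<or> min_label R a > 0 then exchange C \<Lambda> a {#} {#(1, -1)#} R
      else let x = min_label R a; l = Max {i. (i, x) \<in># R a}
           in exchange C \<Lambda> a {#(l, x)#} {#(l + 1, x - 1)#} R)"

definition rc_f ::
    "'i cartan_datum \<Rightarrow> hweight \<Rightarrow> 'i \<Rightarrow> 'i rigged_config \<Rightarrow> 'i rigged_config option" where
  "rc_f C \<Lambda> a R =
     (let R' = rc_f_raw C \<Lambda> a R
      in if \<Lambda> = Infty \<or> valid C \<Lambda> R' then Some R' else None)"

inductive_set RC_infty :: "'i cartan_datum \<Rightarrow> 'i rigged_config set" for C where
  RC_empty: "(\<lambda>_. {#}) \<in> RC_infty C"
| RC_e: "R \<in> RC_infty C \<Longrightarrow> a \<in> idx C \<Longrightarrow> rc_e C a R = Some R' \<Longrightarrow> R' \<in> RC_infty C"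
| RC_f: "R \<in> RC_infty C \<Longrightarrow> a \<in> idx C \<Longrightarrow> rc_f C Infty a R = Some R' \<Longrightarrow> R' \<in> RC_infty C"

definition rc_eps :: "'i cartan_datum \<Rightarrow> 'i \<Rightarrow> 'i rigged_config \<Rightarrow> int" where
  "rc_eps C a R = int (Max {k. iter_op (rc_e C a) k R \<noteq> None})"

definition rc_wt :: "'i cartan_datum \<Rightarrow> hweight \<Rightarrow> 'i rigged_config \<Rightarrow> lvec" where
  "rc_wt C \<Lambda> R =
     (\<lambda>k. (case \<Lambda> of Weight \<mu> \<Rightarrow> \<mu> k | Infty \<Rightarrow> 0)
          - (\<Sum>a\<in>idx C. int (sum_mset (image_mset fst (R a))) * root C a k))"

definition RC :: "'i cartan_datum \<Rightarrow> hweight \<Rightarrow> ('i, 'i rigged_config) crystal" where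
  "RC C \<Lambda> =
     \<lparr> elts = {R \<in> RC_infty C. \<Lambda> = Infty \<or> valid C \<Lambda> R},
       eop = rc_e C,
       fop = rc_f C \<Lambda>,
       eps = rc_eps C,
       phi = (\<lambda>a R. rc_eps C a R + pairing C (coroot C a) (rc_wt C \<Lambda> R)),
       wt = rc_wt C \<Lambda> \<rparr>"

definition virtualization_map ::
    "'j cartan_datum \<Rightarrow> ('j \<Rightarrow> 'i) \<Rightarrow> ('i \<Rightarrow> nat) \<Rightarrow> 'i rigged_config \<Rightarrow> 'j rigged_config" where
  "virtualization_map C' \<phi> \<gamma> R =
     (\<lambda>b. if b \<in> idx C'
          then image_mset (\<lambda>(i, x). (\<gamma> (\<phi> b) * i, int (\<gamma> (\<phi> b)) * x)) (R (\<phi> b))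
          else {#})"

text \<open>The equations that characterize the virtualization map.\<close>

lemma mult_virtualization_map:
  assumes "b \<in> idx C'" "\<gamma> (\<phi> b) > 0"
  shows "mult (virtualization_map C' \<phi> \<gamma> R) b (\<gamma> (\<phi> b) * i) = mult R (\<phi> b) i"
proof -
  have "count (image_mset fst (image_mset (\<lambda>(i, x). (\<gamma> (\<phi> b) * i, int (\<gamma> (\<phi> b)) * x)) M))
          (\<gamma> (\<phi> b) * i) = count (image_mset fst M) i" for M :: "(nat \<times> int) multiset"
    using assms(2) by (induction M) auto
  then show ?thesis using assms(1) by (simp add: mult_def virtualization_map_def)
qed

lemma labels_virtualization_map:
  assumes "b \<in> idx C'" "\<gamma> (\<phi> b) > 0"
  shows "labels (virtualization_map C' \<phi> \<gamma> R) b (\<gamma> (\<phi> b) * i)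
           = map (\<lambda>x. int (\<gamma> (\<phi> b)) * x) (labels R (\<phi> b) i)"
proof -
  let ?g = "int (\<gamma> (\<phi> b))"
  have *: "image_mset snd (filter_mset (\<lambda>s. fst s = \<gamma> (\<phi> b) * i)
             (image_mset (\<lambda>(i, x). (\<gamma> (\<phi> b) * i, ?g * x)) M))
           = image_mset ((*) ?g) (image_mset snd (filter_mset (\<lambda>s. fst s = i) M))"
    for M :: "(nat \<times> int) multiset"
    using assms(2) by (induction M) auto
  have "sorted_list_of_multiset (image_mset ((*) ?g) N) = map ((*) ?g) (sorted_list_of_multiset N)"
    for N :: "int multiset"
  proof -
    have "sorted (map ((*) ?g) (sorted_list_of_multiset N))"
      by (rule sorted_map_mono[OF sorted_sorted_list_of_multiset])
        (auto intro!: mono_onI mult_left_mono)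
    then show ?thesis
      by (metis mset_map mset_sorted_list_of_multiset sorted_list_of_multiset_mset sorted_sort_id)
  qed
  with * show ?thesis using assms(1)
    by (simp add: labels_def virtualization_map_def rev_map)
qed

lemma no_other_lengths_virtualization_map:
  assumes "\<not> \<gamma> (\<phi> b) dvd j"
  shows "mult (virtualization_map C' \<phi> \<gamma> R) b j = 0"
  using assms by (auto simp: mult_def virtualization_map_def count_eq_zero_iff)

end

theory Submission
  imports Defs HOL.Rat HOL.Vector_Spaces "HOL-Library.Function_Algebras"
begin

text \<open>
  All scaling factors can be taken to be \<open>1\<close>. If \<open>d\<close> symmetrizes the Cartan matrix \<open>A\<close>, replace
  each node \<open>a\<close> by \<open>M * d a\<close> pairwise unconnected copies, where \<open>M\<close> is a large constant, and join
  the copies of \<open>a\<close> to those of \<open>b\<close> by a bipartite graph of degrees \<open>- A a b\<close> and \<open>- A b a\<close>; the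
  edge counts on the two sides agree because \<open>d a * A a b = d b * A b a\<close>
  (\<open>simply_laced_cover\<close>). The virtualization map then only copies the rigged partition of a node
  to its fibre.

  The crystal axioms are proved directly for every symmetrizable datum. An application of \<open>f\<close>
  lengthens one string \<open>(l, x)\<close> to \<open>(l + 1, x - 1)\<close>; the relation \<open>fstep\<close> records such moves, with
  the creation of \<open>(1, -1)\<close> as the case \<open>(l, x) = (0, 0)\<close>, and \<open>f\<close> and \<open>e\<close> are its two directions.
  The only obstruction to reading an \<open>e\<close> as a move is a string \<open>(1, x)\<close> with \<open>x < -1\<close>. It is excluded
  on \<open>RC(\<infinity>)\<close> by an invariant: every subconfiguration, that is, every choice of strings with their
  present labels, has nonnegative cocharge, and for a single string \<open>(i, x)\<close> at \<open>a\<close> the cocharge is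
  \<open>d a * (x + i)\<close>. Moves preserve the invariant in both directions (\<open>fstep_cocharge_nonneg\<close>). For
  subconfigurations that contain the moved string the cocharge does not change; for the others one
  exchanges the moved string with the chosen string at the same node of the nearest length and uses
  convexity in the length (\<open>node_energy_backward\<close>, \<open>node_energy_forward\<close>). Validity descends along
  \<open>e\<close> by concavity of the vacancy numbers (\<open>fstep_valid\<close>), so that \<open>RC(\<lambda>)\<close> is a crystal as well.

  Given a folding with \<open>\<gamma> = 1\<close>, the virtual operators perform the same move at the nodes of a fibre
  one after the other. The intermediate states have a closed form and are related by single moves,
  which gives the virtualization (\<open>RC_virtualizes\<close>).

  It remains to realize the simply-laced matrix so that \<open>\<Psi>\<close> exists. The coordinates of a root of the
  cover are its matrix column, followed by the entries of further rows, and each of these rows must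
  come with a linear form on the weight lattice of the given datum that vanishes on the fundamental
  weights and takes the fibre sums of the row on the simple roots. Such rows separate vectors
  together with the matrix (\<open>cover_separating\<close>), so the Steinitz exchange lemma selects as many of
  them as the rank condition prescribes. The corresponding linear forms, together with the coroots,
  define \<open>\<Psi>\<close>; it is injective since weights that annihilate the coroots are rational combinations
  of the simple roots (\<open>annihilator_in_root_span\<close>).
\<close>

section \<open>Strings and convexity\<close>

text \<open>
  The multiset with the one string \<open>(l, x)\<close>. A string of length \<open>0\<close> counts as absent, so that creating
  \<open>(1, -1)\<close> is the lengthening of \<open>(0, 0)\<close>.
\<close>

definition str :: "nat \<Rightarrow> int \<Rightarrow> (nat \<times> int) multiset" where
  "str l x = (if l = 0 then {#} else {#(l, x)#})"

text \<open>
  Add \<open>k\<close> to the label of a string of length at least \<open>l\<close>.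
\<close>

definition shift_label :: "int \<Rightarrow> nat \<Rightarrow> nat \<times> int \<Rightarrow> nat \<times> int" where
  "shift_label k l s = (fst s, snd s + (if l \<le> fst s then k else 0))"

text \<open>
  The number of boxes in the first \<open>j\<close> columns of the partition of a rigged partition.
\<close>

definition trunc :: "(nat \<times> int) multiset \<Rightarrow> nat \<Rightarrow> int" where
  "trunc T j = (\<Sum>s\<in>#T. int (min j (fst s)))"

lemma fst_shift_label [simp]: "fst (shift_label k l s) = fst s"
  by (simp add: shift_label_def)

lemma snd_shift_label: "snd (shift_label k l s) = snd s + (if l \<le> fst s then k else 0)"
  by (simp add: shift_label_def)

lemma shift_label_shift_label [simp]: "shift_label k l (shift_label k' l s) = shift_label (k + k') l s"
  by (simp add: shift_label_def)

lemma shift_label_0 [simp]: "shift_label 0 l = id"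
  by (auto simp: shift_label_def)

lemma image_shift_shift [simp]:
  "image_mset (shift_label k l) (image_mset (shift_label k' l) T) = image_mset (shift_label (k + k') l) T"
  by (simp add: multiset.map_comp comp_def)

lemma trunc_empty [simp]: "trunc {#} j = 0"
  by (simp add: trunc_def)

lemma trunc_add_mset [simp]: "trunc (add_mset s T) j = int (min j (fst s)) + trunc T j"
  by (simp add: trunc_def)

lemma trunc_union [simp]: "trunc (S + T) j = trunc S j + trunc T j"
  by (simp add: trunc_def)

lemma trunc_0 [simp]: "trunc T 0 = 0"
  by (induction T) auto

lemma trunc_shift [simp]: "trunc (image_mset (shift_label k l) T) j = trunc T j"
  by (induction T) auto

lemma trunc_str: "trunc (str l x) j = int (min j l)"
  by (simp add: str_def)

lemma trunc_slope:
  "trunc T (Suc j) - trunc T j = int (size (filter_mset (\<lambda>s. j < fst s) T))"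
  by (induction T) auto

lemma trunc_slope_eq:
  assumes "\<forall>s\<in>#T. fst s \<noteq> Suc j"
  shows "trunc T (Suc (Suc j)) - trunc T (Suc j) = trunc T (Suc j) - trunc T j"
  using assms by (induction T) (auto simp: min_def)

lemma trunc_concave:
  "trunc T (Suc (Suc j)) - trunc T (Suc j) \<le> trunc T (Suc j) - trunc T j"
  by (induction T) (auto simp: min_def algebra_simps)

lemma trunc_mono: "trunc T j \<le> trunc T (Suc j)"
  by (induction T) auto

lemma sum_trunc_swap: "(\<Sum>s\<in>#S. trunc T (fst s)) = (\<Sum>t\<in>#T. trunc S (fst t))"
proof (induction S)
  case empty show ?case by (induction T) auto
next
  case (add s S)
  have "trunc T (fst s) = (\<Sum>t\<in>#T. int (min (fst t) (fst s)))"
    by (simp add: trunc_def min.commute)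
  then show ?case using add by (simp add: sum_mset.distrib)
qed

lemma finite_lengths: "finite {fst s |s. s \<in># T \<and> P s}"
proof -
  have "{fst s |s. s \<in># T \<and> P s} = fst ` {s \<in> set_mset T. P s}" by blast
  then show ?thesis by simp
qed

lemma convex_slope_right:
  fixes f :: "nat \<Rightarrow> int"
  assumes "\<And>j. i \<le> j \<Longrightarrow> j + 2 \<le> k \<Longrightarrow> f (Suc j) - f j \<le> f (Suc (Suc j)) - f (Suc j)"
    and "i < k"
  shows "int (k - i) * (f (Suc i) - f i) \<le> f k - f i
       \<and> f (Suc i) - f i \<le> f k - f (k - 1)"
  using assms
proof (induction "k - Suc i" arbitrary: k)
  case 0
  then have "k = Suc i" by simp
  then show ?case by simp
next
  case (Suc n)
  define k' where "k' = k - 1"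
  have k: "k = Suc k'" "i < k'" using Suc.hyps by (auto simp: k'_def)
  have IH: "int (k' - i) * (f (Suc i) - f i) \<le> f k' - f i \<and> f (Suc i) - f i \<le> f k' - f (k' - 1)"
    using Suc.hyps k Suc.prems(1) by (intro Suc.hyps(1)) auto
  have "f k' - f (k' - 1) \<le> f k - f k'"
    using Suc.prems(1)[of "k' - 1"] k by auto
  moreover have "int (k - i) = int (k' - i) + 1" using k by auto
  ultimately show ?case using IH by (simp add: k algebra_simps)
qed

lemma convex_slope_left:
  fixes f :: "nat \<Rightarrow> int"
  assumes "\<And>j. i \<le> j \<Longrightarrow> j < k \<Longrightarrow> f (Suc j) - f j \<le> f (Suc (Suc j)) - f (Suc j)"
    and "i \<le> k"
  shows "f k - f i \<le> int (k - i) * (f (Suc k) - f k)"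
  using assms
proof (induction "k - i" arbitrary: k)
  case 0 then show ?case by simp
next
  case (Suc n)
  define k' where "k' = k - 1"
  have k: "k = Suc k'" "i \<le> k'" using Suc.hyps by (auto simp: k'_def)
  have IH: "f k' - f i \<le> int (k' - i) * (f (Suc k') - f k')"
    using Suc.hyps k Suc.prems(1) by (intro Suc.hyps(1)) auto
  have *: "f (Suc k') - f k' \<le> f (Suc k) - f k"
    using Suc.prems(1)[of k'] k by auto
  have "int (k' - i) * (f (Suc k') - f k') \<le> int (k' - i) * (f (Suc k) - f k)"
    using * by (intro mult_left_mono) auto
  moreover have "int (k - i) = int (k' - i) + 1" using k by auto
  ultimately show ?case using IH * k by (simp add: algebra_simps)
qed

section \<open>The energy of strings at one node\<close>

text \<open>
  The part of the cocharge that depends on the chosen strings \<open>T\<close> at one node, up to the factor given by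
  the symmetrizer; \<open>g\<close> is the interaction of a string of given length with the chosen strings at all other
  nodes.
\<close>

definition node_energy :: "(nat \<Rightarrow> int) \<Rightarrow> (nat \<times> int) multiset \<Rightarrow> int" where
  "node_energy g T = (\<Sum>s\<in>#T. snd s + g (fst s)) + (\<Sum>s\<in>#T. trunc T (fst s))"

lemma node_energy_empty [simp]: "node_energy g {#} = 0"
  by (simp add: node_energy_def)

lemma node_energy_add:
  "node_energy g (add_mset (i, y) T) = node_energy g T + y + g i + int i + 2 * trunc T i"
proof -
  have "(\<Sum>s\<in>#T. int (min (fst s) i)) = trunc T i"
    by (simp add: trunc_def min.commute)
  then show ?thesis by (simp add: node_energy_def sum_mset.distrib)
qed

lemma node_energy_str:
  assumes "l = 0 \<longrightarrow> x = 0" "g 0 = 0"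
  shows "node_energy g (T + str l x) = node_energy g T + x + g l + int l + 2 * trunc T l"
  using assms by (auto simp: str_def node_energy_add)

lemma node_energy_shift:
  "node_energy g (image_mset (shift_label (- 2) (Suc l)) T)
     = node_energy g T - 2 * (trunc T (Suc l) - trunc T l)"
proof -
  have "(\<Sum>s\<in>#T. snd (shift_label (- 2) (Suc l) s) + g (fst s))
      = (\<Sum>s\<in>#T. snd s + g (fst s)) - 2 * (trunc T (Suc l) - trunc T l)"
    by (induction T) (auto simp: shift_label_def)
  then show ?thesis by (simp add: node_energy_def multiset.map_comp comp_def)
qed

text \<open>
  If the moved string is chosen, its contribution compensates the relabelling of the others; the
  remaining difference \<open>g (Suc l) - g l\<close> cancels against the relabelling at the other nodes.
\<close>

lemma node_energy_moved:
  assumes "l = 0 \<longrightarrow> x = 0" "g 0 = 0"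
  shows "node_energy g (add_mset (Suc l, x - 1) (image_mset (shift_label (- 2) (Suc l)) T))
     = node_energy g (T + str l x) + (g (Suc l) - g l)"
  by (simp add: node_energy_str[of l x g, OF assms] node_energy_add node_energy_shift)

lemma subset_add_str_cases:
  assumes "T \<subseteq># M + str l x"
  shows "T \<subseteq># M \<or> (\<exists>U. U \<subseteq># M \<and> T = U + str l x)"
proof (cases "l = 0 \<or> (l, x) \<notin># T")
  case True
  have "T \<subseteq># M" 
  proof (cases "l = 0")
    case True then show ?thesis using assms by (simp add: str_def)
  next
    case False
    then have *: "T \<subseteq># add_mset (l,x) M" "(l,x) \<notin># T" using True assms by (auto simp: str_def)
    show ?thesis using * by (metis diff_subset_eq_self diff_single_trivial subset_eq_diff_conv add_mset_add_single)
  qed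
  then show ?thesis by blast
next
  case False
  then obtain U where U: "T = add_mset (l, x) U" by (metis mset_add)
  then have "U \<subseteq># M" using assms False by (simp add: str_def)
  then show ?thesis using U False by (auto simp: str_def)
qed

text \<open>
  Removing a string \<open>t\<close> of length \<open>i\<close> and adding one of length \<open>l\<close>.
\<close>

lemma node_energy_replace:
  assumes "l = 0 \<longrightarrow> x = 0" "g 0 = 0" "(i, y) \<in># T"
  defines "h \<equiv> \<lambda>j. int j + g j + 2 * trunc T j"
  shows "node_energy g (T - {#(i, y)#} + str l x)
     = node_energy g T + x - y + h l - h i + 2 * (int i - int (min i l))"
proof -
  obtain U where U: "T = add_mset (i, y) U" using assms(3) by (metis mset_add)
  show ?thesis
    by (simp add: U node_energy_str[of l x g, OF assms(1,2)] node_energy_add h_def min.commute)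
qed

text \<open>
  The invariant passes from the target of a move to its source. If it failed for \<open>T\<close>, which then does
  not contain the moved string, the slope at \<open>l\<close> of the energy \<open>h\<close> of an additional string would be at
  most \<open>0\<close>. Adding \<open>(l, x)\<close> to \<open>T\<close>, in exchange for a longest string of \<open>T\<close> of length at most \<open>l\<close> if
  there is one, would then not raise the energy, against the hypothesis on \<open>T + str l x\<close>.
\<close>

lemma node_energy_backward:
  fixes Z d :: int
  assumes lx: "l = 0 \<longrightarrow> x = 0" "x \<le> 0"
    and M: "\<forall>s\<in>#M. x \<le> snd s"
    and g: "g 0 = 0" "\<And>j. g (Suc j) - g j \<le> g (Suc (Suc j)) - g (Suc j)" and d: "d > 0"
    and kept: "\<And>T. T \<subseteq># M \<Longrightarrow> 0 \<le> Z - d * (g (Suc l) - g l)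
            + d * node_energy g (image_mset (shift_label (- 2) (Suc l)) T)"
    and moved: "\<And>T. T \<subseteq># M \<Longrightarrow> 0 \<le> Z + d * node_energy g (T + str l x)"
    and T: "T \<subseteq># M + str l x"
  shows "0 \<le> Z + d * node_energy g T"
proof -
  have "0 \<le> Z + d * node_energy g T" if T: "T \<subseteq># M" for T
  proof (rule ccontr)
    assume neg: "\<not> ?thesis"
    define h where "h = (\<lambda>j. int j + g j + 2 * trunc T j)"
    define D where "D = h (Suc l) - h l"
    have "0 \<le> Z + d * node_energy g T - d * (D - 1)"
      using kept[OF T] by (simp add: node_energy_shift D_def h_def algebra_simps)
    then have "d * (D - 1) < 0" using neg by linarith
    then have D: "D \<le> 0" using d by (simp add: mult_less_0_iff)
    have conv: "h (Suc j) - h j \<le> h (Suc (Suc j)) - h (Suc j)" if "\<forall>s\<in>#T. fst s \<noteq> Suc j" for j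
      using trunc_slope_eq[OF that] g(2)[of j] by (simp add: h_def)
    show False
    proof (cases "\<exists>s\<in>#T. fst s \<le> l")
      case False
      have "h l - h 0 \<le> int (l - 0) * (h (Suc l) - h l)"
        by (rule convex_slope_left) (use False in \<open>fastforce intro!: conv\<close>)+
      then have "h l \<le> 0" using D by (simp add: h_def g D_def mult_nonneg_nonpos order_trans)
      then have "d * (x + h l) \<le> 0" using lx d by (simp add: mult_nonneg_nonpos)
      moreover have "0 \<le> Z + d * node_energy g T + d * (x + h l)"
        using moved[OF T] by (simp add: node_energy_str[of l x g, OF lx(1) g(1)] h_def algebra_simps)
      ultimately show False using neg by linarith
    next
      case True
      define i where "i = Max {fst s |s. s \<in># T \<and> fst s \<le> l}"
      have fin: "finite {fst s |s. s \<in># T \<and> fst s \<le> l}" by (rule finite_lengths)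
      have "i \<in> {fst s |s. s \<in># T \<and> fst s \<le> l}"
        unfolding i_def by (rule Max_in[OF fin]) (use True in auto)
      then obtain y where y: "(i, y) \<in># T" "i \<le> l" by auto
      have gap: "fst s \<le> i" if "s \<in># T" "fst s \<le> l" for s
        unfolding i_def by (rule Max_ge[OF fin]) (use that in blast)
      have "h l - h i \<le> int (l - i) * (h (Suc l) - h l)"
      proof (rule convex_slope_left[of i l h, OF conv y(2)])
        fix j assume "i \<le> j" "j < l"
        then show "\<forall>s\<in>#T. fst s \<noteq> Suc j" using gap by fastforce
      qed
      then have "h l - h i \<le> 0"
        using D by (metis D_def mult_nonneg_nonpos of_nat_0_le_iff order_trans)
      moreover have "x \<le> y" using M y T by (metis mset_subset_eqD snd_conv)
      ultimately have "d * (x - y + h l - h i) \<le> 0" using d by (simp add: mult_nonneg_nonpos)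
      moreover have "0 \<le> Z + d * node_energy g T + d * (x - y + h l - h i)"
      proof -
        have "T - {#(i, y)#} \<subseteq># M" using T by (meson diff_subset_eq_self subset_mset.order_trans)
        from moved[OF this, unfolded node_energy_replace[of l x g, OF lx(1) g(1) y(1)]] show ?thesis
          using y(2) by (simp add: h_def algebra_simps)
      qed
      ultimately show False using neg by linarith
    qed
  qed
  then show ?thesis using subset_add_str_cases[OF T] moved by auto
qed

text \<open>
  The invariant passes from the source of a move to its target. If it failed for \<open>T\<close>, then \<open>T\<close> would
  contain a string of length greater than \<open>l\<close>, since \<open>g\<close> does not increase; exchanging the shortest
  such string for \<open>(l, x)\<close> would then contradict the invariant at the source.
\<close>

lemma node_energy_forward:
  fixes Z d :: int
  assumes lx: "l = 0 \<longrightarrow> x = 0" "x \<le> 0"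
    and M: "\<forall>s\<in>#M. l < fst s \<longrightarrow> x < snd s"
    and g: "g 0 = 0" "\<And>j. g (Suc j) - g j \<le> g (Suc (Suc j)) - g (Suc j)"
           "\<And>j. g (Suc j) \<le> g j" and d: "d > 0"
    and nonneg: "\<And>T. T \<subseteq># M + str l x \<Longrightarrow> 0 \<le> Z + d * node_energy g T"
    and T: "T \<subseteq># M"
  shows "0 \<le> Z - d * (g (Suc l) - g l)
            + d * node_energy g (image_mset (shift_label (- 2) (Suc l)) T)"
proof (rule ccontr)
  assume neg: "\<not> ?thesis"
  define h where "h = (\<lambda>j. int j + g j + 2 * trunc T j)"
  define D where "D = h (Suc l) - h l - 1"
  have neg': "Z + d * node_energy g T - d * D < 0"
    using neg by (simp add: node_energy_shift D_def h_def algebra_simps)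
  have "0 \<le> Z + d * node_energy g T"
    using T by (intro nonneg) (simp add: subset_mset.add_increasing2)
  then have "d * D > 0" using neg' by linarith
  then have D: "D \<ge> 1" using d by (simp add: zero_less_mult_iff)
  have conv: "h (Suc j) - h j \<le> h (Suc (Suc j)) - h (Suc j)" if "\<forall>s\<in>#T. fst s \<noteq> Suc j" for j
    using trunc_slope_eq[OF that] g(2)[of j] by (simp add: h_def)
  have ex: "\<exists>s\<in>#T. l < fst s"
  proof (rule ccontr)
    assume "\<not> ?thesis"
    then have "filter_mset (\<lambda>s. l < fst s) T = {#}" by auto
    then have "trunc T (Suc l) - trunc T l = 0" by (simp only: trunc_slope) simp
    then show False using D g(3)[of l] by (simp add: D_def h_def)
  qed
  define i where "i = Min {fst s |s. s \<in># T \<and> l < fst s}"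
  have fin: "finite {fst s |s. s \<in># T \<and> l < fst s}" by (rule finite_lengths)
  have "i \<in> {fst s |s. s \<in># T \<and> l < fst s}"
    unfolding i_def by (rule Min_in[OF fin]) (use ex in auto)
  then obtain y where y: "(i, y) \<in># T" "l < i" by auto
  have gap: "i \<le> fst s" if "s \<in># T" "l < fst s" for s
    unfolding i_def by (rule Min_le[OF fin]) (use that in blast)
  have "int (i - l) * (h (Suc l) - h l) \<le> h i - h l"
  proof (rule convex_slope_right[of l i h, OF conv y(2), THEN conjunct1])
    fix j assume "l \<le> j" "j + 2 \<le> i"
    then show "\<forall>s\<in>#T. fst s \<noteq> Suc j" using gap by fastforce
  qed
  then have "int (i - l) * (D + 1) \<le> h i - h l" by (simp add: D_def)
  moreover have "int (i - l) * (D + 1) = int (i - l) * (D - 1) + 2 * int (i - l)"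
    by (simp add: algebra_simps)
  moreover have "1 * (D - 1) \<le> int (i - l) * (D - 1)" using D y by (intro mult_right_mono) auto
  moreover have "x + 1 \<le> y" using M y T by (metis mset_subset_eqD snd_conv fst_conv zless_imp_add1_zle)
  ultimately have "x - y + h l - h i + 2 * (int i - int l) \<le> - D" using y(2) by (simp add: of_nat_diff)
  then have "d * (x - y + h l - h i + 2 * (int i - int l)) \<le> d * (- D)"
    using d by (intro mult_left_mono) auto
  moreover have "0 \<le> Z + d * node_energy g T + d * (x - y + h l - h i + 2 * (int i - int l))"
  proof -
    have "T - {#(i, y)#} \<subseteq># M" using T by (meson diff_subset_eq_self subset_mset.order_trans)
    then have "T - {#(i, y)#} + str l x \<subseteq># M + str l x" by simp
    from nonneg[OF this, unfolded node_energy_replace[of l x g, OF lx(1) g(1) y(1)]] show ?thesis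
      using y(2) by (simp add: h_def algebra_simps)
  qed
  ultimately show False using neg' by simp
qed

section \<open>Elementary moves\<close>

lemma sum_count_eq_sum_mset:
  fixes g :: "'a \<Rightarrow> int"
  assumes "finite A" "set_mset N \<subseteq> A"
  shows "(\<Sum>j\<in>A. g j * int (count N j)) = (\<Sum>j\<in>#N. g j)"
  using assms(2)
proof (induction N)
  case empty show ?case by simp
next
  case (add x N)
  have "(\<Sum>j\<in>A. g j * int (count (add_mset x N) j))
      = (\<Sum>j\<in>A. (if j = x then g x else 0) + g j * int (count N j))"
    by (rule sum.cong) (auto simp: algebra_simps)
  also have "\<dots> = g x + (\<Sum>j\<in>#N. g j)"
    using add assms(1) by (simp add: sum.distrib)
  finally show ?case by simp
qed

lemma sum_mset_by_lengths:
  fixes g :: "nat \<Rightarrow> int"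
  shows "(\<Sum>j\<in>fst ` set_mset M. g j * int (count (image_mset fst M) j)) = (\<Sum>s\<in>#M. g (fst s))"
  using sum_count_eq_sum_mset[of "fst ` set_mset M" "image_mset fst M" g]
  by (simp add: multiset.map_comp comp_def)

text \<open>
  Vacancy numbers as sums over strings instead of over lengths.
\<close>

lemma vacancy_eq:
  "vacancy C \<Lambda> R a i = base_vacancy C \<Lambda> a - (\<Sum>b\<in>idx C. cmat C a b * trunc (R b) i)"
proof -
  have "(\<Sum>j\<in>fst ` set_mset (R b). cmat C a b * int (min i j) * int (mult R b j))
     = cmat C a b * trunc (R b) i" for b
    using sum_mset_by_lengths[of "\<lambda>j. cmat C a b * int (min i j)" "R b"]
    by (simp add: mult_def trunc_def sum_mset_distrib_left)
  then show ?thesis by (simp add: vacancy_def)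
qed

lemma exchange_eq:
  assumes "finite (idx C)" "a \<in> idx C" "old \<subseteq># R a"
    and step: "\<And>i. trunc new i - trunc old i = (if k \<le> i then c else 0)"
  shows "exchange C \<Lambda> a old new R =
    (\<lambda>b. if b = a then image_mset (shift_label (- (c * cmat C a a)) k) (R a - old) + new
         else image_mset (shift_label (- (c * cmat C b a)) k) (R b))"
proof -
  obtain M where M: "R a = M + old" using assms(3) by (metis subset_mset.diff_add)
  let ?R0 = "R(a := R a - old + new)"
  have "vacancy C \<Lambda> ?R0 b i - vacancy C \<Lambda> R b i = (if k \<le> i then - (c * cmat C b a) else 0)" for b i
  proof -
    have "(\<Sum>e\<in>idx C. cmat C b e * trunc (?R0 e) i) - (\<Sum>e\<in>idx C. cmat C b e * trunc (R e) i)
        = (\<Sum>e\<in>idx C. if e = a then cmat C b a * (trunc new i - trunc old i) else 0)"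
      unfolding sum_subtractf[symmetric] by (rule sum.cong) (auto simp: M algebra_simps)
    also have "\<dots> = cmat C b a * (trunc new i - trunc old i)"
      using assms by simp
    finally show ?thesis unfolding vacancy_eq step by (simp add: mult.commute split: if_splits)
  qed
  then have sh: "(\<lambda>(i, y). (i, y + vacancy C \<Lambda> ?R0 b i - vacancy C \<Lambda> R b i))
      = shift_label (- (c * cmat C b a)) k" for b
    by (intro ext) (simp add: case_prod_unfold add_diff_eq[symmetric] shift_label_def)
  show ?thesis by (simp only: exchange_def Let_def sh) (auto simp: fun_eq_iff)
qed

lemma finite_lengths_of_label: "finite {i. (i, x) \<in># T}"
  by (rule finite_subset[of _ "fst ` set_mset T"]) force+

text \<open>
  The string \<open>(l, x)\<close> of \<open>R\<close> at node \<open>a\<close> is replaced by \<open>(l + 1, x - 1)\<close>, the remaining strings \<open>M\<close> at \<open>a\<close>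
  and those at the other nodes keep their colabels, and \<open>(l, x)\<close> is the string selected by \<open>f\<close>. The case
  \<open>l = x = 0\<close> is the creation of \<open>(1, -1)\<close>; for strings of positive length the condition
  on \<open>M\<close> then says that all labels are positive.
\<close>

definition fstep :: "'i cartan_datum \<Rightarrow> 'i \<Rightarrow> nat \<Rightarrow> int \<Rightarrow> (nat \<times> int) multiset
    \<Rightarrow> 'i rigged_config \<Rightarrow> 'i rigged_config \<Rightarrow> bool" where
  "fstep C a l x M R R' \<longleftrightarrow>
     (l = 0 \<longrightarrow> x = 0) \<and> x \<le> 0 \<and>
     (\<forall>s\<in>#M. x \<le> snd s \<and> (l < fst s \<longrightarrow> x < snd s)) \<and>
     R a = M + str l x \<and>
     R' = (\<lambda>b. if b = a then add_mset (Suc l, x - 1) (image_mset (shift_label (- 2) (Suc l)) M)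
               else image_mset (shift_label (- cmat C b a) (Suc l)) (R b))"

definition positive_lengths :: "'i rigged_config \<Rightarrow> bool" where
  "positive_lengths R \<longleftrightarrow> (\<forall>b. \<forall>s\<in>#R b. 0 < fst s)"

text \<open>
  The value of \<open>\<epsilon>\<close> on a rigged partition: the negative of its smallest label, or \<open>0\<close> if there is no negative
  label.
\<close>

definition min_depth :: "(nat \<times> int) multiset \<Rightarrow> nat" where
  "min_depth T = (if T = {#} then 0 else nat (- Min (snd ` set_mset T)))"

text \<open>
  The part of a symmetrizable datum that the operators depend on: the Cartan matrix, with a
  symmetrizer \<open>d\<close>.
\<close>

locale cartan =
  fixes C :: "'i cartan_datum" and d :: "'i \<Rightarrow> int"
  assumes finite_idx: "finite (idx C)"
    and gcm: "generalized_cartan_matrix (idx C) (cmat C)"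
    and d_pos: "a \<in> idx C \<Longrightarrow> 0 < d a"
    and d_sym: "a \<in> idx C \<Longrightarrow> b \<in> idx C \<Longrightarrow> d a * cmat C a b = d b * cmat C b a"
begin

lemma cmat_diag: "a \<in> idx C \<Longrightarrow> cmat C a a = 2"
  using gcm by (auto simp: generalized_cartan_matrix_def)

lemma cmat_off_diag: "a \<in> idx C \<Longrightarrow> b \<in> idx C \<Longrightarrow> a \<noteq> b \<Longrightarrow> cmat C a b \<le> 0"
  using gcm by (auto simp: generalized_cartan_matrix_def)

lemma fstep_ex:
  assumes a: "a \<in> idx C" and pos: "positive_lengths R"
  shows "\<exists>l x M. fstep C a l x M R (rc_f_raw C \<Lambda> a R)"
proof (cases "R a = {#} \<or> min_label R a > 0")
  case True
  have *: "\<forall>s\<in>#R a. 0 < snd s"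
  proof
    fix s assume s: "s \<in># R a"
    then have "min_label R a \<le> snd s" unfolding min_label_def by (intro Min_le) auto
    then show "0 < snd s" using True s by auto
  qed
  have step: "trunc {#(Suc 0, - 1)#} i - trunc {#} i = (if Suc 0 \<le> i then 1 else 0)" for i
    by auto
  have "rc_f_raw C \<Lambda> a R = (\<lambda>b. if b = a
      then add_mset (Suc 0, 0 - 1) (image_mset (shift_label (- 2) (Suc 0)) (R a))
      else image_mset (shift_label (- cmat C b a) (Suc 0)) (R b))"
    using True a by (auto simp: rc_f_raw_def exchange_eq[OF finite_idx a _ step] cmat_diag fun_eq_iff)
  then have "fstep C a 0 0 (R a) R (rc_f_raw C \<Lambda> a R)"
    using * by (auto simp: fstep_def str_def less_imp_le)
  then show ?thesis by blast
next
  case False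
  define x where "x = min_label R a"
  define l where "l = Max {i. (i, x) \<in># R a}"
  have x: "x \<in> snd ` set_mset (R a)"
    unfolding x_def min_label_def using False by (intro Min_in) auto
  note fin = finite_lengths_of_label[of x "R a"]
  have "{i. (i, x) \<in># R a} \<noteq> {}" using x by force
  then have l: "(l, x) \<in># R a" using Max_in[OF fin] unfolding l_def by blast
  then obtain M where M: "R a = add_mset (l, x) M" by (metis mset_add)
  have l0: "l > 0" using pos l by (force simp: positive_lengths_def)
  have 1: "x \<le> snd s" if "s \<in># R a" for s
    unfolding x_def min_label_def using that by (intro Min_le) auto
  have 2: "x < snd s" if "s \<in># R a" "l < fst s" for s
  proof (rule ccontr)
    assume "\<not> ?thesis"
    then have "snd s = x" using 1[OF that(1)] by simp
    then have "(fst s, x) \<in># R a" using that(1) by auto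
    then have "fst s \<le> l" unfolding l_def using fin by (intro Max_ge) auto
    then show False using that(2) by simp
  qed
  have step: "trunc {#(Suc l, x - 1)#} i - trunc {#(l, x)#} i = (if Suc l \<le> i then 1 else 0)" for i
    by auto
  have "rc_f_raw C \<Lambda> a R = exchange C \<Lambda> a {#(l, x)#} {#(Suc l, x - 1)#} R"
    using False by (auto simp: rc_f_raw_def Let_def x_def l_def)
  then have "rc_f_raw C \<Lambda> a R = (\<lambda>b. if b = a
      then add_mset (Suc l, x - 1) (image_mset (shift_label (- 2) (Suc l)) M)
      else image_mset (shift_label (- cmat C b a) (Suc l)) (R b))"
    using l a M by (simp add: exchange_eq[OF finite_idx a _ step] cmat_diag fun_eq_iff)
  then have "fstep C a l x M R (rc_f_raw C \<Lambda> a R)"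
    using False l0 1 2 M by (auto simp: fstep_def str_def x_def)
  then show ?thesis by blast
qed

lemma fstep_min_depth:
  assumes "fstep C a l x M R R'"
  shows "min_depth (R a) = nat (- x)" "min_depth (R' a) = Suc (min_depth (R a))"
    "R' a \<noteq> {#}" "min_label R' a = x - 1"
proof -
  have x: "l = 0 \<longrightarrow> x = 0" "x \<le> 0" and M: "\<And>s. s \<in># M \<Longrightarrow> x \<le> snd s"
      "\<And>s. s \<in># M \<Longrightarrow> l < fst s \<Longrightarrow> x < snd s"
    and R: "R a = M + str l x"
    and R': "R' a = add_mset (Suc l, x - 1) (image_mset (shift_label (- 2) (Suc l)) M)"
    using assms by (auto simp: fstep_def)
  show depth: "min_depth (R a) = nat (- x)"
  proof (cases "l = 0")
    case True
    then have "x = 0" using x by simp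
    show ?thesis
    proof (cases "M = {#}")
      case False
      then have "0 \<le> Min (snd ` set_mset M)"
        using M(1) \<open>x = 0\<close> by (subst Min_ge_iff) auto
      then show ?thesis using False True \<open>x = 0\<close> by (simp add: min_depth_def R str_def)
    qed (use True \<open>x = 0\<close> in \<open>simp add: min_depth_def R str_def\<close>)
  next
    case False
    have "Min (snd ` set_mset (R a)) = x"
      using False M by (intro Min_eqI) (auto simp: R str_def)
    then show ?thesis using False by (simp add: min_depth_def R str_def)
  qed
  show R'_ne: "R' a \<noteq> {#}" by (simp add: R')
  have "x - 1 \<le> snd s" if "s \<in># R' a" for s
    using that M by (fastforce simp: R' snd_shift_label)
  then show ml: "min_label R' a = x - 1"
    unfolding min_label_def by (intro Min_eqI) (auto simp: R')
  then show "min_depth (R' a) = Suc (min_depth (R a))"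
    using R'_ne x depth by (simp add: min_depth_def min_label_def)
qed

lemma fstep_rc_e:
  assumes a: "a \<in> idx C" and st: "fstep C a l x M R R'" and pos: "positive_lengths R"
  shows "rc_e C a R' = Some R"
proof -
  have x: "l = 0 \<longrightarrow> x = 0" "x \<le> 0" and M: "\<And>s. s \<in># M \<Longrightarrow> x \<le> snd s"
      "\<And>s. s \<in># M \<Longrightarrow> l < fst s \<Longrightarrow> x < snd s"
    and R: "R a = M + str l x"
    and R': "R' = (\<lambda>b. if b = a then add_mset (Suc l, x - 1) (image_mset (shift_label (- 2) (Suc l)) M)
               else image_mset (shift_label (- cmat C b a) (Suc l)) (R b))"
    using st by (auto simp: fstep_def)
  have R'a: "R' a = add_mset (Suc l, x - 1) (image_mset (shift_label (- 2) (Suc l)) M)"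
    by (simp add: R')
  have "Suc l \<le> i" if "(i, x - 1) \<in># R' a" for i
  proof (rule ccontr)
    assume "\<not> ?thesis"
    then have "(i, x - 1) \<in> shift_label (- 2) (Suc l) ` set_mset M"
      using that by (auto simp: R'a)
    then obtain s where "s \<in># M" "shift_label (- 2) (Suc l) s = (i, x - 1)" by (metis imageE)
    then show False using M(1)[of s] \<open>\<not> Suc l \<le> i\<close> by (auto simp: shift_label_def)
  qed
  moreover have "finite {i. (i, x - 1) \<in># R' a}"
    by (rule finite_lengths_of_label)
  ultimately have "Min {i. (i, x - 1) \<in># R' a} = Suc l"
    by (intro Min_eqI) (auto simp: R'a)
  then have "rc_e C a R' = Some (exchange C Infty a {#(Suc l, x - 1)#} (str l x) R')"
    using fstep_min_depth(3,4)[OF st] x by (simp add: rc_e_def Let_def str_def)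
  moreover have step: "trunc (str l x) i - trunc {#(Suc l, x - 1)#} i = (if Suc l \<le> i then - 1 else 0)"
    for i by (auto simp: trunc_str)
  have "exchange C Infty a {#(Suc l, x - 1)#} (str l x) R' = R"
    using a by (simp add: exchange_eq[OF finite_idx a _ step] R'a fun_eq_iff)
       (simp add: R' R cmat_diag)
  ultimately show ?thesis by simp
qed

text \<open>
  Conversely, \<open>e\<close> undoes a move. The hypothesis on strings of length \<open>1\<close> is needed because \<open>e\<close> deletes
  such a string whatever its label.
\<close>

lemma rc_e_fstep:
  assumes a: "a \<in> idx C" and e: "rc_e C a R' = Some R" and pos: "positive_lengths R'"
    and unit: "\<And>y. (1, y) \<in># R' a \<Longrightarrow> -1 \<le> y"
  shows "\<exists>l x M. fstep C a l x M R R'"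
proof -
  define z where "z = min_label R' a"
  define k where "k = Min {i. (i, z) \<in># R' a}"
  have ne: "R' a \<noteq> {#}" "z < 0" using e by (auto simp: rc_e_def z_def split: if_splits)
  have z: "z \<in> snd ` set_mset (R' a)"
    unfolding z_def min_label_def using ne by (intro Min_in) auto
  note fin = finite_lengths_of_label[of z "R' a"]
  have "{i. (i, z) \<in># R' a} \<noteq> {}" using z by force
  then have k: "(k, z) \<in># R' a" using Min_in[OF fin] unfolding k_def by blast
  then have "k > 0" using pos by (force simp: positive_lengths_def)
  then obtain l where l: "k = Suc l" by (cases k) auto
  define x where "x = z + 1"
  have zx: "z = x - 1" by (simp add: x_def)
  have x0: "l = 0 \<longrightarrow> x = 0" "x \<le> 0" using ne(2) unit[of z] k l by (auto simp: x_def)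
  obtain M' where M': "R' a = add_mset (Suc l, x - 1) M'" using k l zx by (metis mset_add)
  define M where "M = image_mset (shift_label 2 (Suc l)) M'"
  have M'_eq: "M' = image_mset (shift_label (- 2) (Suc l)) M" by (simp add: M_def)
  have 1: "x - 1 \<le> snd s" if "s \<in># R' a" for s
    unfolding zx[symmetric] unfolding z_def min_label_def using that by (intro Min_le) auto
  have 2: "x \<le> snd s" if "s \<in># R' a" "fst s \<le> l" for s
  proof (rule ccontr)
    assume "\<not> ?thesis"
    then have "snd s = z" using 1[OF that(1)] zx by simp
    then have "(fst s, z) \<in># R' a" using that(1) by auto
    then have "k \<le> fst s" unfolding k_def using fin by (intro Min_le) auto
    then show False using that(2) l by simp
  qed
  have cond: "x \<le> snd s \<and> (l < fst s \<longrightarrow> x < snd s)" if "s \<in># M" for s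
  proof -
    obtain t where t: "t \<in># M'" "s = shift_label 2 (Suc l) t" using \<open>s \<in># M\<close> unfolding M_def by (metis (no_types, lifting) image_iff set_image_mset)
    then show ?thesis using 1[of t] 2[of t] by (auto simp: M' snd_shift_label)
  qed
  have "R = exchange C Infty a {#(Suc l, x - 1)#} (str l x) R'"
    using e ne l by (auto simp: rc_e_def Let_def str_def zx[symmetric] z_def[symmetric] k_def[symmetric] x_def split: if_splits)
  moreover have step: "trunc (str l x) i - trunc {#(Suc l, x - 1)#} i = (if Suc l \<le> i then - 1 else 0)"
    for i by (auto simp: trunc_str)
  ultimately have R: "R = (\<lambda>b. if b = a then M + str l x
       else image_mset (shift_label (cmat C b a) (Suc l)) (R' b))"
    using a by (simp add: exchange_eq[OF finite_idx a _ step] M' fun_eq_iff M_def cmat_diag)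
  have "fstep C a l x M R R'"
    using x0 cond by (auto simp: fstep_def R M' M'_eq fun_eq_iff)
  then show ?thesis by blast
qed

lemma fstep_unique:
  assumes a: "a \<in> idx C" and st: "fstep C a l x M R R'" and pos: "positive_lengths R"
  shows "rc_f_raw C \<Lambda> a R = R'"
proof -
  obtain k z N where st': "fstep C a k z N R (rc_f_raw C \<Lambda> a R)"
    using fstep_ex[OF a pos] by blast
  have "k = l \<and> z = x \<and> N = M"
  proof -
    have zx: "z = x"
      using fstep_min_depth(1)[OF st] fstep_min_depth(1)[OF st'] st st' by (auto simp: fstep_def)
    have R: "R a = M + str l x" "R a = N + str k x" using st st' zx by (auto simp: fstep_def)
    have *: "j' \<le> j" if "fstep C a j x K R S" "fstep C a j' x K' R S'" for j j' K K' S S'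
    proof (rule ccontr)
      assume "\<not> ?thesis"
      then have "j' > j" by simp
      then have "(j', x) \<in># R a" using that by (auto simp: fstep_def str_def)
      moreover have "R a = K + str j x" using that by (auto simp: fstep_def)
      ultimately have "(j', x) \<in># K" using \<open>j' > j\<close> by (auto simp: str_def split: if_splits)
      then show False using that(1) \<open>j' > j\<close> by (auto simp: fstep_def)
    qed
    have "k = l" using *[of l M R' k N] *[of k N _ l M R'] st st' zx by (auto intro: antisym)
    then show ?thesis using zx R by auto
  qed
  then show ?thesis using st st' by (simp add: fstep_def)
qed

lemma fstep_positive:
  assumes "fstep C a l x M R R'"
  shows "positive_lengths R' \<longleftrightarrow> positive_lengths R"
proof -
  have "(\<forall>s\<in>#R' b. 0 < fst s) \<longleftrightarrow> (\<forall>s\<in>#R b. 0 < fst s)" for b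
    using assms by (cases "b = a") (auto simp: fstep_def str_def)
  then show ?thesis by (simp add: positive_lengths_def)
qed

end

section \<open>The cocharge invariant\<close>

context cartan begin

text \<open>
  Twice the cocharge, weighted by the symmetrizer; the factor \<open>2\<close> keeps it integral term by term.
\<close>

definition cocharge :: "'i rigged_config \<Rightarrow> int" where
  "cocharge \<mu> = 2 * (\<Sum>b\<in>idx C. d b * (\<Sum>s\<in>#\<mu> b. snd s))
     + (\<Sum>b\<in>idx C. \<Sum>c\<in>idx C. d b * cmat C b c * (\<Sum>s\<in>#\<mu> b. trunc (\<mu> c) (fst s)))"

text \<open>
  The invariant. The strings of a subconfiguration \<open>\<mu>\<close> keep the labels that they have in \<open>R\<close>.
\<close>

definition cocharge_nonneg :: "'i rigged_config \<Rightarrow> bool" where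
  "cocharge_nonneg R \<longleftrightarrow> (\<forall>\<mu>. (\<forall>b. \<mu> b \<subseteq># R b) \<longrightarrow> 0 \<le> cocharge \<mu>)"

text \<open>
  The interaction of a string of length \<open>j\<close> at node \<open>a\<close> with the strings of \<open>\<mu>\<close> at the other nodes.
\<close>

definition off_node :: "'i \<Rightarrow> 'i rigged_config \<Rightarrow> nat \<Rightarrow> int" where
  "off_node a \<mu> j = (\<Sum>c\<in>idx C - {a}. cmat C a c * trunc (\<mu> c) j)"

lemma off_node_0: "off_node a \<mu> 0 = 0"
  by (simp add: off_node_def)

lemma off_node_convex:
  assumes "a \<in> idx C"
  shows "off_node a \<mu> (Suc j) - off_node a \<mu> j
    \<le> off_node a \<mu> (Suc (Suc j)) - off_node a \<mu> (Suc j)"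
  unfolding off_node_def sum_subtractf[symmetric] right_diff_distrib[symmetric]
  by (intro sum_mono mult_left_mono_neg trunc_concave) (use assms cmat_off_diag in auto)

lemma off_node_antimono:
  assumes "a \<in> idx C"
  shows "off_node a \<mu> (Suc j) \<le> off_node a \<mu> j"
  unfolding off_node_def
  by (intro sum_mono mult_left_mono_neg trunc_mono) (use assms cmat_off_diag in auto)

lemma cocharge_split:
  assumes a: "a \<in> idx C"
  shows "cocharge \<mu> = cocharge (\<mu>(a := {#})) + 2 * d a * node_energy (off_node a \<mu>) (\<mu> a)"
proof -
  let ?I = "idx C - {a}"
  let ?p = "\<lambda>b c. d b * cmat C b c * (\<Sum>s\<in>#\<mu> b. trunc (\<mu> c) (fst s))"
  have I: "(\<Sum>b\<in>idx C. f b) = f a + (\<Sum>b\<in>?I. f b)" for f :: "'i \<Rightarrow> int"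
    using a finite_idx by (simp add: sum.remove)
  have sym: "?p b c = ?p c b" if "b \<in> idx C" "c \<in> idx C" for b c
    using d_sym[OF that] sum_trunc_swap[of "\<mu> c" "\<mu> b"] by simp
  have "(\<Sum>b\<in>idx C. \<Sum>c\<in>idx C. ?p b c)
      = ?p a a + (\<Sum>c\<in>?I. ?p a c) + ((\<Sum>b\<in>?I. ?p b a) + (\<Sum>b\<in>?I. \<Sum>c\<in>?I. ?p b c))"
    by (simp add: I sum.distrib)
  also have "(\<Sum>b\<in>?I. ?p b a) = (\<Sum>b\<in>?I. ?p a b)"
    by (rule sum.cong) (auto intro: sym a)
  finally have 1: "(\<Sum>b\<in>idx C. \<Sum>c\<in>idx C. ?p b c)
     = ?p a a + 2 * (\<Sum>c\<in>?I. ?p a c) + (\<Sum>b\<in>?I. \<Sum>c\<in>?I. ?p b c)" by simp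
  have 2: "(\<Sum>c\<in>?I. ?p a c) = d a * (\<Sum>s\<in>#\<mu> a. off_node a \<mu> (fst s))"
  proof -
    have "(\<Sum>c\<in>?I. cmat C a c * (\<Sum>s\<in>#T. trunc (\<mu> c) (fst s))) = (\<Sum>s\<in>#T. off_node a \<mu> (fst s))" for T
      by (induction T) (auto simp: off_node_def sum.distrib algebra_simps)
    from this[of "\<mu> a"] show ?thesis
      unfolding sum_distrib_left[symmetric] mult.assoc by simp
  qed
  have 3: "cocharge (\<mu>(a := {#})) = 2 * (\<Sum>b\<in>?I. d b * (\<Sum>s\<in>#\<mu> b. snd s)) + (\<Sum>b\<in>?I. \<Sum>c\<in>?I. ?p b c)"
  proof -
    have "(\<Sum>b\<in>?I. d b * (\<Sum>s\<in>#(\<mu>(a := {#})) b. snd s)) = (\<Sum>b\<in>?I. d b * (\<Sum>s\<in>#\<mu> b. snd s))"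
      by (rule sum.cong) auto
    moreover have "(\<Sum>b\<in>?I. \<Sum>c\<in>?I. d b * cmat C b c * (\<Sum>s\<in>#(\<mu>(a := {#})) b. trunc ((\<mu>(a := {#})) c) (fst s)))
       = (\<Sum>b\<in>?I. \<Sum>c\<in>?I. ?p b c)"
      by (intro sum.cong) auto
    ultimately show ?thesis unfolding cocharge_def I by simp
  qed
  have "cocharge \<mu> = 2 * (d a * (\<Sum>s\<in>#\<mu> a. snd s)) + 2 * (\<Sum>b\<in>?I. d b * (\<Sum>s\<in>#\<mu> b. snd s))
     + (\<Sum>b\<in>idx C. \<Sum>c\<in>idx C. ?p b c)"
    unfolding cocharge_def using I[of "\<lambda>b. d b * (\<Sum>s\<in>#\<mu> b. snd s)"] by simp
  then show ?thesis
    unfolding 1 2 3 node_energy_def by (simp add: cmat_diag a sum_mset.distrib algebra_simps)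
qed

text \<open>
  The effect of a move at \<open>a\<close> on the part of a subconfiguration that lies off \<open>a\<close>.
\<close>

lemma cocharge_shift:
  assumes a: "a \<in> idx C" and \<mu>': "\<And>b. b \<noteq> a \<Longrightarrow> \<mu>' b = image_mset (shift_label (- cmat C b a) (Suc l)) (\<mu> b)"
  shows "cocharge (\<mu>'(a := {#})) = cocharge (\<mu>(a := {#}))
      - 2 * d a * (off_node a \<mu> (Suc l) - off_node a \<mu> l)"
    and "off_node a \<mu>' = off_node a \<mu>"
proof -
  show "off_node a \<mu>' = off_node a \<mu>"
    by (auto simp: off_node_def fun_eq_iff \<mu>' intro!: sum.cong)
  let ?I = "idx C - {a}"
  have I: "(\<Sum>b\<in>idx C. f b) = f a + (\<Sum>b\<in>?I. f b)" for f :: "'i \<Rightarrow> int"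
    using a finite_idx by (simp add: sum.remove)
  have sh: "(\<Sum>s\<in>#T. snd (shift_label k (Suc l) s)) = (\<Sum>s\<in>#T. snd s) + k * (trunc T (Suc l) - trunc T l)" for k T
    by (induction T) (auto simp: snd_shift_label algebra_simps)
  have "(\<Sum>b\<in>?I. d b * (\<Sum>s\<in>#\<mu>' b. snd s))
     = (\<Sum>b\<in>?I. d b * (\<Sum>s\<in>#\<mu> b. snd s) - d a * (cmat C a b * trunc (\<mu> b) (Suc l) - cmat C a b * trunc (\<mu> b) l))"
  proof (rule sum.cong)
    fix b assume b: "b \<in> ?I"
    then have "(\<Sum>s\<in>#\<mu>' b. snd s) = (\<Sum>s\<in>#\<mu> b. snd s) - cmat C b a * (trunc (\<mu> b) (Suc l) - trunc (\<mu> b) l)"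
      by (simp add: \<mu>' multiset.map_comp comp_def sh)
    then have "d b * (\<Sum>s\<in>#\<mu>' b. snd s)
      = d b * (\<Sum>s\<in>#\<mu> b. snd s) - (d b * cmat C b a) * (trunc (\<mu> b) (Suc l) - trunc (\<mu> b) l)"
      by (simp only:) (simp add: algebra_simps)
    also have "d b * cmat C b a = d a * cmat C a b" using d_sym[of b a] a b by simp
    finally show "d b * (\<Sum>s\<in>#\<mu>' b. snd s) = d b * (\<Sum>s\<in>#\<mu> b. snd s)
        - d a * (cmat C a b * trunc (\<mu> b) (Suc l) - cmat C a b * trunc (\<mu> b) l)"
      by (simp add: algebra_simps)
  qed simp
  also have "\<dots> = (\<Sum>b\<in>?I. d b * (\<Sum>s\<in>#\<mu> b. snd s)) - d a * (off_node a \<mu> (Suc l) - off_node a \<mu> l)"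
    by (simp add: off_node_def sum_subtractf sum_distrib_left[symmetric])
  finally have 1: "(\<Sum>b\<in>?I. d b * (\<Sum>s\<in>#(\<mu>'(a := {#})) b. snd s))
     = (\<Sum>b\<in>?I. d b * (\<Sum>s\<in>#(\<mu>(a := {#})) b. snd s)) - d a * (off_node a \<mu> (Suc l) - off_node a \<mu> l)"
    by (simp cong: sum.cong_simp)
  have 2: "(\<Sum>b\<in>?I. \<Sum>c\<in>?I. d b * cmat C b c * (\<Sum>s\<in>#(\<mu>'(a := {#})) b. trunc ((\<mu>'(a := {#})) c) (fst s)))
       = (\<Sum>b\<in>?I. \<Sum>c\<in>?I. d b * cmat C b c * (\<Sum>s\<in>#(\<mu>(a := {#})) b. trunc ((\<mu>(a := {#})) c) (fst s)))"
    by (intro sum.cong) (auto simp: \<mu>' multiset.map_comp comp_def)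
  show "cocharge (\<mu>'(a := {#})) = cocharge (\<mu>(a := {#}))
      - 2 * d a * (off_node a \<mu> (Suc l) - off_node a \<mu> l)"
    unfolding cocharge_def I using 1 2 by simp
qed

text \<open>
  Subconfigurations of the target of a move are the translates of those of its source, with the
  moved string present or absent.
\<close>

lemma fstep_cocharge_nonneg:
  assumes a: "a \<in> idx C" and st: "fstep C a l x M R R'"
  shows "cocharge_nonneg R' \<longleftrightarrow> cocharge_nonneg R"
proof -
  have x: "l = 0 \<longrightarrow> x = 0" "x \<le> 0" and M1: "\<forall>s\<in>#M. x \<le> snd s"
    and M2: "\<forall>s\<in>#M. l < fst s \<longrightarrow> x < snd s"
    and R: "R a = M + str l x"
    and R': "R' = (\<lambda>b. if b = a then add_mset (Suc l, x - 1) (image_mset (shift_label (- 2) (Suc l)) M)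
               else image_mset (shift_label (- cmat C b a) (Suc l)) (R b))"
    using st by (auto simp: fstep_def)
  define tr where "tr \<mu> T = (\<lambda>b. if b = a then T
     else image_mset (shift_label (- cmat C b a) (Suc l)) (\<mu> b))" for \<mu> :: "'i rigged_config" and T
  have tr: "cocharge (tr \<mu> T) = cocharge (\<mu>(a := {#}))
      + 2 * d a * (node_energy (off_node a \<mu>) T - (off_node a \<mu> (Suc l) - off_node a \<mu> l))" for \<mu> T
    unfolding cocharge_split[OF a, of "tr \<mu> T"]
    using cocharge_shift[OF a, of "tr \<mu> T" l \<mu>] by (simp add: tr_def algebra_simps)
  have upd: "cocharge (\<mu>(a := T)) = cocharge (\<mu>(a := {#})) + 2 * d a * node_energy (off_node a \<mu>) T" for \<mu> T
  proof -
    have "off_node a (\<mu>(a := T)) = off_node a \<mu>"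
      by (auto simp: off_node_def fun_eq_iff intro!: sum.cong)
    then show ?thesis using cocharge_split[OF a, of "\<mu>(a := T)"] by simp
  qed
  have d2: "2 * d a > 0" using d_pos[OF a] by simp
  have g: "off_node a \<mu> 0 = 0"
      "\<And>j. off_node a \<mu> (Suc j) - off_node a \<mu> j \<le> off_node a \<mu> (Suc (Suc j)) - off_node a \<mu> (Suc j)"
      "\<And>j. off_node a \<mu> (Suc j) \<le> off_node a \<mu> j" for \<mu>
    using off_node_0 off_node_convex[OF a] off_node_antimono[OF a] by auto
  have moved_eq: "cocharge (tr \<mu> (add_mset (Suc l, x - 1) (image_mset (shift_label (- 2) (Suc l)) T)))
       = cocharge (\<mu>(a := T + str l x))" for \<mu> T
    unfolding tr upd[of \<mu> "T + str l x"] node_energy_moved[of l x "off_node a \<mu>", OF x(1) g(1)]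
    by simp
  show ?thesis
  proof
    assume H: "cocharge_nonneg R'"
    show "cocharge_nonneg R"
      unfolding cocharge_nonneg_def
    proof (intro allI impI)
      fix \<mu> assume \<mu>: "\<forall>b. \<mu> b \<subseteq># R b"
      have trH: "0 \<le> cocharge (tr \<mu> T)" if "T \<subseteq># R' a" for T
        using H \<mu> that unfolding cocharge_nonneg_def
        by (auto simp: tr_def R' image_mset_subseteq_mono)
      have "0 \<le> cocharge (\<mu>(a := {#})) + 2 * d a * node_energy (off_node a \<mu>) (\<mu> a)"
      proof (rule node_energy_backward[where g = "off_node a \<mu>", OF x M1 g(1,2) d2])
        fix T assume "T \<subseteq># M"
        then have "image_mset (shift_label (- 2) (Suc l)) T \<subseteq># image_mset (shift_label (- 2) (Suc l)) M"
          by (rule image_mset_subseteq_mono)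
        then have *: "image_mset (shift_label (- 2) (Suc l)) T \<subseteq># R' a"
          "add_mset (Suc l, x - 1) (image_mset (shift_label (- 2) (Suc l)) T) \<subseteq># R' a"
          by (auto simp: R' subset_mset.trans subset_mset.order_trans[OF _ mset_subset_eq_add_right])
        show "0 \<le> cocharge (\<mu>(a := {#})) - 2 * d a * (off_node a \<mu> (Suc l) - off_node a \<mu> l)
            + 2 * d a * node_energy (off_node a \<mu>) (image_mset (shift_label (- 2) (Suc l)) T)"
          using trH[OF *(1)] by (simp add: tr algebra_simps)
        show "0 \<le> cocharge (\<mu>(a := {#})) + 2 * d a * node_energy (off_node a \<mu>) (T + str l x)"
          using trH[OF *(2)] unfolding moved_eq upd[of \<mu> "T + str l x"] .
      next
        show "\<mu> a \<subseteq># M + str l x" using \<mu> R by metis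
      qed
      then show "0 \<le> cocharge \<mu>" by (simp add: cocharge_split[OF a, of \<mu>])
    qed
  next
    assume H: "cocharge_nonneg R"
    show "cocharge_nonneg R'"
      unfolding cocharge_nonneg_def
    proof (intro allI impI)
      fix \<mu>' assume \<mu>': "\<forall>b. \<mu>' b \<subseteq># R' b"
      define \<mu> where "\<mu> = (\<lambda>b. if b = a then {#} else image_mset (shift_label (cmat C b a) (Suc l)) (\<mu>' b))"
      have eq: "\<mu>' = tr \<mu> (\<mu>' a)" by (auto simp: tr_def \<mu>_def fun_eq_iff)
      have sub: "\<mu> b \<subseteq># R b" for b
      proof (cases "b = a")
        case False
        then have "\<mu>' b \<subseteq># image_mset (shift_label (- cmat C b a) (Suc l)) (R b)"
          using \<mu>'[rule_format, of b] by (simp add: R')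
        then have "\<mu> b \<subseteq># image_mset (shift_label (cmat C b a) (Suc l)) (image_mset (shift_label (- cmat C b a) (Suc l)) (R b))"
          using False unfolding \<mu>_def by (simp only: if_False image_mset_subseteq_mono)
        then show ?thesis by simp
      qed (simp add: \<mu>_def)
      have updH: "0 \<le> cocharge (\<mu>(a := T))" if "T \<subseteq># M + str l x" for T
        using H sub that R unfolding cocharge_nonneg_def by auto
      define N where "N = image_mset (shift_label (- 2) (Suc l)) M"
      have unshift: "image_mset (shift_label 2 (Suc l)) U \<subseteq># M" if "U \<subseteq># N" for U
        using image_mset_subseteq_mono[OF that, of "shift_label 2 (Suc l)"] by (simp add: N_def)
      have kept: "0 \<le> cocharge (tr \<mu> U)" if "U \<subseteq># N" for U
      proof -
        define T where "T = image_mset (shift_label 2 (Suc l)) U"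
        have "0 \<le> cocharge (\<mu>(a := {#})) - 2 * d a * (off_node a \<mu> (Suc l) - off_node a \<mu> l)
            + 2 * d a * node_energy (off_node a \<mu>) (image_mset (shift_label (- 2) (Suc l)) T)"
          by (rule node_energy_forward[where g = "off_node a \<mu>", OF x M2 g d2])
            (use updH unshift[OF that] in \<open>simp_all add: T_def flip: upd\<close>)
        then show ?thesis by (simp add: tr T_def algebra_simps)
      qed
      have "\<mu>' a \<subseteq># N + str (Suc l) (x - 1)"
        using \<mu>'[rule_format, of a] by (simp add: R' N_def str_def)
      from subset_add_str_cases[OF this] show "0 \<le> cocharge \<mu>'"
      proof
        assume "\<mu>' a \<subseteq># N"
        then show ?thesis using kept eq by metis
      next
        assume "\<exists>U. U \<subseteq># N \<and> \<mu>' a = U + str (Suc l) (x - 1)"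
        then obtain U where U: "U \<subseteq># N" "\<mu>' a = add_mset (Suc l, x - 1) U" by (auto simp: str_def)
        define T where "T = image_mset (shift_label 2 (Suc l)) U"
        have "cocharge \<mu>' = cocharge (\<mu>(a := T + str l x))"
          using moved_eq[of \<mu> T] eq U(2) by (simp add: T_def)
        then show ?thesis using updH[of "T + str l x"] unshift[OF U(1)] by (simp add: T_def)
      qed
    qed
  qed
qed

lemma cocharge_single:
  assumes a: "a \<in> idx C"
  shows "cocharge ((\<lambda>_. {#})(a := {#(i, y)#})) = 2 * d a * (y + int i)"
  unfolding cocharge_split[OF a, of "(\<lambda>_. {#})(a := {#(i, y)#})"]
  by (simp add: cocharge_def off_node_def node_energy_def)

lemma cocharge_nonneg_label:
  assumes a: "a \<in> idx C" and "cocharge_nonneg R" and "(i, y) \<in># R a"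
  shows "- int i \<le> y"
proof -
  have "0 \<le> cocharge ((\<lambda>_. {#})(a := {#(i, y)#}))"
    using assms unfolding cocharge_nonneg_def by auto
  then have "0 \<le> y + int i"
    using d_pos[OF a] unfolding cocharge_single[OF a] by (simp add: zero_le_mult_iff)
  then show ?thesis by simp
qed

section \<open>Moves within the generated crystal\<close>

lemma RC_infty_invariant:
  assumes "R \<in> RC_infty C"
  shows "positive_lengths R \<and> cocharge_nonneg R \<and> (\<forall>b. b \<notin> idx C \<longrightarrow> R b = {#})"
  using assms
proof induction
  case RC_empty
  have "\<mu> = (\<lambda>_. {#})" if "\<forall>b. \<mu> b \<subseteq># {#}" for \<mu> :: "'i rigged_config"
    using that by auto
  then show ?case
    by (auto simp: positive_lengths_def cocharge_nonneg_def) (simp add: cocharge_def)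
next
  case (RC_e R a R')
  obtain l x M where st: "fstep C a l x M R' R"
    using rc_e_fstep[of a R R'] RC_e cocharge_nonneg_label[of a R 1] by auto
  have "R' b = {#}" if "b \<notin> idx C" for b
  proof -
    have "b \<noteq> a" using that RC_e by auto
    then have "R b = image_mset (shift_label (- cmat C b a) (Suc l)) (R' b)"
      using st by (simp add: fstep_def)
    then show ?thesis using RC_e that by simp
  qed
  then show ?case
    using fstep_positive[OF st] fstep_cocharge_nonneg[OF _ st] RC_e by auto
next
  case (RC_f R a R')
  then have R': "R' = rc_f_raw C Infty a R" by (simp add: rc_f_def Let_def)
  obtain l x M where st: "fstep C a l x M R R'"
    using fstep_ex[of a R Infty] RC_f R' by auto
  have "R' b = {#}" if "b \<notin> idx C" for b
    using st that RC_f by (auto simp: fstep_def)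
  then show ?case
    using fstep_positive[OF st] fstep_cocharge_nonneg[OF _ st] RC_f by auto
qed

lemma RC_infty_rc_e:
  assumes "R' \<in> RC_infty C" "a \<in> idx C" "rc_e C a R' = Some R"
  shows "\<exists>l x M. fstep C a l x M R R'"
  using assms RC_infty_invariant[OF assms(1)] cocharge_nonneg_label[of a R' 1]
  by (intro rc_e_fstep) auto

lemma fstep_RC_infty:
  assumes a: "a \<in> idx C" and st: "fstep C a l x M R R'"
  shows "R' \<in> RC_infty C \<longleftrightarrow> R \<in> RC_infty C"
proof
  assume R': "R' \<in> RC_infty C"
  then have "positive_lengths R" using RC_infty_invariant fstep_positive[OF st] by blast
  then show "R \<in> RC_infty C" using RC_infty.RC_e[OF R' a] fstep_rc_e[OF a st] by blast
next
  assume R: "R \<in> RC_infty C"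
  then have "positive_lengths R" using RC_infty_invariant by blast
  then have "rc_f C Infty a R = Some R'" using fstep_unique[OF a st] by (simp add: rc_f_def Let_def)
  then show "R' \<in> RC_infty C" using RC_infty.RC_f[OF R a] by blast
qed

end

section \<open>Crystal axioms\<close>

lemma iter_op_0 [simp]: "iter_op g 0 x = Some x"
  by (simp add: iter_op_def)

lemma iter_op_Suc: "iter_op g (Suc k) x = Option.bind (g x) (iter_op g k)"
proof -
  have none: "((\<lambda>y. Option.bind y g) ^^ k) None = None" by (induction k) auto
  show ?thesis
    by (cases "g x") (simp_all add: iter_op_def funpow_swap1[symmetric] none del: funpow.simps add: funpow_Suc_right)
qed

lemma rc_e_eq_None: "rc_e C a R = None \<longleftrightarrow> min_depth (R a) = 0"
  by (auto simp: rc_e_def min_depth_def min_label_def Let_def)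

lemma valid_iff:
  "valid C \<Lambda> R \<longleftrightarrow> (\<forall>a\<in>idx C. \<forall>s\<in>#R a. 0 < fst s \<longrightarrow> snd s \<le> vacancy C \<Lambda> R a (fst s))"
proof -
  have "set (labels R a i) = snd ` {s. s \<in># R a \<and> fst s = i}" for a i
    by (simp add: labels_def)
  then show ?thesis unfolding valid_def by fastforce
qed

lemma pairing_diff:
  "pairing C h (\<lambda>k. \<mu> k - \<nu> k) = pairing C h \<mu> - pairing C h \<nu>"
  by (simp add: pairing_def algebra_simps sum_subtractf)

text \<open>
  A Kac--Moody datum with a fixed symmetrizer.
\<close>

locale kac_moody = cartan C d for C :: "'i cartan_datum" and d :: "'i \<Rightarrow> int" +
  assumes km: "symmetrizable_kac_moody C"
begin

lemma pairing_root: "a \<in> idx C \<Longrightarrow> b \<in> idx C \<Longrightarrow> pairing C (coroot C a) (root C b) = cmat C a b"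
  using km by (simp add: symmetrizable_kac_moody_def)

lemma pairing_fund:
  "a \<in> idx C \<Longrightarrow> b \<in> idx C \<Longrightarrow> pairing C (coroot C a) (fund C b) = (if a = b then 1 else 0)"
  using km by (simp add: symmetrizable_kac_moody_def)

lemma root_lattice: "a \<in> idx C \<Longrightarrow> lrank C \<le> k \<Longrightarrow> root C a k = 0"
  using km by (simp add: symmetrizable_kac_moody_def weight_lattice_def)

lemma base_vacancy_nonneg:
  "\<Lambda> \<in> dominant_infty C \<Longrightarrow> a \<in> idx C \<Longrightarrow> 0 \<le> base_vacancy C \<Lambda> a"
  by (auto simp: dominant_infty_def dominant_def)

lemma rc_wt_lattice:
  assumes "\<Lambda> \<in> dominant_infty C"
  shows "rc_wt C \<Lambda> R \<in> weight_lattice C"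
  using assms root_lattice
  by (auto simp: dominant_infty_def dominant_def weight_lattice_def rc_wt_def)

lemma iter_rc_e:
  assumes "R \<in> RC_infty C" "a \<in> idx C"
  shows "iter_op (rc_e C a) k R \<noteq> None \<longleftrightarrow> k \<le> min_depth (R a)"
  using assms(1)
proof (induction k arbitrary: R)
  case (Suc k)
  show ?case
  proof (cases "rc_e C a R")
    case None
    then show ?thesis using rc_e_eq_None[of C a R] by (simp add: iter_op_Suc)
  next
    case (Some R0)
    then obtain l x M where st: "fstep C a l x M R0 R" using RC_infty_rc_e Suc.prems assms(2) by blast
    have "R0 \<in> RC_infty C" using fstep_RC_infty[OF assms(2) st] Suc.prems by blast
    then show ?thesis using Suc.IH[of R0] Some fstep_min_depth(2)[OF st] by (simp add: iter_op_Suc)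
  qed
qed simp

lemma rc_eps_eq:
  assumes "R \<in> RC_infty C" "a \<in> idx C"
  shows "rc_eps C a R = int (min_depth (R a))"
proof -
  have "{k. iter_op (rc_e C a) k R \<noteq> None} = {..min_depth (R a)}"
    using iter_rc_e[OF assms] by auto
  moreover have "Max {..n} = n" for n :: nat by (rule Max_eqI) auto
  ultimately show ?thesis unfolding rc_eps_def by simp
qed

lemma fstep_wt:
  assumes a: "a \<in> idx C" and st: "fstep C a l x M R R'"
  shows "rc_wt C \<Lambda> R' = (\<lambda>k. rc_wt C \<Lambda> R k - root C a k)"
proof
  fix k
  let ?n = "\<lambda>R b. int (sum_mset (image_mset fst (R b)))"
  have n: "?n R' b = ?n R b + (if b = a then 1 else 0)" for b
    using st by (auto simp: fstep_def str_def multiset.map_comp comp_def)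
  have "(\<Sum>b\<in>idx C. ?n R' b * root C b k)
      = (\<Sum>b\<in>idx C. ?n R b * root C b k + (if b = a then root C a k else 0))"
    unfolding n by (rule sum.cong) (auto simp: algebra_simps)
  also have "\<dots> = (\<Sum>b\<in>idx C. ?n R b * root C b k) + root C a k"
    using a finite_idx by (simp add: sum.distrib)
  finally show "rc_wt C \<Lambda> R' k = rc_wt C \<Lambda> R k - root C a k" by (simp add: rc_wt_def)
qed

lemma fstep_vacancy:
  assumes a: "a \<in> idx C" and st: "fstep C a l x M R R'"
  shows "vacancy C \<Lambda> R' b i = vacancy C \<Lambda> R b i - (if l < i then cmat C b a else 0)"
proof -
  have t: "trunc (R' c) i = trunc (R c) i + (if c = a \<and> l < i then 1 else 0)" for c
    using st by (auto simp: fstep_def trunc_str)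
  have "(\<Sum>c\<in>idx C. cmat C b c * trunc (R' c) i)
      = (\<Sum>c\<in>idx C. cmat C b c * trunc (R c) i + (if c = a then if l < i then cmat C b a else 0 else 0))"
    unfolding t by (rule sum.cong) (auto simp: algebra_simps)
  also have "\<dots> = (\<Sum>c\<in>idx C. cmat C b c * trunc (R c) i) + (if l < i then cmat C b a else 0)"
    using a finite_idx by (simp add: sum.distrib)
  finally show ?thesis by (simp add: vacancy_eq)
qed

lemma vacancy_concave:
  assumes a: "a \<in> idx C" and no: "\<forall>s\<in>#R a. fst s \<noteq> Suc j"
  shows "vacancy C \<Lambda> R a (Suc (Suc j)) - vacancy C \<Lambda> R a (Suc j)
    \<le> vacancy C \<Lambda> R a (Suc j) - vacancy C \<Lambda> R a j"
proof -
  let ?t = "\<lambda>b j. trunc (R b) (Suc j) - trunc (R b) j"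
  have "(\<Sum>b\<in>idx C. cmat C a b * ?t b j) \<le> (\<Sum>b\<in>idx C. cmat C a b * ?t b (Suc j))"
  proof (rule sum_mono)
    fix b assume b: "b \<in> idx C"
    show "cmat C a b * ?t b j \<le> cmat C a b * ?t b (Suc j)"
    proof (cases "b = a")
      case True
      then show ?thesis using trunc_slope_eq[OF no] by simp
    next
      case False
      then show ?thesis using cmat_off_diag[OF a b] by (intro mult_left_mono_neg trunc_concave) auto
    qed
  qed
  then show ?thesis by (simp add: vacancy_eq right_diff_distrib sum_subtractf)
qed

text \<open>
  Validity descends along \<open>e\<close>. Only the moved string can violate it in \<open>R\<close>. If \<open>x\<close> exceeded the vacancy
  number at \<open>l\<close>, the vacancy numbers would decrease between the greatest length up to \<open>l\<close> of another
  string at \<open>a\<close> (or \<open>0\<close>, where they equal the nonnegative base value) and \<open>l\<close>; by concavity they would decrease further at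
  \<open>l + 1\<close>, and the new string would violate validity in \<open>R'\<close>.
\<close>

lemma fstep_valid:
  assumes a: "a \<in> idx C" and st: "fstep C a l x M R R'" and pos: "positive_lengths R"
    and base: "0 \<le> base_vacancy C \<Lambda> a" and val: "valid C \<Lambda> R'"
  shows "valid C \<Lambda> R"
proof -
  have x: "x \<le> 0" and M: "\<And>s. s \<in># M \<Longrightarrow> x \<le> snd s"
    and R: "R a = M + str l x"
    and R'a: "R' a = add_mset (Suc l, x - 1) (image_mset (shift_label (- 2) (Suc l)) M)"
    and R'b: "\<And>b. b \<noteq> a \<Longrightarrow> R' b = image_mset (shift_label (- cmat C b a) (Suc l)) (R b)"
    using st by (auto simp: fstep_def)
  define p where "p = vacancy C \<Lambda> R' a"
  note vac = fstep_vacancy[OF a st, of \<Lambda>]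
  have V: "snd s \<le> vacancy C \<Lambda> R' b (fst s)" if "b \<in> idx C" "s \<in># R' b" for s b
    using val that fstep_positive[OF st] pos by (auto simp: valid_iff positive_lengths_def)
  have keptM: "snd s \<le> vacancy C \<Lambda> R a (fst s)" if "s \<in># M" for s
    using V[OF a, of "shift_label (- 2) (Suc l) s"] that
    by (auto simp: R'a snd_shift_label vac cmat_diag a Suc_le_eq split: if_splits)
  have kept: "snd s \<le> vacancy C \<Lambda> R b (fst s)" if "b \<in> idx C" "b \<noteq> a" "s \<in># R b" for s b
    using V[OF that(1), of "shift_label (- cmat C b a) (Suc l) s"] that
    by (auto simp: R'b snd_shift_label vac Suc_le_eq split: if_splits)
  have pos_a: "0 < fst s" if "s \<in># R a" for s using pos that by (auto simp: positive_lengths_def)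
  have x_le: "x \<le> p l"
  proof (rule ccontr)
    assume neg: "\<not> ?thesis"
    define i where "i = Max (insert 0 {fst s |s. s \<in># M \<and> fst s \<le> l})"
    have fin: "finite (insert 0 {fst s |s. s \<in># M \<and> fst s \<le> l})"
      using finite_lengths[of M "\<lambda>s. fst s \<le> l"] by simp
    have i: "i \<in> insert 0 {fst s |s. s \<in># M \<and> fst s \<le> l}"
      unfolding i_def by (rule Max_in[OF fin]) simp
    have gap: "fst s \<le> i" if "s \<in># M" "fst s \<le> l" for s
      unfolding i_def by (rule Max_ge[OF fin]) (use that in blast)
    have pi: "x \<le> p i"
    proof (cases "i = 0")
      case True
      then show ?thesis using x base by (simp add: p_def vacancy_eq)
    next
      case False
      then obtain s where s: "s \<in># M" "fst s = i" "i \<le> l" using i by auto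
      then show ?thesis using keptM[OF s(1)] M[OF s(1)] by (simp add: p_def vac)
    qed
    have il: "i \<le> l" using i by auto
    have "- p l - (- p i) \<le> int (l - i) * (- p (Suc l) - (- p l))"
    proof (rule convex_slope_left[of i l "\<lambda>j. - p j", OF _ il])
      fix j assume "i \<le> j" "j < l"
      then have "fst s \<noteq> Suc j" if "s \<in># M" for s using gap[OF that] by linarith
      then have "\<forall>s\<in>#R' a. fst s \<noteq> Suc j" using \<open>j < l\<close> by (auto simp: R'a)
      from vacancy_concave[where R = R' and j = j and \<Lambda> = \<Lambda>, OF a this]
      show "- p (Suc j) - (- p j) \<le> - p (Suc (Suc j)) - (- p (Suc j))" by (simp add: p_def)
    qed
    moreover have "0 < - p l - (- p i)" using neg pi by simp
    ultimately have "0 < int (l - i) * (- p (Suc l) - (- p l))" by linarith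
    then have "0 < - p (Suc l) - (- p l)" by (simp add: zero_less_mult_iff)
    moreover have "x - 1 \<le> p (Suc l)" using V[OF a, of "(Suc l, x - 1)"] by (simp add: R'a p_def)
    ultimately show False using neg by linarith
  qed
  show ?thesis
    unfolding valid_iff
  proof (intro ballI impI)
    fix b s assume b: "b \<in> idx C" and s: "s \<in># R b"
    show "snd s \<le> vacancy C \<Lambda> R b (fst s)"
    proof (cases "b = a")
      case False
      then show ?thesis using kept b s by blast
    next
      case True
      then have "s \<in># M \<or> s = (l, x)" using s R by (auto simp: str_def split: if_splits)
      then show ?thesis using keptM x_le True by (auto simp: p_def vac)
    qed
  qed
qed

lemma rc_f_iff:
  assumes R: "R \<in> RC_infty C" and a: "a \<in> idx C"
  shows "rc_f C \<Lambda> a R = Some R' \<longleftrightarrow> (\<exists>l x M. fstep C a l x M R R') \<and> (\<Lambda> = Infty \<or> valid C \<Lambda> R')"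
proof -
  have pos: "positive_lengths R" using RC_infty_invariant[OF R] by blast
  have "rc_f_raw C \<Lambda> a R = R' \<longleftrightarrow> (\<exists>l x M. fstep C a l x M R R')"
    using fstep_ex[OF a pos, of \<Lambda>] fstep_unique[OF a _ pos] by blast
  then show ?thesis by (auto simp: rc_f_def Let_def)
qed

lemma rc_e_iff:
  assumes R': "R' \<in> RC_infty C" and a: "a \<in> idx C"
  shows "rc_e C a R' = Some R \<longleftrightarrow> (\<exists>l x M. fstep C a l x M R R')"
proof
  assume "\<exists>l x M. fstep C a l x M R R'"
  then obtain l x M where st: "fstep C a l x M R R'" by blast
  then have "positive_lengths R" using RC_infty_invariant[OF R'] fstep_positive by blast
  then show "rc_e C a R' = Some R" using fstep_rc_e[OF a st] by blast
qed (use RC_infty_rc_e[OF R' a] in blast)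

lemma abstract_crystal_RC:
  assumes \<Lambda>: "\<Lambda> \<in> dominant_infty C"
  shows "abstract_crystal C (RC C \<Lambda>)"
proof -
  define E where "E = {R \<in> RC_infty C. \<Lambda> = Infty \<or> valid C \<Lambda> R}"
  define ph where "ph a R = rc_eps C a R + pairing C (coroot C a) (rc_wt C \<Lambda> R)" for a R
  have step: "rc_wt C \<Lambda> R = (\<lambda>k. rc_wt C \<Lambda> R' k + root C a k)" "rc_wt C \<Lambda> R' = (\<lambda>k. rc_wt C \<Lambda> R k - root C a k)"
     "rc_eps C a R = rc_eps C a R' - 1" "rc_eps C a R' = rc_eps C a R + 1"
     "ph a R = ph a R' + 1" "ph a R' = ph a R - 1"
    if "a \<in> idx C" "R \<in> RC_infty C" "R' \<in> RC_infty C" "fstep C a l x M R R'" for a R R' l x M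
  proof -
    show wt: "rc_wt C \<Lambda> R = (\<lambda>k. rc_wt C \<Lambda> R' k + root C a k)" "rc_wt C \<Lambda> R' = (\<lambda>k. rc_wt C \<Lambda> R k - root C a k)"
      using fstep_wt[OF that(1,4), of \<Lambda>] by (simp_all add: fun_eq_iff)
    show eps: "rc_eps C a R = rc_eps C a R' - 1" "rc_eps C a R' = rc_eps C a R + 1"
      using that fstep_min_depth(2)[OF that(4)] by (simp_all add: rc_eps_eq)
    have "pairing C (coroot C a) (rc_wt C \<Lambda> R') = pairing C (coroot C a) (rc_wt C \<Lambda> R) - 2"
      unfolding wt(2) using that(1) by (simp add: pairing_diff pairing_root cmat_diag)
    then show "ph a R = ph a R' + 1" "ph a R' = ph a R - 1"
      using eps by (simp_all add: ph_def)
  qed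
  have e_E: "R \<in> E \<and> (\<exists>l x M. fstep C a l x M R R')"
    if H: "a \<in> idx C" "R' \<in> E" "rc_e C a R' = Some R" for a R R'
  proof -
    obtain l x M where st: "fstep C a l x M R R'"
      using rc_e_iff[of R' a R] H by (auto simp: E_def)
    have R: "R \<in> RC_infty C" using fstep_RC_infty[OF that(1) st] that(2) by (simp add: E_def)
    then show ?thesis
      using fstep_valid[OF that(1) st, of \<Lambda>] that(1,2) base_vacancy_nonneg[OF \<Lambda> that(1)]
        RC_infty_invariant[OF R] st by (auto simp: E_def)
  qed
  have f_E: "R' \<in> E \<and> (\<exists>l x M. fstep C a l x M R R')"
    if "a \<in> idx C" "R \<in> E" "rc_f C \<Lambda> a R = Some R'" for a R R'
    using that rc_f_iff[of R a \<Lambda> R'] fstep_RC_infty[OF that(1)] by (auto simp: E_def)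
  have fe: "rc_f C \<Lambda> a R = Some R' \<longleftrightarrow> rc_e C a R' = Some R"
    if "a \<in> idx C" "R \<in> E" "R' \<in> E" for a R R'
    using that rc_f_iff[of R a \<Lambda> R'] rc_e_iff[of R' a R] by (auto simp: E_def)
  have EI: "R \<in> E \<Longrightarrow> R \<in> RC_infty C" for R by (simp add: E_def)
  have RC: "RC C \<Lambda> = \<lparr> elts = E, eop = rc_e C, fop = rc_f C \<Lambda>, eps = rc_eps C, phi = ph, wt = rc_wt C \<Lambda> \<rparr>"
    by (simp add: RC_def E_def ph_def fun_eq_iff)
  have e_op: "y \<in> E \<and> rc_wt C \<Lambda> y = (\<lambda>k. rc_wt C \<Lambda> x k + root C a k) \<and>
           rc_eps C a y = rc_eps C a x - 1 \<and> ph a y = ph a x + 1"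
    if H: "a \<in> idx C" "x \<in> E" "rc_e C a x = Some y" for a x y
  proof -
    obtain l z M where st: "fstep C a l z M y x" and y: "y \<in> E" using e_E[OF H] by blast
    show ?thesis using step(1,3,5)[OF H(1) EI[OF y] EI[OF H(2)] st] y by (intro conjI)
  qed
  have f_op: "y \<in> E \<and> rc_wt C \<Lambda> y = (\<lambda>k. rc_wt C \<Lambda> x k - root C a k) \<and>
           rc_eps C a y = rc_eps C a x + 1 \<and> ph a y = ph a x - 1"
    if H: "a \<in> idx C" "x \<in> E" "rc_f C \<Lambda> a x = Some y" for a x y
  proof -
    obtain l z M where st: "fstep C a l z M x y" and y: "y \<in> E" using f_E[OF H] by blast
    show ?thesis using step(2,4,6)[OF H(1) EI[OF H(2)] EI[OF y] st] y by (intro conjI)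
  qed
  have phi: "ph a x = rc_eps C a x + pairing C (coroot C a) (rc_wt C \<Lambda> x)" for a x
    by (simp add: ph_def)
  show ?thesis
    unfolding abstract_crystal_def RC crystal.simps
    using rc_wt_lattice[OF \<Lambda>] e_op f_op fe phi by (intro conjI ballI allI impI) blast+
qed

end

section \<open>Foldings\<close>

lemma iter_op_one [simp]: "iter_op g (Suc 0) x = g x"
  by (simp add: iter_op_Suc) (cases "g x"; simp)

lemma foldr_bind_None: "foldr (\<lambda>b y. Option.bind y (h b)) bs None = None"
  by (induction bs) auto

lemma abstract_crystal_transport:
  assumes B: "abstract_crystal C B" and iso: "crystal_isomorphism C B V v"
  shows "abstract_crystal C V"
proof -
  have bij: "bij_betw v (elts B) (elts V)"
    and wt: "\<And>x. x \<in> elts B \<Longrightarrow> wt V (v x) = wt B x"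
    and ops: "\<And>a x. a \<in> idx C \<Longrightarrow> x \<in> elts B \<Longrightarrow> eps V a (v x) = eps B a x \<and> phi V a (v x) = phi B a x \<and>
        eop V a (v x) = map_option v (eop B a x) \<and> fop V a (v x) = map_option v (fop B a x)"
    using iso by (auto simp: crystal_isomorphism_def)
  have V: "elts V = v ` elts B" using bij by (simp add: bij_betw_def)
  have inj: "v x = v y \<longleftrightarrow> x = y" if "x \<in> elts B" "y \<in> elts B" for x y
    using bij that by (auto simp: bij_betw_def inj_on_def)
  note axB = bspec[OF bspec[OF conjunct2[OF B[unfolded abstract_crystal_def]]]]
  have e: "y \<in> elts B \<and> wt B y = (\<lambda>k. wt B x k + root C a k) \<and>
           eps B a y = eps B a x - 1 \<and> phi B a y = phi B a x + 1"
    if H: "a \<in> idx C" "x \<in> elts B" "eop B a x = Some y" for a x y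
    using axB[OF H(1,2)] H(3) by simp
  have f: "y \<in> elts B \<and> wt B y = (\<lambda>k. wt B x k - root C a k) \<and>
           eps B a y = eps B a x + 1 \<and> phi B a y = phi B a x - 1"
    if H: "a \<in> idx C" "x \<in> elts B" "fop B a x = Some y" for a x y
    using axB[OF H(1,2)] H(3) by simp
  have fe: "fop B a x = Some y \<longleftrightarrow> eop B a y = Some x"
    if H: "a \<in> idx C" "x \<in> elts B" "y \<in> elts B" for a x y
    using axB[OF H(1,2)] H(3) by blast
  have ph: "phi B a x = eps B a x + pairing C (coroot C a) (wt B x)"
    if H: "a \<in> idx C" "x \<in> elts B" for a x
    using axB[OF H] by blast
  have wtB: "wt B x \<in> weight_lattice C" if "x \<in> elts B" for x
    using B that unfolding abstract_crystal_def by blast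
  have e_iff: "eop V a (v x) = Some (v y) \<longleftrightarrow> eop B a x = Some y"
    and f_iff: "fop V a (v x) = Some (v y) \<longleftrightarrow> fop B a x = Some y"
    if H: "a \<in> idx C" "x \<in> elts B" "y \<in> elts B" for a x y
  proof -
    show "eop V a (v x) = Some (v y) \<longleftrightarrow> eop B a x = Some y"
      using ops[OF H(1,2)] e[OF H(1,2)] inj[OF _ H(3)] by (cases "eop B a x") auto
    show "fop V a (v x) = Some (v y) \<longleftrightarrow> fop B a x = Some y"
      using ops[OF H(1,2)] f[OF H(1,2)] inj[OF _ H(3)] by (cases "fop B a x") auto
  qed
  show ?thesis
    unfolding abstract_crystal_def V ball_simps
  proof (intro conjI ballI allI impI)
    show "wt V (v x) \<in> weight_lattice C" if "x \<in> elts B" for x using that wt wtB by simp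
  next
    fix a x assume a: "a \<in> idx C" and x: "x \<in> elts B"
    show "phi V a (v x) = eps V a (v x) + pairing C (coroot C a) (wt V (v x))"
      using ops[OF a x] wt[OF x] ph[OF a x] by simp
    have "y \<in> v ` elts B \<and> wt V y = (\<lambda>k. wt V (v x) k + root C a k) \<and>
           eps V a y = eps V a (v x) - 1 \<and> phi V a y = phi V a (v x) + 1"
      if y: "eop V a (v x) = Some y" for y
    proof -
      obtain y' where y': "eop B a x = Some y'" "y = v y'" using y ops[OF a x] by auto
      then show ?thesis using e[OF a x y'(1)] ops[OF a x] ops[OF a, of y'] wt[OF x] wt[of y'] by simp
    qed
    then show "y \<in> v ` elts B" "wt V y = (\<lambda>k. wt V (v x) k + root C a k)"
       "eps V a y = eps V a (v x) - 1" "phi V a y = phi V a (v x) + 1"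
      if "eop V a (v x) = Some y" for y using that by blast+
    have "y \<in> v ` elts B \<and> wt V y = (\<lambda>k. wt V (v x) k - root C a k) \<and>
           eps V a y = eps V a (v x) + 1 \<and> phi V a y = phi V a (v x) - 1"
      if y: "fop V a (v x) = Some y" for y
    proof -
      obtain y' where y': "fop B a x = Some y'" "y = v y'" using y ops[OF a x] by auto
      then show ?thesis using f[OF a x y'(1)] ops[OF a x] ops[OF a, of y'] wt[OF x] wt[of y'] by simp
    qed
    then show "y \<in> v ` elts B" "wt V y = (\<lambda>k. wt V (v x) k - root C a k)"
       "eps V a y = eps V a (v x) + 1" "phi V a y = phi V a (v x) - 1"
      if "fop V a (v x) = Some y" for y using that by blast+
    fix y assume y: "y \<in> elts B"
    show "fop V a (v x) = Some (v y) \<longleftrightarrow> eop V a (v y) = Some (v x)"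
      using e_iff[OF a y x] f_iff[OF a x y] fe[OF a x y] by simp
  qed
qed

text \<open>
  A folding with all scaling factors equal to \<open>1\<close>; \<open>fold_cmat\<close> says that the matrix entries
  of a node \<open>b\<close> of the cover with the fibre over \<open>a\<close> add up to \<open>cmat C (\<phi> b) a\<close>.
\<close>

locale folding = dom: kac_moody C d + cod: kac_moody C' d'
  for C :: "'i cartan_datum" and d and C' :: "('j::linorder) cartan_datum" and d' +
  fixes \<phi> :: "'j \<Rightarrow> 'i" and \<Psi> :: "lvec \<Rightarrow> lvec"
  assumes onto: "\<phi> ` idx C' = idx C"
    and unconnected: "b \<in> idx C' \<Longrightarrow> b' \<in> idx C' \<Longrightarrow> b \<noteq> b' \<Longrightarrow> \<phi> b = \<phi> b' \<Longrightarrow> cmat C' b b' = 0"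
    and fold_cmat: "b \<in> idx C' \<Longrightarrow> a \<in> idx C \<Longrightarrow> (\<Sum>b'\<in>fibre C' \<phi> a. cmat C' b b') = cmat C (\<phi> b) a"
    and embedding: "weight_embedding C C' \<phi> (\<lambda>_. 1) \<Psi>"
    and pairing_\<Psi>: "b \<in> idx C' \<Longrightarrow> \<mu> \<in> weight_lattice C \<Longrightarrow>
       pairing C' (coroot C' b) (\<Psi> \<mu>) = pairing C (coroot C (\<phi> b)) \<mu>"
begin

abbreviation "F \<equiv> fibre C' \<phi>"
text \<open>
  The virtualization map for scaling factors \<open>1\<close>.
\<close>

definition v :: "'i rigged_config \<Rightarrow> 'j rigged_config" where
  "v R = (\<lambda>b. if b \<in> idx C' then R (\<phi> b) else {#})"

lemma virtualization_map_eq: "virtualization_map C' \<phi> (\<lambda>_. 1) = v"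
  by (simp add: virtualization_map_def v_def fun_eq_iff case_prod_unfold)

lemma fibre_iff: "b \<in> F a \<longleftrightarrow> b \<in> idx C' \<and> \<phi> b = a"
  by (simp add: fibre_def)

lemma finite_fibre: "finite (F a)"
  using cod.finite_idx by (simp add: fibre_def)

lemma \<phi>_idx: "b \<in> idx C' \<Longrightarrow> \<phi> b \<in> idx C"
  using onto by auto

lemma fibre_nonempty: "a \<in> idx C \<Longrightarrow> F a \<noteq> {}"
  unfolding onto[symmetric] by (auto simp: fibre_def)

lemma sum_fibres:
  fixes g :: "'j \<Rightarrow> int"
  shows "(\<Sum>b\<in>idx C'. g b) = (\<Sum>a\<in>idx C. \<Sum>b\<in>F a. g b)"
  using sum.group[OF cod.finite_idx dom.finite_idx, of \<phi> g] onto by (simp add: fibre_def)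

text \<open>
  The state reached from \<open>v R\<close> when the move from \<open>R\<close> to \<open>R'\<close>, which lengthens a string of length \<open>l\<close> at \<open>a\<close>,
  has been performed at the nodes of the subset \<open>D\<close> of the fibre over \<open>a\<close>.
\<close>

definition partial :: "'i \<Rightarrow> nat \<Rightarrow> 'i rigged_config \<Rightarrow> 'i rigged_config \<Rightarrow> 'j set \<Rightarrow> 'j rigged_config" where
  "partial a l R R' D = (\<lambda>c. if c \<notin> idx C' then {#} else if c \<in> D then R' a
     else if \<phi> c = a then R a
     else image_mset (shift_label (- (\<Sum>b\<in>D. cmat C' c b)) (Suc l)) (R (\<phi> c)))"

lemma partial_empty: "partial a l R R' {} = v R"
  by (auto simp: partial_def v_def)

lemma partial_fibre:
  assumes a: "a \<in> idx C" and st: "fstep C a l x M R R'"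
  shows "partial a l R R' (F a) = v R'"
  using st fold_cmat[OF _ a] by (auto simp: partial_def v_def fibre_iff fun_eq_iff fstep_def)

lemma partial_step:
  assumes a: "a \<in> idx C" and st: "fstep C a l x M R R'"
    and b: "b \<in> F a" "b \<notin> D" and D: "D \<subseteq> F a"
  shows "fstep C' b l x M (partial a l R R' D) (partial a l R R' (insert b D))"
proof -
  have fin: "finite D" using D finite_fibre finite_subset by blast
  have R': "R' a = add_mset (Suc l, x - 1) (image_mset (shift_label (- 2) (Suc l)) M)"
    and R: "R a = M + str l x" using st by (simp_all add: fstep_def)
  have bI: "b \<in> idx C'" "\<phi> b = a" using b by (auto simp: fibre_iff)
  have "partial a l R R' (insert b D) c = image_mset (shift_label (- cmat C' c b) (Suc l)) (partial a l R R' D c)"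
    if "c \<noteq> b" for c
  proof (cases "c \<in> idx C'")
    case True
    show ?thesis
    proof (cases "\<phi> c = a")
      case eq: True
      then have "cmat C' c b = 0" using unconnected[of c b] True bI that by simp
      then show ?thesis using that True eq by (simp add: partial_def)
    next
      case neq: False
      then have "c \<notin> D" using D by (auto simp: fibre_iff)
      then show ?thesis using that True neq fin b(2) by (simp add: partial_def)
    qed
  qed (simp add: partial_def)
  moreover have "partial a l R R' (insert b D) b
      = add_mset (Suc l, x - 1) (image_mset (shift_label (- 2) (Suc l)) M)"
    using bI R' by (simp add: partial_def)
  moreover have "partial a l R R' D b = M + str l x" using bI b R by (simp add: partial_def)
  ultimately show ?thesis
    using st by (auto simp: fstep_def fun_eq_iff)
qed

lemma partial_RC_infty:
  assumes a: "a \<in> idx C" and st: "fstep C a l x M R R'" and D: "D \<subseteq> F a"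
  shows "partial a l R R' D \<in> RC_infty C' \<longleftrightarrow> v R \<in> RC_infty C'"
proof -
  have "finite D" using D finite_fibre finite_subset by blast
  then show ?thesis using D
  proof (induction D rule: finite_induct)
    case empty then show ?case by (simp add: partial_empty)
  next
    case (insert b D)
    then show ?case
      using cod.fstep_RC_infty[OF _ partial_step[OF a st, of b D]] by (auto simp: fibre_iff)
  qed
qed

lemma v_fstep_RC_infty:
  assumes "a \<in> idx C" and "fstep C a l x M R R'"
  shows "v R' \<in> RC_infty C' \<longleftrightarrow> v R \<in> RC_infty C'"
  using partial_RC_infty[OF assms, of "F a"] partial_fibre[OF assms] by simp

lemma v_RC_infty:
  assumes "R \<in> RC_infty C"
  shows "v R \<in> RC_infty C'"
  using assms
proof induction
  case RC_empty
  then show ?case using RC_infty.RC_empty[of C'] by (simp add: v_def)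
next
  case (RC_e R a R')
  then show ?case using dom.RC_infty_rc_e v_fstep_RC_infty by blast
next
  case (RC_f R a R')
  then show ?case using dom.rc_f_iff v_fstep_RC_infty by blast
qed

lemma vacancy_v:
  assumes \<Lambda>: "\<Lambda> \<in> dominant_infty C" and b: "b \<in> idx C'"
  shows "vacancy C' (virtual_weight \<Psi> \<Lambda>) (v R) b i = vacancy C \<Lambda> R (\<phi> b) i"
proof -
  have "(\<Sum>c\<in>idx C'. cmat C' b c * trunc (v R c) i)
      = (\<Sum>a\<in>idx C. \<Sum>c\<in>F a. cmat C' b c * trunc (R a) i)"
    unfolding sum_fibres by (intro sum.cong) (auto simp: v_def fibre_iff)
  also have "\<dots> = (\<Sum>a\<in>idx C. cmat C (\<phi> b) a * trunc (R a) i)"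
    by (intro sum.cong) (auto simp: fold_cmat[OF b] simp flip: sum_distrib_right)
  finally show ?thesis
    using \<Lambda> b pairing_\<Psi> by (auto simp: vacancy_eq dominant_infty_def dominant_def)
qed

lemma valid_v:
  assumes \<Lambda>: "\<Lambda> \<in> dominant_infty C"
  shows "valid C' (virtual_weight \<Psi> \<Lambda>) (v R) \<longleftrightarrow> valid C \<Lambda> R"
proof -
  have "valid C' (virtual_weight \<Psi> \<Lambda>) (v R)
    \<longleftrightarrow> (\<forall>b\<in>idx C'. \<forall>s\<in>#R (\<phi> b). 0 < fst s \<longrightarrow> snd s \<le> vacancy C \<Lambda> R (\<phi> b) (fst s))"
    using vacancy_v[OF \<Lambda>, of _ R] by (auto simp: valid_iff v_def)
  also have "\<dots> \<longleftrightarrow> valid C \<Lambda> R"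
    unfolding valid_iff onto[symmetric] by blast
  finally show ?thesis .
qed

lemma virtual_e:
  assumes R': "R' \<in> RC_infty C" and a: "a \<in> idx C"
  shows "virtual_op C' \<phi> (\<lambda>_. 1) (rc_e C') a (v R') = map_option v (rc_e C a R')"
proof (cases "rc_e C a R'")
  case None
  obtain bs b where bs: "sorted_list_of_set (F a) = bs @ [b]"
    using fibre_nonempty[OF a] finite_fibre
    by (metis rev_exhaust sorted_list_of_set_eq_Nil_iff)
  then have "b \<in> F a"
    by (metis finite_fibre in_set_conv_decomp set_sorted_list_of_set)
  then have "rc_e C' b (v R') = None"
    using None by (simp add: rc_e_eq_None v_def fibre_iff)
  then show ?thesis using None by (simp add: virtual_op_def bs foldr_bind_None)
next
  case (Some R)
  then obtain l x M where st: "fstep C a l x M R R'" using dom.RC_infty_rc_e[OF R' a] by blast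
  let ?p = "partial a l R R'"
  have vR: "v R \<in> RC_infty C'" using v_RC_infty[OF R'] v_fstep_RC_infty[OF a st] by blast
  have "foldr (\<lambda>b y. Option.bind y (iter_op (rc_e C' b) 1)) bs (Some (v R')) = Some (?p (F a - set bs))"
    if "distinct bs" "set bs \<subseteq> F a" for bs
    using that
  proof (induction bs)
    case Nil
    then show ?case by (simp add: partial_fibre[OF a st])
  next
    case (Cons b bs)
    let ?D = "F a - set (b # bs)"
    have D: "F a - set bs = insert b ?D" using Cons.prems by auto
    have b: "b \<in> F a" "b \<notin> ?D" "?D \<subseteq> F a" using Cons.prems by auto
    have "rc_e C' b (?p (insert b ?D)) = Some (?p ?D)"
      using cod.rc_e_iff[of "?p (insert b ?D)" b] partial_step[OF a st b] b
        partial_RC_infty[OF a st, of "insert b ?D"] vR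
      by (auto simp: fibre_iff simp del: insert_Diff_single)
    then show ?case using Cons D by simp
  qed
  from this[of "sorted_list_of_set (F a)"] show ?thesis
    using Some by (simp add: virtual_op_def finite_fibre partial_empty)
qed

lemma base_vacancy_virtual:
  assumes "\<Lambda> \<in> dominant_infty C" "b \<in> idx C'"
  shows "0 \<le> base_vacancy C' (virtual_weight \<Psi> \<Lambda>) b"
proof -
  have "base_vacancy C' (virtual_weight \<Psi> \<Lambda>) b = base_vacancy C \<Lambda> (\<phi> b)"
    using assms pairing_\<Psi> by (auto simp: dominant_infty_def dominant_def)
  then show ?thesis using dom.base_vacancy_nonneg[OF assms(1) \<phi>_idx[OF assms(2)]] by simp
qed

text \<open>
  When the virtual operator stops because some intermediate state is not valid, the final state is not
  valid either, since validity descends along \<open>e\<close>.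
\<close>

lemma virtual_f:
  assumes \<Lambda>: "\<Lambda> \<in> dominant_infty C" and R: "R \<in> RC_infty C" and a: "a \<in> idx C"
    and val: "\<Lambda> = Infty \<or> valid C \<Lambda> R"
  shows "virtual_op C' \<phi> (\<lambda>_. 1) (rc_f C' (virtual_weight \<Psi> \<Lambda>)) a (v R) = map_option v (rc_f C \<Lambda> a R)"
proof -
  let ?\<Lambda> = "virtual_weight \<Psi> \<Lambda>"
  define ok where "ok X \<longleftrightarrow> ?\<Lambda> = Infty \<or> valid C' ?\<Lambda> X" for X
  have \<Lambda>_Infty: "?\<Lambda> = Infty \<longleftrightarrow> \<Lambda> = Infty" by (cases \<Lambda>) auto
  have pos: "positive_lengths R" using dom.RC_infty_invariant[OF R] by blast
  obtain l x M R' where st: "fstep C a l x M R R'" and R': "R' = rc_f_raw C \<Lambda> a R"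
    using dom.fstep_ex[OF a pos] by blast
  let ?p = "partial a l R R'"
  have inRC: "?p D \<in> RC_infty C'" if "D \<subseteq> F a" for D
    using partial_RC_infty[OF a st that] v_RC_infty[OF R] by blast
  have chain: "foldr (\<lambda>b y. Option.bind y (iter_op (rc_f C' ?\<Lambda> b) 1)) bs (Some (v R))
      = (if ok (?p (set bs)) then Some (?p (set bs)) else None)"
    if "distinct bs" "set bs \<subseteq> F a" for bs
    using that
  proof (induction bs)
    case Nil
    then show ?case using val valid_v[OF \<Lambda>, of R] by (simp add: partial_empty ok_def \<Lambda>_Infty)
  next
    case (Cons b bs)
    let ?D = "set bs"
    have b: "b \<in> F a" "b \<notin> ?D" "?D \<subseteq> F a" using Cons.prems by auto
    then have bI: "b \<in> idx C'" by (simp add: fibre_iff)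
    note st' = partial_step[OF a st b]
    have pos': "positive_lengths (?p ?D)" using cod.RC_infty_invariant[OF inRC[OF b(3)]] by blast
    have prev: "ok (?p ?D)" if "ok (?p (insert b ?D))"
      using that cod.fstep_valid[OF bI st' pos' base_vacancy_virtual[OF \<Lambda> bI]] by (auto simp: ok_def)
    have "rc_f C' ?\<Lambda> b (?p ?D) = (if ok (?p (insert b ?D)) then Some (?p (insert b ?D)) else None)"
      using cod.fstep_unique[OF bI st' pos'] by (simp add: rc_f_def ok_def Let_def)
    then show ?case using Cons prev by (auto split: if_splits)
  qed
  have "rc_f C \<Lambda> a R = (if \<Lambda> = Infty \<or> valid C \<Lambda> R' then Some R' else None)"
    by (simp add: rc_f_def R' Let_def)
  moreover have "ok (v R') \<longleftrightarrow> \<Lambda> = Infty \<or> valid C \<Lambda> R'"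
    using valid_v[OF \<Lambda>] by (simp add: ok_def \<Lambda>_Infty)
  ultimately show ?thesis
    using chain[of "sorted_list_of_set (F a)"]
    by (simp add: virtual_op_def finite_fibre partial_fibre[OF a st])
qed

lemma \<Psi>_add: "\<mu> \<in> weight_lattice C \<Longrightarrow> \<nu> \<in> weight_lattice C \<Longrightarrow> \<Psi> (\<lambda>k. \<mu> k + \<nu> k) = (\<lambda>k. \<Psi> \<mu> k + \<Psi> \<nu> k)"
  using embedding by (auto simp: weight_embedding_def)

lemma \<Psi>_zero: "\<Psi> (\<lambda>_. 0) = (\<lambda>_. 0)"
proof -
  have "(\<lambda>_. 0) \<in> weight_lattice C" by (simp add: weight_lattice_def)
  from \<Psi>_add[OF this this] show ?thesis by (simp add: fun_eq_iff)
qed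

lemma \<Psi>_root: "a \<in> idx C \<Longrightarrow> \<Psi> (root C a) = (\<lambda>k. \<Sum>b\<in>F a. root C' b k)"
  using embedding by (auto simp: weight_embedding_def)

lemma root_in_lattice: "a \<in> idx C \<Longrightarrow> root C a \<in> weight_lattice C"
  using dom.km by (simp add: symmetrizable_kac_moody_def)

lemma \<Psi>_diff_roots:
  assumes \<mu>: "\<mu> \<in> weight_lattice C" and J: "finite J" "J \<subseteq> idx C"
  shows "\<Psi> (\<lambda>k. \<mu> k - (\<Sum>a\<in>J. int (n a) * root C a k))
       = (\<lambda>k. \<Psi> \<mu> k - (\<Sum>a\<in>J. int (n a) * (\<Sum>b\<in>F a. root C' b k)))"
  using J
proof (induction J rule: finite_induct)
  case empty then show ?case by simp
next
  case (insert a J)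
  have lat: "(\<lambda>k. \<nu> k - c * root C a k) \<in> weight_lattice C" if "\<nu> \<in> weight_lattice C" for \<nu> c
    using that root_in_lattice[of a] insert.prems by (simp add: weight_lattice_def)
  have one: "\<Psi> (\<lambda>k. \<nu> k - int m * root C a k) = (\<lambda>k. \<Psi> \<nu> k - int m * (\<Sum>b\<in>F a. root C' b k))"
    if \<nu>: "\<nu> \<in> weight_lattice C" for \<nu> m
  proof (induction m)
    case 0 then show ?case by simp
  next
    case (Suc m)
    have "\<Psi> (\<lambda>k. (\<nu> k - int (Suc m) * root C a k) + root C a k)
       = (\<lambda>k. \<Psi> (\<lambda>k. \<nu> k - int (Suc m) * root C a k) k + \<Psi> (root C a) k)"
      using \<Psi>_add[OF lat[OF \<nu>] root_in_lattice] insert.prems by simp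
    moreover have "(\<lambda>k. (\<nu> k - int (Suc m) * root C a k) + root C a k) = (\<lambda>k. \<nu> k - int m * root C a k)"
      by (simp add: algebra_simps)
    ultimately have "\<Psi> (\<lambda>k. \<nu> k - int m * root C a k)
        = (\<lambda>k. \<Psi> (\<lambda>k. \<nu> k - int (Suc m) * root C a k) k + \<Psi> (root C a) k)"
      by (simp only:)
    then have "\<Psi> \<nu> k - int m * (\<Sum>b\<in>F a. root C' b k)
        = \<Psi> (\<lambda>k. \<nu> k - int (Suc m) * root C a k) k + (\<Sum>b\<in>F a. root C' b k)" for k
      unfolding Suc using \<Psi>_root[of a] insert.prems by (simp add: fun_eq_iff)
    then show ?case by (simp add: fun_eq_iff algebra_simps)
  qed
  have "(\<lambda>k. \<mu> k - (\<Sum>a\<in>J. int (n a) * root C a k)) \<in> weight_lattice C"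
    using \<mu> root_in_lattice insert.prems by (auto simp: weight_lattice_def subset_iff)
  from one[OF this, of "n a"] show ?case
    using insert by (simp add: algebra_simps)
qed

lemma wt_v:
  assumes \<Lambda>: "\<Lambda> \<in> dominant_infty C"
  shows "rc_wt C' (virtual_weight \<Psi> \<Lambda>) (v R) = \<Psi> (rc_wt C \<Lambda> R)"
proof -
  define \<mu> where "\<mu> = (case \<Lambda> of Weight \<mu> \<Rightarrow> \<mu> | Infty \<Rightarrow> (\<lambda>_. 0))"
  define n where "n a = sum_mset (image_mset fst (R a))" for a
  have \<mu>: "\<mu> \<in> weight_lattice C"
    using \<Lambda> by (auto simp: \<mu>_def dominant_infty_def dominant_def weight_lattice_def)
  have "rc_wt C \<Lambda> R = (\<lambda>k. \<mu> k - (\<Sum>a\<in>idx C. int (n a) * root C a k))"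
    by (cases \<Lambda>) (simp_all add: rc_wt_def \<mu>_def n_def)
  then have 1: "\<Psi> (rc_wt C \<Lambda> R) = (\<lambda>k. \<Psi> \<mu> k - (\<Sum>a\<in>idx C. int (n a) * (\<Sum>b\<in>F a. root C' b k)))"
    using \<Psi>_diff_roots[OF \<mu> dom.finite_idx subset_refl, of n] by simp
  have "(\<Sum>b\<in>idx C'. int (sum_mset (image_mset fst (v R b))) * root C' b k)
     = (\<Sum>a\<in>idx C. \<Sum>b\<in>F a. int (n a) * root C' b k)" for k
    unfolding sum_fibres by (intro sum.cong) (auto simp: v_def fibre_iff n_def)
  then have "rc_wt C' (virtual_weight \<Psi> \<Lambda>) (v R)
     = (\<lambda>k. \<Psi> \<mu> k - (\<Sum>a\<in>idx C. int (n a) * (\<Sum>b\<in>F a. root C' b k)))"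
    by (cases \<Lambda>) (simp_all add: rc_wt_def \<mu>_def sum_distrib_left \<Psi>_zero)
  then show ?thesis using 1 by simp
qed

lemma virtual_weight_dominant:
  assumes "\<Lambda> \<in> dominant_infty C"
  shows "virtual_weight \<Psi> \<Lambda> \<in> dominant_infty C'"
proof (cases \<Lambda>)
  case (Weight \<mu>)
  then have \<mu>: "\<mu> \<in> weight_lattice C" "\<And>a. a \<in> idx C \<Longrightarrow> 0 \<le> pairing C (coroot C a) \<mu>"
    using assms by (auto simp: dominant_infty_def dominant_def)
  then have "\<Psi> \<mu> \<in> weight_lattice C'" using embedding by (auto simp: weight_embedding_def)
  then show ?thesis using Weight \<mu> pairing_\<Psi> \<phi>_idx by (simp add: dominant_infty_def dominant_def)
qed (simp add: dominant_infty_def)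

lemma inj_on_v: "inj_on v (RC_infty C)"
proof (rule inj_onI)
  fix R S assume R: "R \<in> RC_infty C" and S: "S \<in> RC_infty C" and eq: "v R = v S"
  show "R = S"
  proof
    fix a
    show "R a = S a"
    proof (cases "a \<in> idx C")
      case True
      then obtain b where "b \<in> idx C'" "\<phi> b = a" unfolding onto[symmetric] by auto
      then show ?thesis using fun_cong[OF eq, of b] by (simp add: v_def)
    next
      case False
      then show ?thesis using dom.RC_infty_invariant[OF R] dom.RC_infty_invariant[OF S] by simp
    qed
  qed
qed

lemma RC_virtualizes:
  assumes \<Lambda>: "\<Lambda> \<in> dominant_infty C"
  shows "virtualizes C C' \<phi> (\<lambda>_. 1) \<Psi> (RC C \<Lambda>) (RC C' (virtual_weight \<Psi> \<Lambda>))
    (virtualization_map C' \<phi> (\<lambda>_. 1))"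
proof -
  let ?B = "RC C \<Lambda>" and ?B' = "RC C' (virtual_weight \<Psi> \<Lambda>)"
  define u where "u = the_inv_into (elts ?B) v"
  define V where "V = \<lparr> elts = v ` elts ?B,
     eop = virtual_op C' \<phi> (\<lambda>_. 1) (eop ?B'), fop = virtual_op C' \<phi> (\<lambda>_. 1) (fop ?B'),
     eps = (\<lambda>a y. eps ?B a (u y)), phi = (\<lambda>a y. phi ?B a (u y)), wt = (\<lambda>y. wt ?B (u y)) \<rparr>"
  have E: "R \<in> elts ?B \<longleftrightarrow> R \<in> RC_infty C \<and> (\<Lambda> = Infty \<or> valid C \<Lambda> R)" for R by (simp add: RC_def)
  have inj: "inj_on v (elts ?B)" using inj_on_v by (rule inj_on_subset) (use E in blast)
  have u: "u (v R) = R" if "R \<in> elts ?B" for R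
    using that inj by (simp add: u_def the_inv_into_f_f)
  have B: "abstract_crystal C ?B" by (rule dom.abstract_crystal_RC[OF \<Lambda>])
  have B': "abstract_crystal C' ?B'" by (rule cod.abstract_crystal_RC[OF virtual_weight_dominant[OF \<Lambda>]])
  have eop: "eop V a (v R) = map_option v (eop ?B a R)" if "a \<in> idx C" "R \<in> elts ?B" for a R
    using virtual_e[of R a] that E[of R] by (simp add: V_def RC_def)
  have fop: "fop V a (v R) = map_option v (fop ?B a R)" if "a \<in> idx C" "R \<in> elts ?B" for a R
    using virtual_f[OF \<Lambda>, of R a] that E[of R] by (simp add: V_def RC_def)
  have iso: "crystal_isomorphism C ?B V v"
    unfolding crystal_isomorphism_def
    using inj eop fop u by (simp add: bij_betw_def) (simp add: V_def)
  have sub: "elts V \<subseteq> elts ?B'"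
  proof
    fix y assume "y \<in> elts V"
    then obtain R where R: "R \<in> elts ?B" "y = v R" by (auto simp: V_def)
    moreover have "virtual_weight \<Psi> \<Lambda> = Infty \<longleftrightarrow> \<Lambda> = Infty" by (cases \<Lambda>) auto
    ultimately show "y \<in> elts ?B'"
      using E[of R] v_RC_infty[of R] valid_v[OF \<Lambda>, of R] by (auto simp: RC_def)
  qed
  have eps: "rc_eps C' b (v R) = rc_eps C a R"
    if "a \<in> idx C" "R \<in> elts ?B" "b \<in> F a" for a b R
    using that E[of R] v_RC_infty[of R] by (simp add: dom.rc_eps_eq cod.rc_eps_eq fibre_iff v_def)
  have phi: "pairing C' (coroot C' b) (rc_wt C' (virtual_weight \<Psi> \<Lambda>) (v R)) = pairing C (coroot C a) (rc_wt C \<Lambda> R)"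
    if "b \<in> F a" for a b R
    using that pairing_\<Psi>[OF _ dom.rc_wt_lattice[OF \<Lambda>]] by (simp add: wt_v[OF \<Lambda>] fibre_iff)
  have "virtual_crystal C C' \<phi> (\<lambda>_. 1) \<Psi> ?B' V"
    unfolding virtual_crystal_def
  proof (intro conjI ballI)
    show "elts V \<subseteq> elts ?B'" by (rule sub)
    show "abstract_crystal C V" by (rule abstract_crystal_transport[OF B iso])
    show "\<Psi> (wt V y) = wt ?B' y" if "y \<in> elts V" for y
      using that u wt_v[OF \<Lambda>] by (auto simp: V_def RC_def)
  next
    fix a y assume a: "a \<in> idx C" and "y \<in> elts V"
    then obtain R where R: "R \<in> elts ?B" and y: "y = v R" by (auto simp: V_def)
    show "eop V a y = virtual_op C' \<phi> (\<lambda>_. 1) (eop ?B') a y" by (simp add: V_def)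
    show "fop V a y = virtual_op C' \<phi> (\<lambda>_. 1) (fop ?B') a y" by (simp add: V_def)
    fix b assume b: "b \<in> F a"
    have "eps V a y = rc_eps C a R" "eps ?B' b y = rc_eps C' b y"
      "phi V a y = rc_eps C a R + pairing C (coroot C a) (rc_wt C \<Lambda> R)"
      "phi ?B' b y = rc_eps C' b y + pairing C' (coroot C' b) (rc_wt C' (virtual_weight \<Psi> \<Lambda>) y)"
      using u[OF R] by (simp_all add: V_def y) (simp_all add: RC_def)
    then show "int 1 * eps V a y = eps ?B' b y" "int 1 * phi V a y = phi ?B' b y"
      using eps[OF a R b] phi[OF b] by (simp_all add: y)
  qed
  then show ?thesis unfolding virtualizes_def virtualization_map_eq using B B' iso by blast
qed

end

section \<open>Biregular bipartite graphs\<close>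

text \<open>
  The \<open>m * p\<close> edges are numbered; consecutive blocks of \<open>p\<close> of them are attached to the \<open>m\<close> left vertices, and
  their right ends run cyclically through the \<open>n\<close> right vertices.
\<close>

definition biregular :: "nat \<Rightarrow> nat \<Rightarrow> nat \<Rightarrow> nat \<Rightarrow> nat \<Rightarrow> bool" where
  "biregular m p n x y \<longleftrightarrow> (\<exists>e < m * p. e div p = x \<and> e mod n = y)"

lemma card_biregular_left:
  assumes "x < m" "p \<le> n" "0 < n"
  shows "card {y. y < n \<and> biregular m p n x y} = p"
proof (cases "p = 0")
  case True
  then show ?thesis by (simp add: biregular_def)
next
  case False
  have "{y. y < n \<and> biregular m p n x y} = (\<lambda>e. e mod n) ` {p * x..<p * x + p}"
  proof (intro equalityI subsetI)
    fix y assume "y \<in> {y. y < n \<and> biregular m p n x y}"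
    then obtain e where e: "e div p = x" "e mod n = y" by (auto simp: biregular_def)
    have "p * x \<le> e" "e < p * x + p" using e(1) False
      using div_times_less_eq_dividend[of e p] dividend_less_div_times[of p e] by (simp_all add: algebra_simps)
    then show "y \<in> (\<lambda>e. e mod n) ` {p * x..<p * x + p}" using e(2) by auto
  next
    fix y assume "y \<in> (\<lambda>e. e mod n) ` {p * x..<p * x + p}"
    then obtain e where e: "p * x \<le> e" "e < p * x + p" "e mod n = y" by auto
    have "e div p = x" using e(1,2) False by (intro div_nat_eqI) (auto simp: algebra_simps)
    moreover have "e < m * p"
    proof -
      have "p * x + p = p * Suc x" by simp
      also have "\<dots> \<le> p * m" using assms(1) by (intro mult_le_mono2) simp
      finally show ?thesis using e(2) by (simp add: mult.commute)
    qed
    ultimately show "y \<in> {y. y < n \<and> biregular m p n x y}"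
      using e(3) assms(3) by (auto simp: biregular_def)
  qed
  moreover have "inj_on (\<lambda>e. e mod n) {p * x..<p * x + p}"
  proof (rule inj_onI)
    fix e e' assume e: "e \<in> {p * x..<p * x + p}" "e' \<in> {p * x..<p * x + p}" "e mod n = e' mod n"
    have *: "a = b" if "a \<le> b" "b - a < n" "a mod n = b mod n" for a b :: nat
    proof -
      have "n dvd b - a" using mod_eq_dvd_iff_nat[OF that(1), of n] that(3) by simp
      then have "b - a = 0" using that(2) by (meson dvd_imp_le not_le neq0_conv)
      then show ?thesis using that(1) by simp
    qed
    have range: "p * x \<le> e" "e < p * x + p" "p * x \<le> e'" "e' < p * x + p"
      using e(1,2) by simp_all
    show "e = e'"
    proof (cases "e \<le> e'")
      case True
      moreover have "e' - e < n" using range assms(2) by linarith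
      ultimately show ?thesis using e(3) by (rule *)
    next
      case False
      then have "e' \<le> e" by simp
      moreover have "e - e' < n" using range assms(2) by linarith
      ultimately show ?thesis using e(3)[symmetric] by (rule *[symmetric])
    qed
  qed
  ultimately show ?thesis by (simp add: card_image)
qed

lemma card_biregular_right:
  assumes "y < n" "p \<le> n" "m * p = n * q"
  shows "card {x. x < m \<and> biregular m p n x y} = q"
proof (cases "p = 0")
  case True
  then show ?thesis using assms by (auto simp: biregular_def)
next
  case False
  have "{x. x < m \<and> biregular m p n x y} = (\<lambda>k. (y + k * n) div p) ` {..<q}"
  proof (intro equalityI subsetI)
    fix x assume "x \<in> {x. x < m \<and> biregular m p n x y}"
    then obtain e where e: "e < n * q" "e div p = x" "e mod n = y" using assms(3) by (auto simp: biregular_def)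
    have "x = (y + (e div n) * n) div p" using e(2,3) mod_div_mult_eq[of e n] by simp
    moreover have "e div n < q" using e(1) by (simp add: less_mult_imp_div_less mult.commute)
    ultimately show "x \<in> (\<lambda>k. (y + k * n) div p) ` {..<q}" by (intro image_eqI) auto
  next
    fix x assume "x \<in> (\<lambda>k. (y + k * n) div p) ` {..<q}"
    then obtain k where k: "k < q" "x = (y + k * n) div p" by auto
    have "y + k * n < Suc k * n" using assms(1) by simp
    also have "\<dots> \<le> q * n" using k(1) by (intro mult_le_mono1) simp
    finally have e: "y + k * n < m * p" using assms(3) by (simp add: mult.commute)
    then have "x < m" using k(2) by (simp add: less_mult_imp_div_less)
    moreover have "(y + k * n) mod n = y" using assms(1) by simp
    ultimately show "x \<in> {x. x < m \<and> biregular m p n x y}"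
      using e k(2) by (auto simp: biregular_def)
  qed
  moreover have "inj_on (\<lambda>k. (y + k * n) div p) {..<q}"
  proof -
    have "strict_mono (\<lambda>k. (y + k * n) div p)"
    proof (rule strict_mono_Suc_iff[THEN iffD2], rule allI)
      fix k
      have "(y + k * n) div p < (y + k * n + p) div p"
        using False by (subst div_add_self2) auto
      also have "\<dots> \<le> (y + Suc k * n) div p" using assms(2) by (intro div_le_mono) simp
      finally show "(y + k * n) div p < (y + Suc k * n) div p" .
    qed
    then show ?thesis by (meson inj_on_subset strict_mono_imp_inj_on subset_UNIV)
  qed
  ultimately show ?thesis by (simp add: card_image)
qed

section \<open>The simply-laced cover\<close>

context cartan
begin

text \<open>
  A simply-laced symmetric matrix \<open>B\<close> on \<open>{..<m}\<close> that folds to the Cartan matrix.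
\<close>

lemma simply_laced_cover:
  obtains m :: nat and \<phi> :: "nat \<Rightarrow> 'i" and B :: "nat \<Rightarrow> nat \<Rightarrow> int"
  where "\<phi> ` {..<m} = idx C"
    and "\<And>i j. i < m \<Longrightarrow> j < m \<Longrightarrow> B i j = B j i"
    and "\<And>i. B i i = 2"
    and "\<And>i j. i \<noteq> j \<Longrightarrow> B i j \<in> {0, -1}"
    and "\<And>i j. i \<noteq> j \<Longrightarrow> \<phi> i = \<phi> j \<Longrightarrow> B i j = 0"
    and "\<And>i a. i < m \<Longrightarrow> a \<in> idx C \<Longrightarrow> (\<Sum>j\<in>{j. j < m \<and> \<phi> j = a}. B i j) = cmat C (\<phi> i) a"
proof -
  \<comment> \<open>\<open>M\<close> bounds all matrix entries, so the fibres are large enough for simple graphs of the required degrees\<close>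
  define M where "M = 1 + (\<Sum>a\<in>idx C. \<Sum>b\<in>idx C. \<bar>cmat C a b\<bar>)"
  define N where "N a = nat (M * d a)" for a
  define p where "p a b = nat (- cmat C a b)" for a b
  have M_ge: "\<bar>cmat C a b\<bar> + 1 \<le> M" if "a \<in> idx C" "b \<in> idx C" for a b
  proof -
    have "\<bar>cmat C a b\<bar> \<le> (\<Sum>b\<in>idx C. \<bar>cmat C a b\<bar>)"
      using that finite_idx by (intro member_le_sum) auto
    also have "\<dots> \<le> (\<Sum>a\<in>idx C. \<Sum>b\<in>idx C. \<bar>cmat C a b\<bar>)"
      using that finite_idx by (intro member_le_sum[of a _ "\<lambda>a. \<Sum>b\<in>idx C. \<bar>cmat C a b\<bar>"]) (auto intro: sum_nonneg)
    finally show ?thesis by (simp add: M_def)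
  qed
  have M_le: "M \<le> M * d a" if "a \<in> idx C" for a
    using mult_left_mono[of 1 "d a" M] d_pos[OF that] M_ge[OF that that] by simp
  have M_pos: "0 < M" unfolding M_def by (smt (verit) sum_nonneg abs_ge_zero)
  have N: "int (N a) = M * d a" if "a \<in> idx C" for a
    using M_le[OF that] M_pos by (simp add: N_def)
  have N_pos: "0 < N a" if "a \<in> idx C" for a using N[OF that] M_le[OF that] M_pos by linarith
  have p: "int (p a b) = - cmat C a b" if "a \<in> idx C" "b \<in> idx C" "a \<noteq> b" for a b
    using cmat_off_diag[OF that] by (simp add: p_def)
  have p_le: "p a b \<le> N b" if "a \<in> idx C" "b \<in> idx C" "a \<noteq> b" for a b
    using p[OF that] N[OF that(2)] M_le[OF that(2)] M_ge[OF that(1,2)] by linarith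
  have Np: "N a * p a b = N b * p b a" if "a \<in> idx C" "b \<in> idx C" "a \<noteq> b" for a b
  proof -
    have "int (N a * p a b) = - (M * (d a * cmat C a b))"
      using that by (simp add: N p)
    also have "\<dots> = int (N b * p b a)"
      using that d_sym[OF that(1,2)] by (simp add: N p)
    finally show ?thesis by linarith
  qed
  obtain f :: "'i \<Rightarrow> nat" where f: "inj_on f (idx C)"
    using finite_imp_inj_to_nat_seg[OF finite_idx] by blast
  \<comment> \<open>the auxiliary injection \<open>f\<close> into \<open>nat\<close> decides which of two nodes is on the left\<close>
  define W where "W a x b y = (if f a < f b then biregular (N a) (p a b) (N b) x y
      else biregular (N b) (p b a) (N a) y x)" for a x b y
  have W_sym: "W a x b y = W b y a x" if "a \<in> idx C" "b \<in> idx C" "a \<noteq> b" for a b x y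
    using that f by (auto simp: W_def inj_on_def neq_iff)
  have W_card: "card {y. y < N b \<and> W a x b y} = p a b" if "a \<in> idx C" "b \<in> idx C" "a \<noteq> b" "x < N a" for a b x
  proof (cases "f a < f b")
    case True
    then show ?thesis using card_biregular_left[OF that(4) p_le[OF that(1-3)] N_pos[OF that(2)]] by (simp add: W_def)
  next
    case False
    then show ?thesis
      using card_biregular_right[OF that(4) p_le[OF that(2,1)] Np[OF that(2,1)]] that by (simp add: W_def)
  qed
  let ?S = "Sigma (idx C) (\<lambda>a. {..<N a})"
  obtain h where h: "bij_betw h {0..<card ?S} ?S"
    using ex_bij_betw_nat_finite[of ?S] finite_idx by auto
  define m where "m = card ?S"
  define \<phi> where "\<phi> = fst \<circ> h"
  define pos where "pos = snd \<circ> h"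
  have hm: "h ` {..<m} = ?S" "inj_on h {..<m}" using h by (auto simp: bij_betw_def m_def atLeast0LessThan)
  have h_in: "\<phi> i \<in> idx C" "pos i < N (\<phi> i)" if "i < m" for i
  proof -
    have "h i \<in> ?S" using hm(1) that by (metis imageI lessThan_iff)
    then show "\<phi> i \<in> idx C" "pos i < N (\<phi> i)" by (auto simp: \<phi>_def pos_def)
  qed
  have onto: "\<phi> ` {..<m} = idx C"
  proof -
    have "\<phi> ` {..<m} = fst ` ?S" unfolding \<phi>_def image_comp[symmetric] hm(1) ..
    also have "\<dots> = idx C" using N_pos by (force simp: image_iff)
    finally show ?thesis .
  qed
  define B :: "nat \<Rightarrow> nat \<Rightarrow> int" where "B i j = (if i = j then 2 else if \<phi> i = \<phi> j then 0
      else if W (\<phi> i) (pos i) (\<phi> j) (pos j) then -1 else 0)" for i j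
  have fold: "(\<Sum>j\<in>{j. j < m \<and> \<phi> j = a}. B i j) = cmat C (\<phi> i) a" if i: "i < m" and a: "a \<in> idx C" for i a
  proof (cases "\<phi> i = a")
    case True
    have "(\<Sum>j\<in>{j. j < m \<and> \<phi> j = a}. B i j) = (\<Sum>j\<in>{j. j < m \<and> \<phi> j = a}. if i = j then 2 else 0)"
      by (rule sum.cong) (use True in \<open>auto simp: B_def\<close>)
    also have "\<dots> = 2" using i True by simp
    finally show ?thesis using True a by (simp add: cmat_diag)
  next
    case False
    have "(\<Sum>j\<in>{j. j < m \<and> \<phi> j = a}. B i j)
        = (\<Sum>j\<in>{j. j < m \<and> \<phi> j = a}. if W (\<phi> i) (pos i) a (pos j) then -1 else 0)"
      by (rule sum.cong) (use False in \<open>auto simp: B_def\<close>)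
    also have "\<dots> = - int (card {j \<in> {j. j < m \<and> \<phi> j = a}. W (\<phi> i) (pos i) a (pos j)})"
      by (simp add: sum.If_cases Int_def)
    also have "card {j \<in> {j. j < m \<and> \<phi> j = a}. W (\<phi> i) (pos i) a (pos j)}
        = card {y. y < N a \<and> W (\<phi> i) (pos i) a y}"
    proof (rule bij_betw_same_card[of pos])
      have "inj_on pos {j \<in> {j. j < m \<and> \<phi> j = a}. W (\<phi> i) (pos i) a (pos j)}"
      proof (rule inj_onI)
        fix j k assume "j \<in> {j \<in> {j. j < m \<and> \<phi> j = a}. W (\<phi> i) (pos i) a (pos j)}"
          "k \<in> {j \<in> {j. j < m \<and> \<phi> j = a}. W (\<phi> i) (pos i) a (pos j)}" "pos j = pos k"
        then have "h j = h k" "j < m" "k < m" by (auto simp: \<phi>_def pos_def prod_eq_iff)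
        then show "j = k" using hm(2) by (auto simp: inj_on_def)
      qed
      moreover have "pos ` {j \<in> {j. j < m \<and> \<phi> j = a}. W (\<phi> i) (pos i) a (pos j)}
          = {y. y < N a \<and> W (\<phi> i) (pos i) a y}"
      proof (intro equalityI subsetI)
        fix y assume y: "y \<in> {y. y < N a \<and> W (\<phi> i) (pos i) a y}"
        then have "(a, y) \<in> h ` {..<m}" using a hm(1) by simp
        then obtain j where "j < m" "h j = (a, y)" by auto
        then show "y \<in> pos ` {j \<in> {j. j < m \<and> \<phi> j = a}. W (\<phi> i) (pos i) a (pos j)}"
          using y by (intro image_eqI[of _ _ j]) (auto simp: \<phi>_def pos_def)
      qed (use h_in(2) in auto)
      ultimately show "bij_betw pos {j \<in> {j. j < m \<and> \<phi> j = a}. W (\<phi> i) (pos i) a (pos j)}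
          {y. y < N a \<and> W (\<phi> i) (pos i) a y}" by (simp add: bij_betw_def)
    qed
    also have "\<dots> = p (\<phi> i) a" using W_card[OF h_in(1)[OF i] a False h_in(2)[OF i]] .
    finally show ?thesis using p[OF h_in(1)[OF i] a False] by simp
  qed
  show thesis
  proof (rule that[of \<phi> m B])
    show "B i j = B j i" if "i < m" "j < m" for i j
      using W_sym[OF h_in(1)[OF that(1)] h_in(1)[OF that(2)]] by (auto simp: B_def)
  qed (use onto fold in \<open>auto simp: B_def\<close>)
qed

end

section \<open>Linear algebra over the rationals\<close>

lemma sum_fun_apply: "(\<Sum>x\<in>A. f x) k = (\<Sum>x\<in>A. f x k)"
  by (induction A rule: infinite_finite_induct) auto

lemma clear_denominators:
  assumes "finite J"
  shows "\<exists>D::int. 0 < D \<and> (\<forall>a\<in>J. \<exists>z::int. of_int D * (c a :: rat) = of_int z)"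
  using assms
proof (induction J rule: finite_induct)
  case empty
  show ?case by (intro exI[of _ 1]) auto
next
  case (insert a J)
  then obtain D where D: "0 < D" "\<forall>a\<in>J. \<exists>z::int. of_int D * c a = of_int z" by auto
  obtain p q where pq: "c a = Fract p q" "0 < q" by (cases "c a") auto
  then have a: "of_int q * c a = of_int p" by (simp add: Fract_of_int_quotient)
  show ?case
  proof (rule exI[of _ "D * q"], intro conjI ballI)
    show "0 < D * q" using D pq by simp
    fix b assume "b \<in> insert a J"
    then consider "b = a" | "b \<in> J" by auto
    then show "\<exists>z::int. of_int (D * q) * c b = of_int z"
    proof cases
      case 1
      then have "of_int (D * q) * c b = of_int (D * p)" using a by (simp add: mult.assoc)
      then show ?thesis by blast
    next
      case 2
      then obtain z :: int where "of_int D * c b = of_int z" using D by auto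
      then have "of_int (D * q) * c b = of_int (z * q)" by (simp add: mult.commute mult.left_commute)
      then show ?thesis by blast
    qed
  qed
qed

text \<open>
  Linear independence over the integers implies linear independence over the rationals.
\<close>

lemma lin_indep_rat:
  fixes c :: "'i \<Rightarrow> rat"
  assumes "lin_indep J K v" "finite J"
    and zero: "\<And>k. k \<in> K \<Longrightarrow> (\<Sum>a\<in>J. c a * of_int (v a k)) = 0" and a: "a \<in> J"
  shows "c a = 0"
proof -
  obtain D :: int where D: "0 < D" "\<forall>a\<in>J. \<exists>z::int. of_int D * c a = of_int z"
    using clear_denominators[OF assms(2)] by blast
  from bchoice[OF D(2)] obtain z :: "'i \<Rightarrow> int"
    where z: "\<And>a. a \<in> J \<Longrightarrow> of_int D * c a = of_int (z a)" by blast
  have "(\<Sum>a\<in>J. z a * v a k) = 0" if "k \<in> K" for k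
  proof -
    have "(of_int (\<Sum>a\<in>J. z a * v a k) :: rat) = (\<Sum>a\<in>J. of_int D * (c a * of_int (v a k)))"
      unfolding of_int_sum by (intro sum.cong refl) (simp add: z flip: mult.assoc)
    also have "\<dots> = 0" using zero[OF that] unfolding sum_distrib_left[symmetric] by simp
    finally show ?thesis by (simp only: of_int_eq_0_iff)
  qed
  then have "z a = 0" using assms(1) a by (auto simp: lin_indep_def)
  then show ?thesis using z[OF a] D(1) by simp
qed

definition unit_vec :: "nat \<Rightarrow> nat \<Rightarrow> rat" where
  "unit_vec j = (\<lambda>k. if k = j then 1 else 0)"

context
begin

text \<open>
  The interpretations are confined to this block: their simplification rules match arbitrary
  function terms.
\<close>

interpretation ratfun: vector_space "\<lambda>(c::rat) (f::nat \<Rightarrow> rat) k. c * f k"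
  by unfold_locales (auto simp: fun_eq_iff algebra_simps)

interpretation ratfun_rat: vector_space_pair "\<lambda>(c::rat) (f::nat \<Rightarrow> rat) k. c * f k" "\<lambda>(c::rat) (x::rat). c * x"
  by unfold_locales (auto simp: algebra_simps)

lemma fun_unit_vec:
  assumes "\<And>k. n \<le> k \<Longrightarrow> f k = 0"
  shows "f = (\<Sum>j<n. (\<lambda>k. f j * unit_vec j k))"
proof
  fix k
  have "(\<Sum>j<n. f j * unit_vec j k) = (\<Sum>j<n. if j = k then f k else 0)"
    by (rule sum.cong) (auto simp: unit_vec_def)
  also have "\<dots> = f k" using assms by simp
  finally show "f k = (\<Sum>j<n. (\<lambda>k. f j * unit_vec j k)) k" by (simp add: sum_fun_apply)
qed

lemma span_unit_vec:
  assumes "\<And>k. n \<le> k \<Longrightarrow> f k = 0"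
  shows "f \<in> ratfun.span (unit_vec ` {..<n})"
proof -
  have "(\<Sum>j<n. (\<lambda>k. f j * unit_vec j k)) \<in> ratfun.span (unit_vec ` {..<n})"
    by (intro ratfun.span_sum ratfun.span_scale ratfun.span_base imageI)
  then show ?thesis using fun_unit_vec[of n f, OF assms] by simp
qed

lemma card_unit_vec: "card (unit_vec ` {..<n}) = n"
proof -
  have "inj_on unit_vec {..<n}"
    by (rule inj_onI) (metis unit_vec_def zero_neq_one)
  then show ?thesis by (simp add: card_image)
qed

lemma independent_family:
  assumes "finite J"
    and indep: "\<And>c a. (\<And>k. (\<Sum>x\<in>J. c x * fam x k) = 0) \<Longrightarrow> a \<in> J \<Longrightarrow> c a = (0::rat)"
  shows "inj_on fam J" "ratfun.independent (fam ` J)"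
proof -
  show inj: "inj_on fam J"
  proof (rule inj_onI, rule ccontr)
    fix x y assume xy: "x \<in> J" "y \<in> J" "fam x = fam y" "x \<noteq> y"
    define c :: "'a \<Rightarrow> rat" where "c z = (if z = x then 1 else if z = y then -1 else 0)" for z
    have "(\<Sum>z\<in>J. c z * fam z k) = 0" for k
    proof -
      have "(\<Sum>z\<in>J. c z * fam z k) = (\<Sum>z\<in>{x, y}. c z * fam z k)"
        by (rule sum.mono_neutral_right) (use assms(1) xy in \<open>auto simp: c_def\<close>)
      also have "\<dots> = 0" using xy by (simp add: c_def)
      finally show ?thesis .
    qed
    then have "c x = 0" using xy(1) by (rule indep)
    then show False by (simp add: c_def)
  qed
  show "ratfun.independent (fam ` J)"
  proof
    assume "ratfun.dependent (fam ` J)"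
    then obtain u w where w: "w \<in> fam ` J" "u w \<noteq> 0" and s: "(\<Sum>w\<in>fam ` J. (\<lambda>k. u w * w k)) = 0"
      using ratfun.dependent_finite[of "fam ` J"] assms(1) by auto
    have "(\<Sum>x\<in>J. u (fam x) * fam x k) = 0" for k
      using fun_cong[OF s, of k] by (simp add: sum_fun_apply sum.reindex[OF inj])
    then have "u (fam x) = 0" if "x \<in> J" for x using that by (rule indep)
    then show False using w by auto
  qed
qed

text \<open>
  An independent family of \<open>n\<close> vectors in an \<open>n\<close>-dimensional space spans it.
\<close>

lemma independent_family_spans:
  assumes J: "finite J" "card J = n"
    and supp: "\<And>x k. x \<in> J \<Longrightarrow> n \<le> k \<Longrightarrow> fam x k = 0"
    and indep: "\<And>c a. (\<And>k. (\<Sum>x\<in>J. c x * fam x k) = 0) \<Longrightarrow> a \<in> J \<Longrightarrow> c a = (0::rat)"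
    and f: "\<And>k. n \<le> k \<Longrightarrow> f k = 0"
  shows "\<exists>c. \<forall>k. f k = (\<Sum>x\<in>J. c x * fam x k)"
proof -
  have inj: "inj_on fam J" by (rule independent_family(1)[OF J(1)]) (rule indep)
  have ind: "ratfun.independent (fam ` J)" by (rule independent_family(2)[OF J(1)]) (rule indep)
  let ?S = "fam ` J"
  have "f \<in> ratfun.span ?S"
  proof (rule ccontr)
    assume not_in: "f \<notin> ratfun.span ?S"
    then have "ratfun.independent (insert f ?S)" using ind by (simp add: ratfun.independent_insert)
    moreover have "insert f ?S \<subseteq> ratfun.span (unit_vec ` {..<n})"
      using supp f by (auto intro!: span_unit_vec)
    ultimately have "card (insert f ?S) \<le> card (unit_vec ` {..<n})"
      using ratfun.independent_span_bound[of "unit_vec ` {..<n}" "insert f ?S"] by simp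
    moreover have "f \<notin> ?S" using not_in ratfun.span_base by blast
    ultimately show False using J inj by (simp add: card_unit_vec card_image)
  qed
  then obtain u where u: "f = (\<Sum>w\<in>?S. (\<lambda>k. u w * w k))"
    using ratfun.span_finite[of ?S] J(1) by auto
  show ?thesis
  proof (intro exI allI)
    fix k show "f k = (\<Sum>x\<in>J. u (fam x) * fam x k)"
      by (subst u) (simp add: sum_fun_apply sum.reindex[OF inj])
  qed
qed

text \<open>
  Steinitz exchange in dual form: if only \<open>0\<close> is orthogonal to an independent family \<open>fam\<close> on \<open>J\<close>
  together with a set \<open>T\<close>, then \<open>n - card J\<close> elements of \<open>T\<close> suffice for this.
\<close>

lemma complete_to_separating:
  fixes fam :: "'x \<Rightarrow> nat \<Rightarrow> rat"
  assumes J: "finite J"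
    and indep: "\<And>c a. (\<And>k. (\<Sum>x\<in>J. c x * fam x k) = 0) \<Longrightarrow> a \<in> J \<Longrightarrow> c a = (0::rat)"
    and supp: "\<And>f k. f \<in> fam ` J \<union> T \<Longrightarrow> n \<le> k \<Longrightarrow> f k = 0"
    and sep: "\<And>c j. (\<And>f. f \<in> fam ` J \<union> T \<Longrightarrow> (\<Sum>k<n. c k * f k) = 0) \<Longrightarrow> j < n \<Longrightarrow> c j = (0::rat)"
  shows "\<exists>X. X \<subseteq> T \<and> finite X \<and> card X + card J = n \<and>
    (\<forall>c :: nat \<Rightarrow> rat. (\<forall>f\<in>fam ` J \<union> X. (\<Sum>k<n. c k * f k) = 0) \<longrightarrow> (\<forall>j<n. c j = 0))"
proof -
  define S where "S = fam ` J"
  have "inj_on fam J" by (rule independent_family(1)[OF J]) (rule indep)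
  then have card_S: "card S = card J" by (simp add: S_def card_image)
  have S: "ratfun.independent S" unfolding S_def by (rule independent_family(2)[OF J]) (rule indep)
  note supp = supp[folded S_def] and sep = sep[folded S_def]
  let ?E = "unit_vec ` {..<n}"
  obtain B where B: "S \<subseteq> B" "B \<subseteq> S \<union> T" "ratfun.independent B" "S \<union> T \<subseteq> ratfun.span B"
    using ratfun.maximal_independent_subset_extend[of S "S \<union> T"] S by auto
  have E_in: "unit_vec j \<in> ratfun.span B" if j: "j < n" for j
  proof (rule ccontr)
    assume not_in: "unit_vec j \<notin> ratfun.span B"
    then have "ratfun.independent (insert (unit_vec j) B)" using B(3) by (simp add: ratfun.independent_insert)
    then obtain g where lin: "Vector_Spaces.linear (\<lambda>(c::rat) (f::nat \<Rightarrow> rat) k. c * f k) (\<lambda>(c::rat) (x::rat). c * x) g"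
      and g: "\<forall>x\<in>insert (unit_vec j) B. g x = (if x = unit_vec j then 1 else 0)"
      using ratfun_rat.linear_independent_extend[of "insert (unit_vec j) B" "\<lambda>x. if x = unit_vec j then 1 else 0"] by blast
    interpret g: Vector_Spaces.linear "\<lambda>(c::rat) (f::nat \<Rightarrow> rat) k. c * f k" "\<lambda>(c::rat) (x::rat). c * x" g by (rule lin)
    have gB: "g x = 0" if "x \<in> B" for x
      using g that not_in ratfun.span_base by (metis insertCI)
    have g0: "g f = 0" if "f \<in> ratfun.span B" for f
      using g.eq_0_on_span[OF gB that] .
    have g_sum: "g f = (\<Sum>k<n. g (unit_vec k) * f k)" if "\<And>k. n \<le> k \<Longrightarrow> f k = 0" for f
    proof -
      have "g f = g (\<Sum>j<n. (\<lambda>k. f j * unit_vec j k))"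
        by (rule arg_cong[OF fun_unit_vec]) (rule that)
      also have "\<dots> = (\<Sum>k<n. f k * g (unit_vec k))" by (simp only: g.sum g.scale)
      finally show ?thesis by (simp add: mult.commute)
    qed
    have "(\<Sum>k<n. g (unit_vec k) * f k) = 0" if "f \<in> S \<union> T" for f
      using g0[of f] B(4) that g_sum[of f] supp[OF that] by auto
    then have "g (unit_vec j) = 0" using j by (rule sep)
    then show False using g by simp
  qed
  have B_sub: "B \<subseteq> ratfun.span ?E" using supp B(2) by (blast intro: span_unit_vec)
  have fin: "finite B" "card B \<le> n"
    using ratfun.independent_span_bound[of ?E B] B(3) B_sub by (simp_all add: card_unit_vec)
  have "ratfun.independent ?E"
  proof (rule independent_family(2))
    fix c :: "nat \<Rightarrow> rat" and a
    assume z: "\<And>k. (\<Sum>x<n. c x * unit_vec x k) = 0" and a: "a \<in> {..<n}"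
    have "(\<Sum>x<n. c x * unit_vec x a) = (\<Sum>x<n. if x = a then c a else 0)"
      by (rule sum.cong) (auto simp: unit_vec_def)
    then show "c a = 0" using z[of a] a by simp
  qed simp
  then have "n \<le> card B"
    using ratfun.independent_span_bound[of B ?E] fin(1) E_in by (auto simp: card_unit_vec)
  then have card_B: "card B = n" using fin by simp
  show ?thesis
    unfolding S_def[symmetric] card_S[symmetric]
  proof (rule exI[of _ "B - S"], intro conjI allI impI)
    show "B - S \<subseteq> T" using B(2) by blast
    show "finite (B - S)" using fin by simp
    show "card (B - S) + card S = n"
      using card_B B(1) fin(1) by (metis add.commute card_Diff_subset card_mono finite_subset le_add_diff_inverse)
    fix c :: "nat \<Rightarrow> rat" and j
    assume orth: "\<forall>f\<in>S \<union> (B - S). (\<Sum>k<n. c k * f k) = 0" and j: "j < n"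
    have "(\<Sum>k<n. c k * f k) = 0" if "f \<in> ratfun.span B" for f
      using that
    proof (induction rule: ratfun.span_induct_alt)
      case base show ?case by simp
    next
      case (step r x y)
      have "(\<Sum>k<n. c k * (r * x k + y k)) = (\<Sum>k<n. r * (c k * x k) + c k * y k)"
        by (simp only: distrib_left mult.left_commute)
      also have "\<dots> = r * (\<Sum>k<n. c k * x k) + (\<Sum>k<n. c k * y k)"
        by (simp only: sum.distrib sum_distrib_left)
      finally have "(\<Sum>k<n. c k * (r * x k + y k)) = r * (\<Sum>k<n. c k * x k) + (\<Sum>k<n. c k * y k)" .
      moreover have "(\<Sum>k<n. c k * x k) = 0" using step(1) orth by blast
      ultimately show ?case using step(2) by simp
    qed
    from this[OF E_in[OF j]] have "(\<Sum>k<n. if k = j then c j else 0) = 0"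
      by (simp add: unit_vec_def if_distrib cong: if_cong)
    then show "c j = 0" using j by simp
  qed
qed

end

text \<open>
  A maximal independent set of columns, in which every other column is expressed.
\<close>

lemma cmat_rank_basis:
  assumes "finite (idx C)"
  obtains J where "J \<subseteq> idx C" "card J = cmat_rank C" "lin_indep J (idx C) (\<lambda>b a. cmat C a b)"
    "\<And>b. b \<in> idx C - J \<Longrightarrow> \<exists>w :: 'i \<Rightarrow> rat. w b = 1 \<and> (\<forall>a. a \<notin> insert b J \<longrightarrow> w a = 0) \<and>
        (\<forall>a'\<in>idx C. (\<Sum>a\<in>idx C. w a * of_int (cmat C a' a)) = 0)"
proof -
  let ?R = "{card J | J. J \<subseteq> idx C \<and> lin_indep J (idx C) (\<lambda>b a. cmat C a b)}"
  have fin: "finite ?R"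
    by (rule finite_subset[of _ "card ` Pow (idx C)"]) (use assms in auto)
  have "lin_indep {} (idx C) (\<lambda>b a. cmat C a b)" by (simp add: lin_indep_def)
  then have "?R \<noteq> {}" by blast
  then have "cmat_rank C \<in> ?R" unfolding cmat_rank_def using Max_in[OF fin] by blast
  then obtain J where J: "J \<subseteq> idx C" "card J = cmat_rank C" "lin_indep J (idx C) (\<lambda>b a. cmat C a b)"
    by auto
  have finJ: "finite J" using J(1) assms finite_subset by blast
  have "\<exists>w :: 'i \<Rightarrow> rat. w b = 1 \<and> (\<forall>a. a \<notin> insert b J \<longrightarrow> w a = 0) \<and>
        (\<forall>a'\<in>idx C. (\<Sum>a\<in>idx C. w a * of_int (cmat C a' a)) = 0)" if b: "b \<in> idx C - J" for b
  proof -
    have "\<not> lin_indep (insert b J) (idx C) (\<lambda>b a. cmat C a b)"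
    proof
      assume "lin_indep (insert b J) (idx C) (\<lambda>b a. cmat C a b)"
      moreover have "insert b J \<subseteq> idx C" using b J(1) by blast
      ultimately have "card (insert b J) \<le> Max ?R" using fin by (intro Max_ge) blast+
      then show False using J(2) b finJ by (simp add: cmat_rank_def)
    qed
    then obtain c where c: "\<And>a'. a' \<in> idx C \<Longrightarrow> (\<Sum>a\<in>insert b J. c a * cmat C a' a) = 0"
      and nz: "\<exists>a\<in>insert b J. c a \<noteq> 0" by (auto simp: lin_indep_def)
    have cb: "c b \<noteq> 0"
    proof
      assume cb: "c b = 0"
      have "(\<Sum>a\<in>J. c a * cmat C a' a) = 0" if "a' \<in> idx C" for a'
        using c[OF that] finJ b cb by simp
      then have "\<forall>a\<in>J. c a = 0" using J(3) unfolding lin_indep_def by blast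
      then show False using nz cb by auto
    qed
    define w :: "'i \<Rightarrow> rat" where "w a = (if a \<in> insert b J then of_int (c a) / of_int (c b) else 0)" for a
    have "(\<Sum>a\<in>idx C. w a * of_int (cmat C a' a)) = 0" if "a' \<in> idx C" for a'
    proof -
      have "(\<Sum>a\<in>idx C. w a * of_int (cmat C a' a)) = (\<Sum>a\<in>insert b J. w a * of_int (cmat C a' a))"
        by (rule sum.mono_neutral_right) (use assms b J(1) in \<open>auto simp: w_def\<close>)
      also have "\<dots> = (\<Sum>a\<in>insert b J. of_int (c a * cmat C a' a) / of_int (c b))"
        by (rule sum.cong) (auto simp: w_def)
      also have "\<dots> = of_int (\<Sum>a\<in>insert b J. c a * cmat C a' a) / of_int (c b)"
        by (simp only: sum_divide_distrib of_int_sum)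
      also have "\<dots> = 0" using c[OF that] by simp
      finally show ?thesis .
    qed
    moreover have "w b = 1" using cb by (simp add: w_def)
    ultimately show ?thesis by (intro exI[of _ w]) (auto simp: w_def)
  qed
  then show thesis using that J by blast
qed

section \<open>Realization of the cover\<close>

context kac_moody
begin

lemma pairing_rat_comb:
  fixes u :: "'i \<Rightarrow> rat"
  assumes "\<And>k. of_int (\<mu> k) = (\<Sum>a\<in>J. u a * of_int (f a k))"
  shows "of_int (pairing C h \<mu>) = (\<Sum>a\<in>J. u a * of_int (pairing C h (f a)))"
proof -
  have "of_int (pairing C h \<mu>) = (\<Sum>k<lrank C. \<Sum>a\<in>J. u a * (of_int (h k) * of_int (f a k)))"
    by (simp add: pairing_def assms sum_distrib_left mult.left_commute)
  also have "\<dots> = (\<Sum>a\<in>J. \<Sum>k<lrank C. u a * (of_int (h k) * of_int (f a k)))"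
    by (rule sum.swap)
  also have "\<dots> = (\<Sum>a\<in>J. u a * of_int (pairing C h (f a)))"
    by (simp add: pairing_def sum_distrib_left)
  finally show ?thesis .
qed

lemma root_indep:
  fixes c :: "'i \<Rightarrow> rat"
  assumes "\<And>k. (\<Sum>a\<in>idx C. c a * of_int (root C a k)) = 0" and "a \<in> idx C"
  shows "c a = 0"
proof (rule lin_indep_rat[OF _ finite_idx _ assms(2)])
  show "lin_indep (idx C) {..<lrank C} (root C)"
    using km unfolding symmetrizable_kac_moody_def by blast
qed (rule assms(1))

text \<open>
  This is where the minimality of the realization enters, through a dimension count.
\<close>

lemma annihilator_in_root_span:
  assumes \<mu>: "\<mu> \<in> weight_lattice C" and ann: "\<And>a. a \<in> idx C \<Longrightarrow> pairing C (coroot C a) \<mu> = 0"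
  obtains u :: "'i \<Rightarrow> rat" where "\<And>k. of_int (\<mu> k) = (\<Sum>a\<in>idx C. u a * of_int (root C a k))"
proof -
  let ?I = "idx C"
  let ?n = "lrank C"
  obtain J where J: "J \<subseteq> ?I" "card J = cmat_rank C" "lin_indep J ?I (\<lambda>b a. cmat C a b)"
    and w_ex: "\<And>b. b \<in> ?I - J \<Longrightarrow> \<exists>w :: 'i \<Rightarrow> rat. w b = 1 \<and> (\<forall>a. a \<notin> insert b J \<longrightarrow> w a = 0) \<and>
        (\<forall>a'\<in>?I. (\<Sum>a\<in>?I. w a * of_int (cmat C a' a)) = 0)"
    by (rule cmat_rank_basis[OF finite_idx]) (rule that)
  have "\<forall>b\<in>?I - J. \<exists>w :: 'i \<Rightarrow> rat. w b = 1 \<and> (\<forall>a. a \<notin> insert b J \<longrightarrow> w a = 0) \<and>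
        (\<forall>a'\<in>?I. (\<Sum>a\<in>?I. w a * of_int (cmat C a' a)) = 0)" using w_ex by blast
  from bchoice[OF this] obtain w :: "'i \<Rightarrow> 'i \<Rightarrow> rat"
    where w: "\<And>b. b \<in> ?I - J \<Longrightarrow> w b b = 1" "\<And>a b. b \<in> ?I - J \<Longrightarrow> a \<notin> insert b J \<Longrightarrow> w b a = 0"
      "\<And>a' b. b \<in> ?I - J \<Longrightarrow> a' \<in> ?I \<Longrightarrow> (\<Sum>a\<in>?I. w b a * of_int (cmat C a' a)) = 0"
    by blast
  \<comment> \<open>the fundamental weights, and for each column outside \<open>J\<close> the combination of simple roots that is
      annihilated by all coroots; their number is the rank of the lattice\<close>
  define fam :: "'i + 'i \<Rightarrow> nat \<Rightarrow> rat" where "fam x k = (case x of Inl a \<Rightarrow> of_int (fund C a k)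
       | Inr b \<Rightarrow> (\<Sum>a\<in>?I. w b a * of_int (root C a k)))" for x k
  let ?F = "?I <+> (?I - J)"
  have fin: "finite ?F" using finite_idx by simp
  have finJ: "finite J" using J(1) finite_idx finite_subset by blast
  have fund_lat: "fund C a k = 0" if "a \<in> ?I" "?n \<le> k" for a k
    using km that by (simp add: symmetrizable_kac_moody_def weight_lattice_def)
  have split: "(\<Sum>x\<in>?F. c x * fam x k) = (\<Sum>a\<in>?I. c (Inl a) * of_int (fund C a k))
      + (\<Sum>a\<in>?I. (\<Sum>b\<in>?I - J. c (Inr b) * w b a) * of_int (root C a k))" for c k
  proof -
    have "(\<Sum>b\<in>?I - J. c (Inr b) * fam (Inr b) k) = (\<Sum>b\<in>?I - J. \<Sum>a\<in>?I. c (Inr b) * w b a * of_int (root C a k))"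
      by (simp add: fam_def sum_distrib_left mult.assoc)
    also have "\<dots> = (\<Sum>a\<in>?I. \<Sum>b\<in>?I - J. c (Inr b) * w b a * of_int (root C a k))"
      by (rule sum.swap)
    finally have "(\<Sum>b\<in>?I - J. c (Inr b) * fam (Inr b) k)
       = (\<Sum>a\<in>?I. (\<Sum>b\<in>?I - J. c (Inr b) * w b a) * of_int (root C a k))"
      by (simp add: sum_distrib_right)
    then show ?thesis using finite_idx by (simp add: sum.Plus comp_def fam_def)
  qed
  \<comment> \<open>pairing with a coroot singles out the coefficient of a fundamental weight\<close>
  have pair: "(\<Sum>k<?n. of_int (coroot C a k) * (\<Sum>x\<in>?F. c x * fam x k)) = c (Inl a)" if a: "a \<in> ?I" for a c
  proof -
    have 1: "(\<Sum>k<?n. of_int (coroot C a k) * (\<Sum>b\<in>?I. y b * of_int (g b k)))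
        = (\<Sum>b\<in>?I. y b * of_int (pairing C (coroot C a) (g b)))" for y :: "'i \<Rightarrow> rat" and g
    proof -
      have "(\<Sum>k<?n. of_int (coroot C a k) * (\<Sum>b\<in>?I. y b * of_int (g b k)))
        = (\<Sum>k<?n. \<Sum>b\<in>?I. y b * (of_int (coroot C a k) * of_int (g b k)))"
        by (simp add: sum_distrib_left mult.left_commute)
      also have "\<dots> = (\<Sum>b\<in>?I. \<Sum>k<?n. y b * (of_int (coroot C a k) * of_int (g b k)))"
        by (rule sum.swap)
      finally show ?thesis by (simp add: pairing_def sum_distrib_left)
    qed
    have 2: "(\<Sum>b\<in>?I. c (Inl b) * of_int (pairing C (coroot C a) (fund C b))) = c (Inl a)"
    proof -
      have "(\<Sum>b\<in>?I. c (Inl b) * of_int (pairing C (coroot C a) (fund C b))) = (\<Sum>b\<in>?I. if b = a then c (Inl a) else 0)"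
        by (rule sum.cong) (use a in \<open>auto simp: pairing_fund\<close>)
      then show ?thesis using a finite_idx by simp
    qed
    have 3: "(\<Sum>b\<in>?I. (\<Sum>b'\<in>?I - J. c (Inr b') * w b' b) * of_int (pairing C (coroot C a) (root C b))) = 0"
    proof -
      have "(\<Sum>b\<in>?I. (\<Sum>b'\<in>?I - J. c (Inr b') * w b' b) * of_int (pairing C (coroot C a) (root C b)))
        = (\<Sum>b\<in>?I. \<Sum>b'\<in>?I - J. c (Inr b') * (w b' b * of_int (cmat C a b)))"
        using a by (simp add: sum_distrib_right pairing_root mult.assoc)
      also have "\<dots> = (\<Sum>b'\<in>?I - J. \<Sum>b\<in>?I. c (Inr b') * (w b' b * of_int (cmat C a b)))"
        by (rule sum.swap)
      also have "\<dots> = 0" using w(3) a by (simp flip: sum_distrib_left)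
      finally show ?thesis .
    qed
    show ?thesis unfolding split distrib_left sum.distrib 1 2 3 by simp
  qed
  have "\<exists>c. \<forall>k. (of_int (\<mu> k) :: rat) = (\<Sum>x\<in>?F. c x * fam x k)"
  proof (rule independent_family_spans[OF fin])
    have "card J \<le> card ?I" using J(1) finite_idx by (rule card_mono[rotated])
    moreover have "?n = 2 * card ?I - cmat_rank C"
      using km unfolding symmetrizable_kac_moody_def by blast
    ultimately show "card ?F = ?n" using J finite_idx finJ by (simp add: card_Plus card_Diff_subset)
    show "fam x k = 0" if "x \<in> ?F" "?n \<le> k" for x k
      using that fund_lat root_lattice by (auto simp: fam_def)
    show "(of_int (\<mu> k) :: rat) = 0" if "?n \<le> k" for k
      using that \<mu> by (simp add: weight_lattice_def)
    fix c x assume z: "\<And>k. (\<Sum>x\<in>?F. c x * fam x k) = 0" and x: "x \<in> ?F"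
    have fund0: "c (Inl a) = 0" if "a \<in> ?I" for a using pair[OF that, of c] by (simp add: z)
    have "(\<Sum>b\<in>?I - J. c (Inr b) * w b a) = 0" if a: "a \<in> ?I" for a
    proof (rule root_indep[OF _ a, where c = "\<lambda>a. \<Sum>b\<in>?I - J. c (Inr b) * w b a"])
      fix k show "(\<Sum>a\<in>?I. (\<Sum>b\<in>?I - J. c (Inr b) * w b a) * of_int (root C a k)) = 0"
        using z[of k] fund0 by (simp add: split)
    qed
    moreover have "(\<Sum>b\<in>?I - J. c (Inr b) * w b a) = c (Inr a)" if a: "a \<in> ?I - J" for a
    proof -
      have "(\<Sum>b\<in>?I - J. c (Inr b) * w b a) = (\<Sum>b\<in>?I - J. if b = a then c (Inr a) else 0)"
        by (rule sum.cong) (use a w(1,2) in auto)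
      then show ?thesis using a finite_idx by simp
    qed
    ultimately show "c x = 0" using x fund0 by auto
  qed
  then obtain c where c: "\<And>k. (of_int (\<mu> k) :: rat) = (\<Sum>x\<in>?F. c x * fam x k)" by blast
  have "c (Inl a) = 0" if a: "a \<in> ?I" for a
  proof -
    have "c (Inl a) = of_int (pairing C (coroot C a) \<mu>)"
      using pair[OF a, of c] by (simp add: c[symmetric] pairing_def)
    then show ?thesis using ann[OF a] by simp
  qed
  then have "(of_int (\<mu> k) :: rat) = (\<Sum>a\<in>?I. (\<Sum>b\<in>?I - J. c (Inr b) * w b a) * of_int (root C a k))" for k
    unfolding c split by simp
  then show thesis by (rule that)
qed

text \<open>
  For \<open>h\<close> and \<open>f\<close> the coroots and the \<open>k\<close>-th coordinates of the fundamental weights, this is \<open>N\<close> times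
  the \<open>k\<close>-th coordinate of the projection along the fundamental weights, as an integral linear form.
\<close>

lemma pairing_projection:
  assumes "k < lrank C"
  shows "pairing C (\<lambda>j. N * ((if j = k then 1 else 0) - (\<Sum>a\<in>J. h a j * f a))) \<mu>
     = N * (\<mu> k - (\<Sum>a\<in>J. pairing C (h a) \<mu> * f a))"
proof -
  have 1: "(\<Sum>j<lrank C. (\<Sum>a\<in>J. h a j * f a) * \<mu> j) = (\<Sum>a\<in>J. pairing C (h a) \<mu> * f a)"
  proof -
    have "(\<Sum>j<lrank C. (\<Sum>a\<in>J. h a j * f a) * \<mu> j) = (\<Sum>j<lrank C. \<Sum>a\<in>J. h a j * \<mu> j * f a)"
      by (simp add: sum_distrib_left mult_ac)
    also have "\<dots> = (\<Sum>a\<in>J. \<Sum>j<lrank C. h a j * \<mu> j * f a)" by (rule sum.swap)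
    finally show ?thesis by (simp add: pairing_def sum_distrib_right)
  qed
  have 2: "(\<Sum>j<lrank C. (if j = k then 1 else 0) * \<mu> j) = \<mu> k"
  proof -
    have "(\<Sum>j<lrank C. (if j = k then 1 else 0) * \<mu> j) = (\<Sum>j<lrank C. if j = k then \<mu> k else 0)"
      by (rule sum.cong) auto
    then show ?thesis using assms by simp
  qed
  have "pairing C (\<lambda>j. N * ((if j = k then 1 else 0) - (\<Sum>a\<in>J. h a j * f a))) \<mu>
     = N * (\<Sum>j<lrank C. (if j = k then 1 else 0) * \<mu> j - (\<Sum>a\<in>J. h a j * f a) * \<mu> j)"
    unfolding pairing_def sum_distrib_left by (simp only: left_diff_distrib mult.assoc)
  then show ?thesis by (simp only: sum_subtractf 1 2)
qed

text \<open>
  A vector \<open>c\<close> orthogonal to the columns of \<open>B\<close> and to all admissible further rows vanishes. Here a row \<open>X\<close>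
  is admissible if some linear form \<open>g\<close> vanishes on the fundamental weights and takes the fibre sums of \<open>X\<close>
  on the simple roots. The vector of fibre averages of \<open>c\<close> is a relation between the simple roots of \<open>C\<close>,
  hence zero; then \<open>c\<close> has zero fibre sums, so a multiple of \<open>c\<close> is admissible with \<open>g = 0\<close>.
\<close>

lemma cover_separating:
  fixes B :: "nat \<Rightarrow> nat \<Rightarrow> int" and c :: "nat \<Rightarrow> rat" and F :: "'i \<Rightarrow> nat set"
  assumes F_def: "\<And>a. F a = {b \<in> {..<m}. \<phi> b = a}"
    and onto: "\<phi> ` {..<m} = idx C"
    and sym: "\<And>i j. i < m \<Longrightarrow> j < m \<Longrightarrow> B i j = B j i"
    and fold: "\<And>i a. i < m \<Longrightarrow> a \<in> idx C \<Longrightarrow> (\<Sum>j\<in>F a. B i j) = cmat C (\<phi> i) a"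
    and rows: "\<And>b. b < m \<Longrightarrow> (\<Sum>k<m. c k * of_int (B k b)) = 0"
    and extra: "\<And>X g. (\<And>k. m \<le> k \<Longrightarrow> X k = 0) \<Longrightarrow>
        (\<And>a. a \<in> idx C \<Longrightarrow> pairing C g (fund C a) = 0 \<and> pairing C g (root C a) = (\<Sum>b\<in>F a. X b)) \<Longrightarrow>
        (\<Sum>k<m. c k * of_int (X k :: int)) = 0"
    and j: "j < m"
  shows "c j = 0"
proof -
  let ?I = "idx C"
  have finF: "finite (F a)" for a by (simp add: F_def)
  have Fm: "b \<in> F a \<longleftrightarrow> b < m \<and> \<phi> b = a" for a b by (simp add: F_def)
  have fibres: "(\<Sum>b<m. g b) = (\<Sum>a\<in>?I. \<Sum>b\<in>F a. g b)" for g :: "nat \<Rightarrow> rat"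
    unfolding F_def using onto by (intro sum.group[symmetric]) (auto simp: finite_idx)
  define n where "n a = card (F a)" for a
  have n_pos: "0 < n a" if "a \<in> ?I" for a
  proof -
    obtain b where "b < m" "\<phi> b = a" using \<open>a \<in> ?I\<close> unfolding onto[symmetric] by auto
    then show ?thesis unfolding n_def using finF by (auto simp: card_gt_0_iff Fm)
  qed
  define N where "N = (\<Prod>a\<in>?I. n a)"
  have N_pos: "0 < N" unfolding N_def using n_pos by (intro prod_pos) auto
  have N_dvd: "N = n a * (N div n a)" if "a \<in> ?I" for a
    using finite_idx that by (simp add: N_def dvd_prodI)
  define s where "s a = (\<Sum>b\<in>F a. c b)" for a
  define u where "u a = s a / of_nat (n a)" for a
  have s_u: "s a = of_nat (n a) * u a" if "a \<in> ?I" for a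
    using n_pos[OF that] by (simp add: u_def)
  define \<pi> where "\<pi> a k = root C a k - (\<Sum>a'\<in>?I. cmat C a' a * fund C a' k)" for a k
  have fund_lat: "fund C a k = 0" if "a \<in> ?I" "lrank C \<le> k" for a k
    using km that by (simp add: symmetrizable_kac_moody_def weight_lattice_def)
  \<comment> \<open>the fibre averages of \<open>c\<close> are killed by the projections of the simple roots\<close>
  have u_\<pi>: "(\<Sum>a\<in>?I. u a * of_int (\<pi> a k)) = 0" for k
  proof (cases "k < lrank C")
    case False
    then have "\<pi> a k = 0" if "a \<in> ?I" for a using that root_lattice[of a k] fund_lat[of _ k] by (simp add: \<pi>_def)
    then show ?thesis by simp
  next
    case k: True
    define X where "X b = (if b < m then int (N div n (\<phi> b)) * \<pi> (\<phi> b) k else 0)" for b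
    define g where "g = (\<lambda>j. int N * ((if j = k then 1 else 0) - (\<Sum>a\<in>?I. coroot C a j * fund C a k)))"
    have "(\<Sum>b<m. c b * of_int (X b)) = 0"
    proof (rule extra)
      show "X b = 0" if "m \<le> b" for b using that by (simp add: X_def)
      fix a assume a: "a \<in> ?I"
      have "(\<Sum>a'\<in>?I. pairing C (coroot C a') (fund C a) * fund C a' k) = (\<Sum>a'\<in>?I. if a' = a then fund C a k else 0)"
        by (rule sum.cong) (use a in \<open>auto simp: pairing_fund\<close>)
      then have "pairing C g (fund C a) = 0"
        using a finite_idx unfolding g_def pairing_projection[OF k] by simp
      moreover have "pairing C g (root C a) = int N * \<pi> a k"
        unfolding g_def pairing_projection[OF k] \<pi>_def using a by (simp add: pairing_root)
      moreover have "(\<Sum>b\<in>F a. X b) = (\<Sum>b\<in>F a. int (N div n a) * \<pi> a k)"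
        by (rule sum.cong) (auto simp: X_def Fm)
      moreover have "int N = int (n a) * int (N div n a)"
        using N_dvd[OF a] by (metis of_nat_mult)
      ultimately show "pairing C g (fund C a) = 0 \<and> pairing C g (root C a) = (\<Sum>b\<in>F a. X b)"
        by (simp add: n_def)
    qed
    also have "(\<Sum>b<m. c b * of_int (X b)) = (\<Sum>a\<in>?I. of_nat N * (u a * of_int (\<pi> a k)))"
      unfolding fibres
    proof (rule sum.cong)
      fix a assume a: "a \<in> ?I"
      have "(\<Sum>b\<in>F a. c b * of_int (X b)) = (\<Sum>b\<in>F a. c b * (of_nat (N div n a) * of_int (\<pi> a k)))"
        by (rule sum.cong) (auto simp: X_def Fm)
      also have "\<dots> = s a * (of_nat (N div n a) * of_int (\<pi> a k))"
        unfolding s_def sum_distrib_right ..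
      also have "\<dots> = of_nat (n a * (N div n a)) * (u a * of_int (\<pi> a k))"
        using s_u[OF a] by simp
      finally show "(\<Sum>b\<in>F a. c b * of_int (X b)) = of_nat N * (u a * of_int (\<pi> a k))"
        using N_dvd[OF a] by simp
    qed simp
    finally have "of_nat N * (\<Sum>a\<in>?I. u a * of_int (\<pi> a k)) = 0" unfolding sum_distrib_left .
    then show ?thesis using N_pos by simp
  qed
  have n_sym: "int (n a) * cmat C a a' = int (n a') * cmat C a' a" if a: "a \<in> ?I" "a' \<in> ?I" for a a'
  proof -
    have row: "(\<Sum>i\<in>F a. \<Sum>j\<in>F a'. B i j) = int (n a) * cmat C a a'" if "a \<in> ?I" "a' \<in> ?I" for a a'
    proof -
      have "(\<Sum>i\<in>F a. \<Sum>j\<in>F a'. B i j) = (\<Sum>i\<in>F a. cmat C a a')"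
        by (rule sum.cong) (use that fold in \<open>auto simp: Fm\<close>)
      then show ?thesis by (simp add: n_def)
    qed
    have "(\<Sum>i\<in>F a. \<Sum>j\<in>F a'. B i j) = (\<Sum>j\<in>F a'. \<Sum>i\<in>F a. B i j)" by (rule sum.swap)
    also have "\<dots> = (\<Sum>j\<in>F a'. \<Sum>i\<in>F a. B j i)"
      by (intro sum.cong refl) (auto simp: Fm intro: sym)
    finally show ?thesis using row[OF a] row[OF a(2,1)] by simp
  qed
  have u_cmat: "(\<Sum>a\<in>?I. u a * of_int (cmat C a' a)) = 0" if a': "a' \<in> ?I" for a'
  proof -
    have "0 = (\<Sum>j\<in>F a'. \<Sum>k<m. c k * of_int (B k j))"
      using rows by (simp add: Fm)
    also have "\<dots> = (\<Sum>k<m. \<Sum>j\<in>F a'. c k * of_int (B k j))" by (rule sum.swap)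
    also have "\<dots> = (\<Sum>k<m. c k * of_int (cmat C (\<phi> k) a'))"
      by (rule sum.cong) (use fold[OF _ a'] in \<open>auto simp flip: sum_distrib_left of_int_sum\<close>)
    also have "\<dots> = (\<Sum>a\<in>?I. \<Sum>k\<in>F a. c k * of_int (cmat C a a'))"
      unfolding fibres by (intro sum.cong refl) (auto simp: Fm)
    also have "\<dots> = (\<Sum>a\<in>?I. of_nat (n a') * (u a * of_int (cmat C a' a)))"
    proof (rule sum.cong)
      fix a assume a: "a \<in> ?I"
      have "(of_int (int (n a) * cmat C a a') :: rat) = of_int (int (n a') * cmat C a' a)"
        using n_sym[OF a a'] by simp
      then have e: "(of_nat (n a) * of_int (cmat C a a') :: rat) = of_nat (n a') * of_int (cmat C a' a)" by simp
      have "(\<Sum>k\<in>F a. c k * of_int (cmat C a a')) = u a * (of_nat (n a) * of_int (cmat C a a'))"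
        unfolding sum_distrib_right[symmetric] s_def[symmetric] s_u[OF a] by simp
      then show "(\<Sum>k\<in>F a. c k * of_int (cmat C a a')) = of_nat (n a') * (u a * of_int (cmat C a' a))"
        unfolding e by simp
    qed simp
    finally have "of_nat (n a') * (\<Sum>a\<in>?I. u a * of_int (cmat C a' a)) = 0"
      unfolding sum_distrib_left by simp
    then show ?thesis using n_pos[OF a'] by simp
  qed
  have "u a = 0" if a: "a \<in> ?I" for a
  proof (rule root_indep[OF _ a, where c = u])
    fix k
    have "(\<Sum>a\<in>?I. u a * of_int (root C a k))
       = (\<Sum>a\<in>?I. u a * of_int (\<pi> a k)) + (\<Sum>a\<in>?I. \<Sum>a'\<in>?I. u a * of_int (cmat C a' a) * of_int (fund C a' k))"
      unfolding sum.distrib[symmetric]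
      by (rule sum.cong) (simp_all add: \<pi>_def right_diff_distrib sum_distrib_left mult.assoc)
    also have "(\<Sum>a\<in>?I. \<Sum>a'\<in>?I. u a * of_int (cmat C a' a) * of_int (fund C a' k))
       = (\<Sum>a'\<in>?I. \<Sum>a\<in>?I. u a * of_int (cmat C a' a) * of_int (fund C a' k))" by (rule sum.swap)
    also have "\<dots> = (\<Sum>a'\<in>?I. (\<Sum>a\<in>?I. u a * of_int (cmat C a' a)) * of_int (fund C a' k))"
      by (simp only: sum_distrib_right)
    also have "\<dots> = 0" using u_cmat by simp
    finally show "(\<Sum>a\<in>?I. u a * of_int (root C a k)) = 0" using u_\<pi> by simp
  qed
  then have s0: "s a = 0" if "a \<in> ?I" for a using s_u[OF that] that by simp
  \<comment> \<open>an integral multiple of \<open>c\<close> is itself one of the admissible rows\<close>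
  obtain D :: int where D: "0 < D" "\<forall>k\<in>{..<m}. \<exists>z::int. of_int D * c k = of_int z"
    using clear_denominators[of "{..<m}" c] by auto
  from bchoice[OF D(2)] obtain z :: "nat \<Rightarrow> int"
    where z: "\<And>k. k < m \<Longrightarrow> of_int D * c k = of_int (z k)" by blast
  define X where "X k = (if k < m then z k else 0)" for k
  have "(\<Sum>k<m. c k * of_int (X k)) = 0"
  proof (rule extra[of X "\<lambda>_. 0"])
    show "X k = 0" if "m \<le> k" for k using that by (simp add: X_def)
    fix a assume a: "a \<in> ?I"
    have "(of_int (\<Sum>b\<in>F a. X b) :: rat) = (\<Sum>b\<in>F a. of_int D * c b)"
      unfolding of_int_sum by (rule sum.cong) (auto simp: X_def Fm z)
    also have "\<dots> = of_int D * s a" by (simp add: s_def sum_distrib_left)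
    also have "\<dots> = of_int 0" using s0[OF a] by simp
    finally have "(\<Sum>b\<in>F a. X b) = 0" by (simp only: of_int_eq_iff)
    then show "pairing C (\<lambda>_. 0) (fund C a) = 0 \<and> pairing C (\<lambda>_. 0) (root C a) = (\<Sum>b\<in>F a. X b)"
      by (simp add: pairing_def)
  qed
  also have "(\<Sum>k<m. c k * of_int (X k)) = (\<Sum>k<m. of_int D * (c k * c k))"
    by (rule sum.cong) (auto simp: X_def simp flip: z)
  finally have "(\<Sum>k<m. of_int D * (c k * c k)) = 0" .
  then have "\<forall>k\<in>{..<m}. of_int D * (c k * c k) = 0"
    using D(1) by (subst (asm) sum_nonneg_eq_0_iff) auto
  then show ?thesis using j D(1) by simp
qed

text \<open>
  The realization of the cover has unit vectors as coroots and fundamental weights; the roots have the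
  columns of \<open>B\<close> as their first coordinates and the entries of the \<open>K\<close> selected rows \<open>X j\<close> as the others.
\<close>

lemma folding_exists:
  obtains C' :: "nat cartan_datum" and \<phi> \<Psi>
  where "simply_laced C'" and "folding C d C' (\<lambda>_. 1) \<phi> \<Psi>"
proof (rule simply_laced_cover)
  let ?I = "idx C"
  fix m :: nat and \<phi> :: "nat \<Rightarrow> 'i" and B :: "nat \<Rightarrow> nat \<Rightarrow> int"
  assume onto: "\<phi> ` {..<m} = ?I"
    and sym: "\<And>i j. i < m \<Longrightarrow> j < m \<Longrightarrow> B i j = B j i"
    and diag: "\<And>i. B i i = 2"
    and off: "\<And>i j. i \<noteq> j \<Longrightarrow> B i j \<in> {0, -1}"
    and unconn: "\<And>i j. i \<noteq> j \<Longrightarrow> \<phi> i = \<phi> j \<Longrightarrow> B i j = 0"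
    and fold': "\<And>i a. i < m \<Longrightarrow> a \<in> ?I \<Longrightarrow> (\<Sum>j\<in>{j. j < m \<and> \<phi> j = a}. B i j) = cmat C (\<phi> i) a"
  define F where "F a = {b \<in> {..<m}. \<phi> b = a}" for a
  have Fm: "b \<in> F a \<longleftrightarrow> b < m \<and> \<phi> b = a" for a b by (simp add: F_def)
  have finF: "finite (F a)" for a by (simp add: F_def)
  have fold: "(\<Sum>j\<in>F a. B i j) = cmat C (\<phi> i) a" if "i < m" "a \<in> ?I" for i a
    using fold'[OF that] by (simp add: F_def)
  have \<phi>_in: "\<phi> b \<in> ?I" if "b < m" for b using onto that by auto
  have fibres: "(\<Sum>b<m. g b) = (\<Sum>a\<in>?I. \<Sum>b\<in>F a. g b)" for g :: "nat \<Rightarrow> rat"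
    unfolding F_def using onto by (intro sum.group[symmetric]) (auto simp: finite_idx)
  \<comment> \<open>only the index set and the matrix of \<open>C0\<close> matter; it serves to name the rank of \<open>B\<close>\<close>
  define C0 :: "nat cartan_datum" where "C0 = \<lparr>idx = {..<m}, cmat = B, lrank = 0,
     root = \<lambda>_ _. 0, coroot = \<lambda>_ _. 0, fund = \<lambda>_ _. 0\<rparr>"
  have C0: "idx C0 = {..<m}" "cmat C0 = B" by (simp_all add: C0_def)
  have fin0: "finite (idx C0)" by (simp add: C0)
  obtain J where J0: "J \<subseteq> idx C0" "card J = cmat_rank C0" "lin_indep J (idx C0) (\<lambda>b a. cmat C0 a b)"
    and w0: "\<And>b. b \<in> idx C0 - J \<Longrightarrow> \<exists>w :: nat \<Rightarrow> rat. w b = 1 \<and> (\<forall>a. a \<notin> insert b J \<longrightarrow> w a = 0) \<and>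
        (\<forall>a'\<in>idx C0. (\<Sum>a\<in>idx C0. w a * of_int (cmat C0 a' a)) = 0)"
    by (rule cmat_rank_basis[OF fin0]) (rule that)
  note J = J0[unfolded C0] and w_ex = w0[unfolded C0]
  have finJ: "finite J" using J(1) finite_subset by blast
  define fam :: "nat \<Rightarrow> nat \<Rightarrow> rat" where "fam b k = (if k < m then of_int (B k b) else 0)" for b k
  define adm where "adm X g \<longleftrightarrow> (\<forall>k\<ge>m. X k = 0) \<and>
      (\<forall>a\<in>?I. pairing C g (fund C a) = 0 \<and> pairing C g (root C a) = (\<Sum>b\<in>F a. X b))"
    for X :: "nat \<Rightarrow> int" and g
  define T :: "(nat \<Rightarrow> rat) set" where "T = {(\<lambda>k. of_int (X k)) | X. \<exists>g. adm X g}"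
  \<comment> \<open>orthogonality to the columns in \<open>J\<close> implies orthogonality to all columns\<close>
  have all_columns: "(\<Sum>k<m. c k * of_int (B k b)) = 0"
    if c: "\<And>b. b \<in> J \<Longrightarrow> (\<Sum>k<m. c k * of_int (B k b)) = 0" and b: "b < m" for c :: "nat \<Rightarrow> rat" and b
  proof (cases "b \<in> J")
    case False
    then obtain w :: "nat \<Rightarrow> rat" where w: "w b = 1" "\<And>a. a \<notin> insert b J \<Longrightarrow> w a = 0"
      "\<And>a'. a' < m \<Longrightarrow> (\<Sum>a<m. w a * of_int (B a' a)) = 0" using w_ex[of b] b by auto
    have "0 = (\<Sum>k<m. c k * (\<Sum>a<m. w a * of_int (B k a)))" using w(3) by simp
    also have "\<dots> = (\<Sum>k<m. \<Sum>a<m. w a * (c k * of_int (B k a)))"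
      by (simp add: sum_distrib_left mult.left_commute)
    also have "\<dots> = (\<Sum>a<m. \<Sum>k<m. w a * (c k * of_int (B k a)))" by (rule sum.swap)
    also have "\<dots> = (\<Sum>a<m. w a * (\<Sum>k<m. c k * of_int (B k a)))" by (simp only: sum_distrib_left)
    also have "\<dots> = (\<Sum>a<m. if a = b then \<Sum>k<m. c k * of_int (B k b) else 0)"
      by (rule sum.cong) (use w(1,2) c in auto)
    also have "\<dots> = (\<Sum>k<m. c k * of_int (B k b))" using b by simp
    finally show ?thesis by simp
  qed (rule c)
  have "\<exists>Xs. Xs \<subseteq> T \<and> finite Xs \<and> card Xs + card J = m \<and>
    (\<forall>c :: nat \<Rightarrow> rat. (\<forall>f\<in>fam ` J \<union> Xs. (\<Sum>k<m. c k * f k) = 0) \<longrightarrow> (\<forall>j<m. c j = 0))"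
  proof (rule complete_to_separating)
    show "finite J" by (rule finJ)
    show "c a = 0" if z: "\<And>k. (\<Sum>x\<in>J. c x * fam x k) = 0" and a: "a \<in> J" for c a
    proof (rule lin_indep_rat[OF J(3) finJ _ a])
      show "(\<Sum>a\<in>J. c a * of_int (B k a)) = 0" if "k \<in> {..<m}" for k
        using z[of k] that by (simp add: fam_def)
    qed
    show "f k = 0" if "f \<in> fam ` J \<union> T" "m \<le> k" for f k
      using that by (auto simp: fam_def T_def adm_def)
    fix c :: "nat \<Rightarrow> rat" and j
    assume orth: "\<And>f. f \<in> fam ` J \<union> T \<Longrightarrow> (\<Sum>k<m. c k * f k) = 0" and j: "j < m"
    have cols: "(\<Sum>k<m. c k * of_int (B k b)) = 0" if "b < m" for b
    proof (rule all_columns[OF _ that])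
      show "(\<Sum>k<m. c k * of_int (B k b)) = 0" if "b \<in> J" for b
        using orth[of "fam b"] that by (simp add: fam_def)
    qed
    show "c j = 0"
    proof (rule cover_separating[OF F_def onto sym fold cols _ j])
      fix X :: "nat \<Rightarrow> int" and g
      assume "\<And>k. m \<le> k \<Longrightarrow> X k = 0"
        and "\<And>a. a \<in> ?I \<Longrightarrow> pairing C g (fund C a) = 0 \<and> pairing C g (root C a) = (\<Sum>b\<in>F a. X b)"
      then have "adm X g" by (simp add: adm_def)
      then have "(\<lambda>k. of_int (X k)) \<in> T" by (auto simp: T_def)
      then show "(\<Sum>k<m. c k * of_int (X k)) = 0" by (intro orth) blast
    qed
  qed
  then obtain Xs where Xs: "Xs \<subseteq> T" "finite Xs" "card Xs + card J = m"
    and sepX: "\<forall>c :: nat \<Rightarrow> rat. (\<forall>f\<in>fam ` J \<union> Xs. (\<Sum>k<m. c k * f k) = 0) \<longrightarrow> (\<forall>j<m. c j = 0)"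
    by blast
  define K where "K = card Xs"
  obtain e where e: "bij_betw e {..<K} Xs"
    using ex_bij_betw_nat_finite[OF Xs(2)] by (auto simp: K_def atLeast0LessThan)
  have "\<forall>j\<in>{..<K}. \<exists>p. (\<forall>k. e j k = of_int (fst p k)) \<and> adm (fst p) (snd p)"
  proof
    fix j assume "j \<in> {..<K}"
    then have "e j \<in> T" using e Xs(1) by (auto simp: bij_betw_def)
    then obtain X g where "e j = (\<lambda>k. of_int (X k))" "adm X g" by (auto simp: T_def)
    then show "\<exists>p. (\<forall>k. e j k = of_int (fst p k)) \<and> adm (fst p) (snd p)"
      by (intro exI[of _ "(X, g)"]) simp
  qed
  from bchoice[OF this] obtain p where p: "\<And>j k. j < K \<Longrightarrow> e j k = of_int (fst (p j) k)"
      "\<And>j. j < K \<Longrightarrow> adm (fst (p j)) (snd (p j))" by blast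
  define X where "X j = fst (p j)" for j
  define g where "g j = snd (p j)" for j
  have g: "pairing C (g j) (fund C a) = 0" "pairing C (g j) (root C a) = (\<Sum>b\<in>F a. X j b)"
    if "j < K" "a \<in> ?I" for j a
    using p(2)[OF that(1)] that(2) by (auto simp: adm_def X_def g_def)
  have sep: "c k = 0"
    if cols: "\<And>b. b < m \<Longrightarrow> (\<Sum>k<m. c k * of_int (B k b)) = 0"
      and ex: "\<And>j. j < K \<Longrightarrow> (\<Sum>k<m. c k * of_int (X j k)) = 0" and k: "k < m" for c :: "nat \<Rightarrow> rat" and k
  proof (rule sepX[rule_format, OF _ k])
    fix f assume "f \<in> fam ` J \<union> Xs"
    then consider b where "b \<in> J" "f = fam b" | j where "j < K" "f = e j"
      using e by (auto simp: bij_betw_def)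
    then show "(\<Sum>k<m. c k * f k) = 0"
    proof cases
      case 1
      then show ?thesis using cols[of b] J(1) by (auto simp: fam_def)
    next
      case 2
      then show ?thesis using ex[of j] by (simp add: p(1) X_def)
    qed
  qed
  define C' :: "nat cartan_datum" where "C' = \<lparr>idx = {..<m}, cmat = B, lrank = m + K,
     root = \<lambda>b k. if k < m then B k b else if k < m + K then X (k - m) b else 0,
     coroot = \<lambda>b k. if k = b then 1 else 0, fund = \<lambda>b k. if k = b then 1 else 0\<rparr>"
  have C': "idx C' = {..<m}" "cmat C' = B" "lrank C' = m + K" "fibre C' \<phi> = F"
    "root C' b k = (if k < m then B k b else if k < m + K then X (k - m) b else 0)"
    "coroot C' b k = (if k = b then 1 else 0)" "fund C' b k = (if k = b then 1 else 0)" for b k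
    by (auto simp: C'_def fibre_def F_def)
  have rank: "cmat_rank C' = card J" using J(2) by (simp add: cmat_rank_def C'_def C0_def)
  have pairing': "pairing C' (coroot C' b) \<mu> = \<mu> b" if "b < m" for b \<mu>
  proof -
    have "pairing C' (coroot C' b) \<mu> = (\<Sum>k<m + K. if k = b then \<mu> b else 0)"
      unfolding pairing_def C' by (rule sum.cong) auto
    then show ?thesis using that by simp
  qed
  have gcm': "generalized_cartan_matrix {..<m} B"
    unfolding generalized_cartan_matrix_def
  proof (intro conjI ballI impI)
    show "B a a = 2" for a by (rule diag)
    fix a b assume ab: "a \<in> {..<m}" "b \<in> {..<m}" "a \<noteq> b"
    show "B a b \<le> 0" using off[OF ab(3)] by auto
    show "B a b = 0 \<longleftrightarrow> B b a = 0" using sym[of a b] ab by simp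
  qed
  have indep': "lin_indep {..<m} {..<m + K} (root C')"
    unfolding lin_indep_def
  proof (intro allI impI ballI)
    fix c :: "nat \<Rightarrow> int" and b
    assume z: "\<forall>k\<in>{..<m + K}. (\<Sum>b<m. c b * root C' b k) = 0" and b: "b \<in> {..<m}"
    have "(of_int (c b) :: rat) = 0"
    proof (rule sep[where c = "\<lambda>k. of_int (c k)"])
      fix i assume i: "i < m"
      have "(\<Sum>k<m. c k * B k i) = (\<Sum>b<m. c b * root C' b i)"
        by (rule sum.cong) (use i sym in \<open>auto simp: C'\<close>)
      then have "(\<Sum>k<m. c k * B k i) = 0" using z i by simp
      then have "(of_int (\<Sum>k<m. c k * B k i) :: rat) = 0" by simp
      then show "(\<Sum>k<m. of_int (c k) * of_int (B k i)) = (0::rat)" by simp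
    next
      fix j assume j: "j < K"
      have "(\<Sum>k<m. c k * X j k) = (\<Sum>b<m. c b * root C' b (m + j))"
        by (rule sum.cong) (use j in \<open>auto simp: C'\<close>)
      then have "(\<Sum>k<m. c k * X j k) = 0" using z j by simp
      then have "(of_int (\<Sum>k<m. c k * X j k) :: rat) = 0" by simp
      then show "(\<Sum>k<m. of_int (c k) * of_int (X j k)) = (0::rat)" by simp
    qed (use b in simp)
    then show "c b = 0" by simp
  qed
  have km': "symmetrizable_kac_moody C'"
    unfolding symmetrizable_kac_moody_def
  proof (intro conjI ballI)
    show "finite (idx C')" by (simp add: C')
    show "generalized_cartan_matrix (idx C') (cmat C')" using gcm' by (simp add: C')
    show "symmetrizable (idx C') (cmat C')"
      unfolding symmetrizable_def C' by (intro exI[of _ "\<lambda>_. 1"]) (use sym in simp)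
    show "root C' a \<in> weight_lattice C'" "fund C' a \<in> weight_lattice C'" "coroot C' a \<in> weight_lattice C'"
      if "a \<in> idx C'" for a using that by (auto simp: weight_lattice_def C')
    show "pairing C' (coroot C' a) (root C' b) = cmat C' a b" if "a \<in> idx C'" "b \<in> idx C'" for a b
      using that pairing' by (simp add: C')
    show "pairing C' (coroot C' a) (fund C' b) = (if a = b then 1 else 0)" if "a \<in> idx C'" "b \<in> idx C'" for a b
      using that pairing' by (simp add: C')
    show "lin_indep (idx C') {..<lrank C'} (root C')" using indep' by (simp add: C')
    show "lrank C' = 2 * card (idx C') - cmat_rank C'" using Xs(3) by (simp add: C' rank K_def)
  qed
  have sl: "simply_laced C'"
    unfolding simply_laced_def C' using sym off by auto
  have cartan': "kac_moody C' (\<lambda>_. 1)"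
    by unfold_locales (use gcm' sym km' in \<open>auto simp: C'\<close>)
  define \<Psi> :: "lvec \<Rightarrow> lvec" where "\<Psi> \<mu> = (\<lambda>k. if k < m then pairing C (coroot C (\<phi> k)) \<mu>
     else if k < m + K then pairing C (g (k - m)) \<mu> else 0)" for \<mu>
  have pairing_add: "pairing C h (\<lambda>k. \<mu> k + \<nu> k) = pairing C h \<mu> + pairing C h \<nu>" for h \<mu> \<nu>
    by (simp add: pairing_def algebra_simps sum.distrib)
  have inj: "inj_on \<Psi> (weight_lattice C)"
  proof (rule inj_onI)
    fix \<mu> \<nu> assume lat: "\<mu> \<in> weight_lattice C" "\<nu> \<in> weight_lattice C" and eq: "\<Psi> \<mu> = \<Psi> \<nu>"
    define \<delta> where "\<delta> = (\<lambda>k. \<mu> k - \<nu> k)"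
    have \<delta>: "\<delta> \<in> weight_lattice C" using lat by (simp add: weight_lattice_def \<delta>_def)
    have ann: "pairing C (coroot C a) \<delta> = 0" if a: "a \<in> ?I" for a
    proof -
      obtain b where "b < m" "\<phi> b = a" using a unfolding onto[symmetric] by auto
      then show ?thesis using fun_cong[OF eq, of b] by (simp add: \<Psi>_def \<delta>_def pairing_diff)
    qed
    have ann_g: "pairing C (g j) \<delta> = 0" if "j < K" for j
      using fun_cong[OF eq, of "m + j"] that by (simp add: \<Psi>_def \<delta>_def pairing_diff)
    obtain u :: "'i \<Rightarrow> rat" where u: "\<And>k. of_int (\<delta> k) = (\<Sum>a\<in>?I. u a * of_int (root C a k))"
      by (rule annihilator_in_root_span[OF \<delta> ann]) (assumption, rule that)
    note comb = pairing_rat_comb[where J = ?I and u = u and f = "root C", OF u]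
    \<comment> \<open>the coefficients, pulled back to the cover, are orthogonal to every row\<close>
    have pull: "(\<Sum>b<m. u (\<phi> b) * of_int (y b)) = (\<Sum>a\<in>?I. u a * of_int (\<Sum>b\<in>F a. y b))" for y :: "nat \<Rightarrow> int"
      unfolding fibres of_int_sum sum_distrib_left by (intro sum.cong refl) (auto simp: Fm)
    have u0: "u (\<phi> b) = 0" if "b < m" for b
    proof (rule sep[where c = "\<lambda>b. u (\<phi> b)", OF _ _ that])
      fix i assume i: "i < m"
      have "(\<Sum>k<m. u (\<phi> k) * of_int (B k i)) = (\<Sum>k<m. u (\<phi> k) * of_int (B i k))"
        by (rule sum.cong) (use i sym in auto)
      also have "\<dots> = (\<Sum>a\<in>?I. u a * of_int (pairing C (coroot C (\<phi> i)) (root C a)))"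
        unfolding pull by (rule sum.cong) (use i fold \<phi>_in pairing_root in auto)
      also have "\<dots> = 0" using comb[of "coroot C (\<phi> i)"] ann[OF \<phi>_in[OF i]] by simp
      finally show "(\<Sum>k<m. u (\<phi> k) * of_int (B k i)) = 0" .
    next
      fix j assume j: "j < K"
      have "(\<Sum>k<m. u (\<phi> k) * of_int (X j k)) = (\<Sum>a\<in>?I. u a * of_int (pairing C (g j) (root C a)))"
        unfolding pull by (rule sum.cong) (use j g(2) in auto)
      also have "\<dots> = 0" using comb[of "g j"] ann_g[OF j] by simp
      finally show "(\<Sum>k<m. u (\<phi> k) * of_int (X j k)) = 0" .
    qed
    have "u a = 0" if "a \<in> ?I" for a
      using that u0 unfolding onto[symmetric] by auto
    then have "(of_int (\<delta> k) :: rat) = 0" for k using u[of k] by simp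
    then show "\<mu> = \<nu>" by (simp add: \<delta>_def fun_eq_iff)
  qed
  have emb: "weight_embedding C C' \<phi> (\<lambda>_. 1) \<Psi>"
    unfolding weight_embedding_def C'(4)
  proof (intro conjI ballI)
    show "\<Psi> ` weight_lattice C \<subseteq> weight_lattice C'" by (auto simp: weight_lattice_def \<Psi>_def C')
    show "inj_on \<Psi> (weight_lattice C)" by (rule inj)
    show "\<Psi> (\<lambda>k. \<mu> k + \<nu> k) = (\<lambda>k. \<Psi> \<mu> k + \<Psi> \<nu> k)" for \<mu> \<nu>
      by (auto simp: \<Psi>_def pairing_add)
  next
    fix a assume a: "a \<in> ?I"
    show "\<Psi> (fund C a) = (\<lambda>k. int 1 * (\<Sum>b\<in>F a. fund C' b k))"
    proof
      fix k
      have "(\<Sum>b\<in>F a. fund C' b k) = (if k \<in> F a then 1 else 0)"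
        using finF by (simp add: C')
      then show "\<Psi> (fund C a) k = int 1 * (\<Sum>b\<in>F a. fund C' b k)"
        using g(1) a \<phi>_in by (auto simp: \<Psi>_def Fm pairing_fund)
    qed
    show "\<Psi> (root C a) = (\<lambda>k. int 1 * (\<Sum>b\<in>F a. root C' b k))"
      using g(2) a \<phi>_in fold by (auto simp: \<Psi>_def C' pairing_root fun_eq_iff)
  qed
  interpret cod: kac_moody C' "\<lambda>_. 1" by (rule cartan')
  have "folding C d C' (\<lambda>_. 1) \<phi> \<Psi>"
  proof unfold_locales
    show "\<phi> ` idx C' = idx C" using onto by (simp add: C')
    show "cmat C' b b' = 0" if "b \<noteq> b'" "\<phi> b = \<phi> b'" for b b'
      using unconn[OF that] by (simp add: C')
    show "(\<Sum>b'\<in>fibre C' \<phi> a. cmat C' b b') = cmat C (\<phi> b) a" if "b \<in> idx C'" "a \<in> idx C" for a b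
      using fold that by (simp add: C')
    show "weight_embedding C C' \<phi> (\<lambda>_. 1) \<Psi>" by (rule emb)
    show "pairing C' (coroot C' b) (\<Psi> \<mu>) = pairing C (coroot C (\<phi> b)) \<mu>" if "b \<in> idx C'" for b \<mu>
      using that pairing' by (simp add: C'(1)) (simp add: \<Psi>_def)
  qed
  then show thesis using sl that by blast
qed

end

theorem mainTheorem2:
  fixes C :: "'i cartan_datum"
  assumes "symmetrizable_kac_moody C"
  shows "\<exists>(C' :: nat cartan_datum) (\<phi> :: nat \<Rightarrow> 'i) (\<gamma> :: 'i \<Rightarrow> nat) (\<Psi> :: lvec \<Rightarrow> lvec).
           symmetrizable_kac_moody C' \<and> simply_laced C' \<and>
           diagram_folding C C' \<phi> \<gamma> \<and> weight_embedding C C' \<phi> \<gamma> \<Psi> \<and>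
           (\<forall>\<Lambda>\<in>dominant_infty C.
              virtualizes C C' \<phi> \<gamma> \<Psi> (RC C \<Lambda>) (RC C' (virtual_weight \<Psi> \<Lambda>))
                (virtualization_map C' \<phi> \<gamma>))"
proof -
  obtain d where "\<forall>a\<in>idx C. 0 < d a" "\<forall>a\<in>idx C. \<forall>b\<in>idx C. d a * cmat C a b = d b * cmat C b a"
    using assms by (auto simp: symmetrizable_kac_moody_def symmetrizable_def)
  then interpret kac_moody C d
    by unfold_locales (use assms in \<open>auto simp: symmetrizable_kac_moody_def\<close>)
  obtain C' :: "nat cartan_datum" and \<phi> \<Psi>
    where sl: "simply_laced C'" and fold: "folding C d C' (\<lambda>_. 1) \<phi> \<Psi>"
    by (rule folding_exists)
  interpret folding C d C' "\<lambda>_. 1" \<phi> \<Psi> by (rule fold)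
  have "diagram_folding C C' \<phi> (\<lambda>_. 1)"
    unfolding diagram_folding_def using onto unconnected by simp
  then show ?thesis
    using cod.km sl embedding RC_virtualizes by blast
qed

end
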